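(* Let $E$ and $S$ be Polish spaces endowed with filtrations $(\mathcal{B}_t(E))_{t\in I}$, $(\mathcal{B}_t(S))_{t\in I}$ of their Borel sigma-fields indexed by a same totally ordered set $I$. Let $c:E\times S\to\mathbb{R}\cup\{+\infty\}$ be a non-negative lower semi-continuous map and let $e:E\times S\to Z$ be a continuous map with values in a third Polish space $Z$. For $\eta\in\mathcal{P}_E$ and $\widetilde\mu\in\mathcal{P}_Z$ define the primal problems $$P_\eta:=\inf\left\{\int_{E\times S}c\,d\gamma:\gamma\in\mathcal{P}^S_c(\eta)\right\},\qquad P^e_{\eta,\widetilde\mu}:=\inf\left\{\int_{E\times S}c\,d\gamma:\gamma\in\mathcal{P}^S_c(\eta),\ e_\star\gamma=\widetilde\mu\right\},$$ and the dual problems $$D_\eta:=\sup\left\{a:(a,h)\in\mathbb{R}\times\mathcal{H}_\eta,\ a+h(x,y)\le c(x,y)\ \forall(x,y)\in E\times S\right\},$$ $$D^e_{\eta,\widetilde\mu}:=\sup\left\{\int_Z g\,d\widetilde\mu:(g,h)\in C_b(Z)\times\mathcal{H}_\eta,\ h(x,y)+g(e(x,y))\le c(x,y)\ \forall(x,y)\in E\times S\right\}.$$ Assume further that $S$ is compact for its Polish topology and that $(\mathcal{B}_t(S))_{t\in I}$ is a regular filtration. Then the infimum defining $P_\eta$ is always attained and $D_\eta=P_\eta$. Moreover, if $P^e_{\eta,\widetilde\mu}<\infty$, then the infimum defining $P^e_{\eta,\widetilde\mu}$ is attained and $D^e_{\eta,\widetilde\mu}=P^e_{\eta,\widetilde\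mu}$.
   Context: A filtration $(\mathcal{B}_t(E))_{t\in I}$ of $\mathcal{B}(E)$ is a family of sigma-fields with $\mathcal{B}_s(E)\subset\mathcal{B}_t(E)\subset\mathcal{B}(E)$ for $s\le t$ (similarly on $S$). $\mathcal{P}_Z$ is the set of Borel probabilities on a Polish space $Z$; $e_\star\gamma$ is the pushforward. For a sigma-field $\mathcal{G}\subset\mathcal{B}(E)$, $\mathcal{G}^\eta$ is its $\eta$-completion (generated by $\mathcal{G}$ and the $\eta$-negligible sets). $\Pi(\eta,\nu)$ is the set of Borel probabilities on $E\times S$ with marginals $\eta$ and $\nu$. Regular filtration: $(\mathcal{B}_t(S))_{t\in I}$ is regular if there is a family $(\rho_t)_{t\in I}$ of continuous maps $\rho_t:S\to S$ with $\mathcal{B}_t(S)=\rho_t^{-1}(\mathcal{B}(S))$ for all $t\in I$, $\rho_s\circ\rho_t=\rho_{\min(s,t)}$ for all $s,t\in I$, and $\rho_{t_f}=\mathrm{Id}_S$ for some $t_f\in I$. A kernel associated to $\gamma\in\Pi(\eta,\nu)$ is a map $\Theta_\gamma:E\times\mathcal{B}(S)\to\mathbb{R}$ with $\Theta^x_\gamma\in\mathcal{P}_S$ for all $x$, $x\mapsto\Theta^x_\gamma(B)$ Borel for all $B$, and $\gamma(A\times B)=\int_A\Theta^x_\gamma(B)\,d\eta(x)$ for all $A\in\mathcal{B}(E),B\in\mathcal{B}(S)$. For $t\in I$, $\mathcal{G}_t(\gamma)$ is the $\eta$-completion of the smallest sigma-field on $E$ making $x\mapsto\Theta^x_\gamma(C)$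 measurable for every $C\in\mathcal{B}_t(S)$ with $\nu(\partial C)=0$. Causal transference plans: $\Pi_c(\eta,\nu)=\{\gamma\in\Pi(\eta,\nu):\mathcal{G}_t(\gamma)\subset\mathcal{B}_t(E)^\eta\ \text{for all }t\in I\}$, and $\mathcal{P}^S_c(\eta):=\bigcup_{\nu\in\mathcal{P}_S}\Pi_c(\eta,\nu)$. Definition of $\mathcal{H}_\eta$: add a symbol $t_0\notin I$ with $\mathcal{B}_{t_0}(S)=\{\emptyset,S\}$, $\mathcal{B}_{t_0}(E)=\{\emptyset,E\}$. $\mathcal{H}_\eta$ is the set of Borel maps $h:E\times S\to\mathbb{R}$ of the form $h(x,y)=\sum_{i=1}^N g_i(x)1_{A_i}(y)$ with $N\in\mathbb{N}$, such that for some $t_1,\dots,t_N\in I\cup\{t_0\}$ and all $i=1,\dots,N$: $A_i\in\mathcal{B}_{t_i}(S)$; and $g_i:E\to\mathbb{R}$ is a bounded measurable map such that $g_i=X_i-E_\eta[X_i\mid\mathcal{B}_{t_i}(E)^\eta]$ $\eta$-a.s. for some $X_i\in L^\infty(\eta)$. The infimum of the empty set is $+\infty$. *)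

theory Defs
  imports "HOL-Probability.Probability"
begin

text \<open>
  Sigma-fields on a type are represented by measures with space \<^term>\<open>UNIV\<close>, of which only
  \<^const>\<open>sets\<close> is relevant. The Borel probabilities on a Polish space are
  \<^term>\<open>space (prob_algebra borel)\<close>.
\<close>

(* The locale filtration of HOL-Probability demands a second countable order topology on the
   index type; here the index set is an arbitrary totally ordered set. *)
definition borel_filtration :: "('i::linorder \<Rightarrow> 'a::topological_space measure) \<Rightarrow> bool" where
  "borel_filtration F \<longleftrightarrow>
     (\<forall>t. subalgebra borel (F t)) \<and> (\<forall>s t. s \<le> t \<longrightarrow> sets (F s) \<subseteq> sets (F t))"

definition regular_filtration :: "('i::linorder \<Rightarrow> 'a::topological_space measure) \<Rightarrow> bool" where
  "regular_filtration F \<longleftrightarrow>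
     (\<exists>\<rho> :: 'i \<Rightarrow> 'a \<Rightarrow> 'a.
        (\<forall>t. continuous_on UNIV (\<rho> t)) \<and>
        (\<forall>t. sets (F t) = {\<rho> t -` B | B. B \<in> sets borel}) \<and>
        (\<forall>s t. \<rho> s \<circ> \<rho> t = \<rho> (min s t)) \<and>
        (\<exists>t\<^sub>f. \<rho> t\<^sub>f = id))"

(* The null sets of the completion of eta are exactly the subsets of Borel eta-null sets. *)
definition completed_by :: "'a measure \<Rightarrow> 'a measure \<Rightarrow> 'a measure" where
  "completed_by \<eta> G = sigma UNIV (sets G \<union> null_sets (completion \<eta>))"

definition transference_plans ::
  "'e::polish_space measure \<Rightarrow> 's::polish_space measure \<Rightarrow> ('e \<times> 's) measure set" where
  "transference_plans \<eta> \<nu> =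
     {\<gamma> \<in> space (prob_algebra borel). distr \<gamma> borel fst = \<eta> \<and> distr \<gamma> borel snd = \<nu>}"

definition associated_kernel ::
  "'e::polish_space measure \<Rightarrow> ('e \<times> 's::polish_space) measure \<Rightarrow> ('e \<Rightarrow> 's measure) \<Rightarrow> bool" where
  "associated_kernel \<eta> \<gamma> \<Theta> \<longleftrightarrow>
     (\<forall>x. \<Theta> x \<in> space (prob_algebra borel)) \<and>
     (\<forall>B\<in>sets borel. (\<lambda>x. measure (\<Theta> x) B) \<in> borel_measurable borel) \<and>
     (\<forall>A\<in>sets borel. \<forall>B\<in>sets borel.
        measure \<gamma> (A \<times> B) = (LINT x:A|\<eta>. measure (\<Theta> x) B))"

definition kernel_sigma_field ::
  "('i::linorder \<Rightarrow> 's::polish_space measure) \<Rightarrow> 'e::polish_space measure \<Rightarrow> 's measure \<Rightarrow>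
   ('e \<Rightarrow> 's measure) \<Rightarrow> 'i \<Rightarrow> 'e measure" where
  "kernel_sigma_field BS \<eta> \<nu> \<Theta> t =
     completed_by \<eta> (sigma UNIV
       {(\<lambda>x. measure (\<Theta> x) C) -` B | B C.
          B \<in> sets borel \<and> C \<in> sets (BS t) \<and> measure \<nu> (frontier C) = 0})"

(* Kernels associated to gamma exist and are eta-a.s. unique, so the completed sigma-field does
   not depend on the kernel chosen. *)
definition causal_plans ::
  "('i::linorder \<Rightarrow> 'e::polish_space measure) \<Rightarrow> ('i \<Rightarrow> 's::polish_space measure) \<Rightarrow>
   'e measure \<Rightarrow> 's measure \<Rightarrow> ('e \<times> 's) measure set" where
  "causal_plans BE BS \<eta> \<nu> =
     {\<gamma> \<in> transference_plans \<eta> \<nu>.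
        \<exists>\<Theta>. associated_kernel \<eta> \<gamma> \<Theta> \<and>
            (\<forall>t. sets (kernel_sigma_field BS \<eta> \<nu> \<Theta> t) \<subseteq> sets (completed_by \<eta> (BE t)))}"

definition causal_plans_from ::
  "('i::linorder \<Rightarrow> 'e::polish_space measure) \<Rightarrow> ('i \<Rightarrow> 's::polish_space measure) \<Rightarrow>
   'e measure \<Rightarrow> ('e \<times> 's) measure set" where
  "causal_plans_from BE BS \<eta> = (\<Union>\<nu>\<in>space (prob_algebra borel). causal_plans BE BS \<eta> \<nu>)"

(* None is the additional index t0, carrying the trivial sigma-field. *)
definition adjoin_trivial :: "('i \<Rightarrow> 'a measure) \<Rightarrow> 'i option \<Rightarrow> 'a measure" where
  "adjoin_trivial F t = (case t of None \<Rightarrow> sigma UNIV {{}, UNIV} | Some s \<Rightarrow> F s)"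

definition causal_test_functions ::
  "('i::linorder \<Rightarrow> 'e::polish_space measure) \<Rightarrow> ('i \<Rightarrow> 's::polish_space measure) \<Rightarrow>
   'e measure \<Rightarrow> ('e \<times> 's \<Rightarrow> real) set" where
  "causal_test_functions BE BS \<eta> =
     {h \<in> borel_measurable borel.
        \<exists>(N::nat) (g :: nat \<Rightarrow> 'e \<Rightarrow> real) (A :: nat \<Rightarrow> 's set) (t :: nat \<Rightarrow> 'i option).
          (\<forall>x y. h (x, y) = (\<Sum>i\<in>{1..N}. g i x * indicator (A i) y)) \<and>
          (\<forall>i\<in>{1..N}.
             A i \<in> sets (adjoin_trivial BS (t i)) \<and>
             g i \<in> borel_measurable borel \<and> bounded (range (g i)) \<and>
             (\<exists>X \<in> borel_measurable \<eta>. (\<exists>K. AE x in \<eta>. \<bar>X x\<bar> \<le> K) \<and>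
                (AE x in \<eta>. g i x = X x -
                   real_cond_exp (completion \<eta>) (completed_by \<eta> (adjoin_trivial BE (t i))) X x)))}"

definition lower_semicontinuous :: "('a::topological_space \<Rightarrow> ennreal) \<Rightarrow> bool" where
  "lower_semicontinuous f \<longleftrightarrow> (\<forall>a. open {x. a < f x})"

(* Infima in ennreal and suprema in ereal: the infimum of the empty set is \<infinity>. *)

definition primal_value ::
  "('i::linorder \<Rightarrow> 'e::polish_space measure) \<Rightarrow> ('i \<Rightarrow> 's::polish_space measure) \<Rightarrow>
   ('e \<times> 's \<Rightarrow> ennreal) \<Rightarrow> 'e measure \<Rightarrow> ennreal" where
  "primal_value BE BS c \<eta> = Inf {\<integral>\<^sup>+ p. c p \<partial>\<gamma> | \<gamma>. \<gamma> \<in> causal_plans_from BE BS \<eta>}"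

definition primal_value_target ::
  "('i::linorder \<Rightarrow> 'e::polish_space measure) \<Rightarrow> ('i \<Rightarrow> 's::polish_space measure) \<Rightarrow>
   ('e \<times> 's \<Rightarrow> ennreal) \<Rightarrow> ('e \<times> 's \<Rightarrow> 'z::polish_space) \<Rightarrow> 'e measure \<Rightarrow> 'z measure \<Rightarrow> ennreal" where
  "primal_value_target BE BS c e \<eta> \<mu> =
     Inf {\<integral>\<^sup>+ p. c p \<partial>\<gamma> | \<gamma>. \<gamma> \<in> causal_plans_from BE BS \<eta> \<and> distr \<gamma> borel e = \<mu>}"

definition dual_value ::
  "('i::linorder \<Rightarrow> 'e::polish_space measure) \<Rightarrow> ('i \<Rightarrow> 's::polish_space measure) \<Rightarrow>
   ('e \<times> 's \<Rightarrow> ennreal) \<Rightarrow> 'e measure \<Rightarrow> ereal" where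
  "dual_value BE BS c \<eta> =
     Sup {ereal a | a h. h \<in> causal_test_functions BE BS \<eta> \<and>
            (\<forall>x y. ereal (a + h (x, y)) \<le> enn2ereal (c (x, y)))}"

definition dual_value_target ::
  "('i::linorder \<Rightarrow> 'e::polish_space measure) \<Rightarrow> ('i \<Rightarrow> 's::polish_space measure) \<Rightarrow>
   ('e \<times> 's \<Rightarrow> ennreal) \<Rightarrow> ('e \<times> 's \<Rightarrow> 'z::polish_space) \<Rightarrow> 'e measure \<Rightarrow> 'z measure \<Rightarrow> ereal" where
  "dual_value_target BE BS c e \<eta> \<mu> =
     Sup {ereal (LINT z|\<mu>. g z) | g h. g \<in> bcontfun \<and> h \<in> causal_test_functions BE BS \<eta> \<and>
            (\<forall>x y. ereal (h (x, y) + g (e (x, y))) \<le> enn2ereal (c (x, y)))}"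

end

theory Submission
  imports Defs
begin

text \<open>
Let \<open>D\<close> be the dual value and suppose that it is finite. The functional sending a bounded function
\<open>f\<close> to the infimum of \<open>\<integral>g d\<mu> + s D\<close>, taken over \<open>f \<le> h + g \<circ> e + s c\<close> with \<open>h\<close> a test function, \<open>g\<close>
bounded continuous and \<open>s \<ge> 0\<close>, is sublinear. By Hahn-Banach it dominates a linear functional \<open>L\<close>,
which is positive, has first marginal \<open>\<eta>\<close>, vanishes on test functions, satisfies
\<open>L (g \<circ> e) = \<integral>g d\<mu>\<close>, and is at most \<open>D\<close> on every bounded function below \<open>c\<close>. Compactness of \<open>S\<close>
replaces any topology on plans: \<open>L\<close> is represented by a plan \<open>\<gamma>\<close> on functions continuous in the second
variable, and Fatou's lemma gives \<open>\<integral>c d\<gamma> \<le> D\<close> because \<open>c\<close> is lower semi-continuous.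

To construct \<open>\<gamma>\<close> with its kernel, cut \<open>S\<close> successively along the sets of a countable base. The masses
that \<open>L\<close> gives to the cells have densities with respect to \<open>\<eta>\<close>, and these are the lengths of nested
intervals in \<open>[0,1)\<close> depending on \<open>x\<close>; a uniform variable selects a decreasing sequence of cells, which shrinks
to a point of \<open>S\<close>.

Regularity of the filtration reduces causality of \<open>\<gamma>\<close>, and the vanishing of test functions under a causal
plan, to functions \<open>v \<circ> \<rho>\<^sub>t\<close> with \<open>v\<close> continuous. The problem without target is the one with \<open>e\<close>
constant.
\<close>

section \<open>Linear functionals dominated by sublinear ones\<close>

text \<open>Hahn-Banach is run on all bounded functions, so no measurability or continuity enters
  there; the price is that \<open>L\<close> is only finitely additive. Limits in \<open>x\<close>
  are recovered from the marginal \<open>\<eta>\<close>, which dominates the mass of every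
  rectangle; limits in \<open>y\<close> come from the shrinking of cells in the compact space. The
  obstacle is that test functions are built from \<open>g(x) 1_A(y)\<close>, discontinuous in
  \<open>y\<close>, whereas \<open>\<gamma>\<close> is known to agree with \<open>L\<close> only on
  functions continuous in \<open>y\<close>. The bridge has three stages. Finite additivity and
  uniform approximation carry the vanishing of \<open>L\<close> from \<open>g 1_A\<close> to
  \<open>g v\<close> for all bounded \<open>v\<close> measurable for \<open>BS t\<close>. For
  continuous \<open>v\<close> the value is then also that of \<open>\<gamma>\<close>. Regularity
  provides enough such \<open>v\<close>, namely continuous functions of
  \<open>\<rho>\<^sub>t\<close>, to return to all sets of \<open>BS t\<close> by dominated
  convergence, which is legitimate for the measure \<open>\<gamma>\<close> but not for
  \<open>L\<close>.\<close>

definition bounded_functions :: "('a \<Rightarrow> real) set" where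
  "bounded_functions = {f. bounded (range f)}"

lemma bounded_functions_iff: "f \<in> bounded_functions \<longleftrightarrow> (\<exists>M. \<forall>x. \<bar>f x\<bar> \<le> M)"
  by (auto simp: bounded_functions_def bounded_iff)

lemma bounded_functionsI: "(\<And>x. \<bar>f x\<bar> \<le> M) \<Longrightarrow> f \<in> bounded_functions"
  by (auto simp: bounded_functions_iff)

lemma bounded_functions_add [simp]:
  assumes "f \<in> bounded_functions" "g \<in> bounded_functions"
  shows "(\<lambda>x. f x + g x) \<in> bounded_functions"
proof -
  obtain M N where "\<And>x. \<bar>f x\<bar> \<le> M" "\<And>x. \<bar>g x\<bar> \<le> N"
    using assms by (auto simp: bounded_functions_iff)
  then have "\<bar>f x + g x\<bar> \<le> M + N" for x
    by (meson abs_triangle_ineq add_mono order_trans)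
  then show ?thesis
    by (rule bounded_functionsI)
qed

lemma bounded_functions_mult [simp]:
  assumes "f \<in> bounded_functions" "g \<in> bounded_functions"
  shows "(\<lambda>x. f x * g x) \<in> bounded_functions"
proof -
  obtain M N where "\<And>x. \<bar>f x\<bar> \<le> M" "\<And>x. \<bar>g x\<bar> \<le> N"
    using assms by (auto simp: bounded_functions_iff)
  then have "\<bar>f x * g x\<bar> \<le> M * N" for x
    unfolding abs_mult by (intro mult_mono) (auto intro: order_trans[OF abs_ge_zero])
  then show ?thesis
    by (rule bounded_functionsI)
qed

lemma bounded_functions_const [simp]: "(\<lambda>x. a) \<in> bounded_functions"
  by (auto simp: bounded_functions_iff)

lemma bounded_functions_indicator [simp]: "indicator A \<in> bounded_functions"
  by (auto simp: bounded_functions_iff indicator_def intro!: exI[of _ 1])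

lemma bounded_functions_minus [simp]: "f \<in> bounded_functions \<Longrightarrow> (\<lambda>x. - f x) \<in> bounded_functions"
  by (auto simp: bounded_functions_iff)

lemma bounded_functions_diff [simp]:
  "f \<in> bounded_functions \<Longrightarrow> g \<in> bounded_functions \<Longrightarrow> (\<lambda>x. f x - g x) \<in> bounded_functions"
  using bounded_functions_add[OF _ bounded_functions_minus, of f g] by simp

lemma bounded_functions_sum [simp]:
  "(\<And>i. i \<in> I \<Longrightarrow> f i \<in> bounded_functions) \<Longrightarrow> (\<lambda>x. \<Sum>i\<in>I. f i x) \<in> bounded_functions"
  by (induction I rule: infinite_finite_induct) auto

lemma bounded_functions_comp:
  "f \<in> bounded_functions \<Longrightarrow> (\<lambda>x. f (k x)) \<in> bounded_functions"
  by (auto simp: bounded_functions_iff)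

lemma bounded_functions_product:
  "g \<in> bounded_functions \<Longrightarrow> w \<in> bounded_functions \<Longrightarrow> (\<lambda>p. g (fst p) * w (snd p)) \<in> bounded_functions"
  by (intro bounded_functions_mult bounded_functions_comp[of g fst] bounded_functions_comp[of w snd])

lemma bounded_functions_scale [simp]:
  "f \<in> bounded_functions \<Longrightarrow> (\<lambda>x. a * f x) \<in> bounded_functions"
  by (intro bounded_functions_mult) auto

section \<open>Sublinear functionals and the Hahn-Banach theorem\<close>

definition sublinear :: "(('a \<Rightarrow> real) \<Rightarrow> real) \<Rightarrow> bool" where
  "sublinear q \<longleftrightarrow>
     (\<forall>f\<in>bounded_functions. \<forall>g\<in>bounded_functions. q (\<lambda>x. f x + g x) \<le> q f + q g) \<and>
     (\<forall>f\<in>bounded_functions. \<forall>a>0. q (\<lambda>x. a * f x) \<le> a * q f)"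

lemma sublinear_add:
  "sublinear q \<Longrightarrow> f \<in> bounded_functions \<Longrightarrow> g \<in> bounded_functions \<Longrightarrow> q (\<lambda>x. f x + g x) \<le> q f + q g"
  by (auto simp: sublinear_def)

text \<open>Homogeneity is defined as one inequality; using it again with the factor
  \<open>inverse a\<close> gives the other.\<close>

lemma sublinear_scale:
  assumes q: "sublinear q" "f \<in> bounded_functions" and a: "a > 0"
  shows "q (\<lambda>x. a * f x) = a * q f"
proof (rule antisym)
  show "q (\<lambda>x. a * f x) \<le> a * q f"
    using assms by (auto simp: sublinear_def)
  have "q (\<lambda>x. inverse a * (a * f x)) \<le> inverse a * q (\<lambda>x. a * f x)"
    using q(1) bounded_functions_scale[OF q(2), of a] a by (auto simp: sublinear_def simp del: bounded_functions_scale)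
  then show "a * q f \<le> q (\<lambda>x. a * f x)"
    using a by (simp add: field_simps)
qed

lemma sublinear_zero: "sublinear q \<Longrightarrow> q (\<lambda>x. 0) = 0"
  using sublinear_scale[of q "\<lambda>x. 0" 2] by simp

lemma sublinear_minus: "sublinear q \<Longrightarrow> f \<in> bounded_functions \<Longrightarrow> - q (\<lambda>x. - f x) \<le> q f"
  using sublinear_add[of q f "\<lambda>x. - f x"] sublinear_zero[of q] bounded_functions_minus[of f] by auto

definition linear_functional :: "(('a \<Rightarrow> real) \<Rightarrow> real) \<Rightarrow> bool" where
  "linear_functional L \<longleftrightarrow>
     (\<forall>f\<in>bounded_functions. \<forall>g\<in>bounded_functions. L (\<lambda>x. f x + g x) = L f + L g) \<and>
     (\<forall>f\<in>bounded_functions. \<forall>a. L (\<lambda>x. a * f x) = a * L f)"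

text \<open>Supplies the bound of a chain in Zorn's lemma. Subadditivity holds because two members
  \<open>q\<close> and \<open>r\<close> can be replaced by the smaller of them; the common bound
  \<open>p\<close> yields the lower bound \<open>- p (\<lambda>x. - f x)\<close>, which keeps the
  infimum finite.\<close>

lemma INF_sublinear:
  assumes C: "C \<noteq> {}" "\<And>q. q \<in> C \<Longrightarrow> sublinear q"
    and p: "\<And>q f. q \<in> C \<Longrightarrow> f \<in> bounded_functions \<Longrightarrow> q f \<le> p f"
    and chain: "\<And>q r. q \<in> C \<Longrightarrow> r \<in> C \<Longrightarrow> (\<forall>f. q f \<le> r f) \<or> (\<forall>f. r f \<le> q f)"
    and u: "\<And>f. f \<in> bounded_functions \<Longrightarrow> u f = (INF q\<in>C. q f)"
  shows "sublinear u" and "\<And>q f. q \<in> C \<Longrightarrow> f \<in> bounded_functions \<Longrightarrow> u f \<le> q f"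
proof -
  have bdd: "bdd_below ((\<lambda>q. q f) ` C)" if "f \<in> bounded_functions" for f
  proof (rule bdd_belowI2)
    fix q assume "q \<in> C"
    then show "- p (\<lambda>x. - f x) \<le> q f"
      using sublinear_minus[of q f] p[of q "\<lambda>x. - f x"] C(2)[of q] that by simp
  qed
  show le: "u f \<le> q f" if "q \<in> C" "f \<in> bounded_functions" for q f
    unfolding u[OF that(2)] using bdd that by (intro cINF_lower)
  have "u (\<lambda>x. f x + g x) \<le> u f + u g" if f: "f \<in> bounded_functions" and g: "g \<in> bounded_functions" for f g
  proof -
    have *: "u (\<lambda>x. f x + g x) \<le> q f + r g" if qr: "q \<in> C" "r \<in> C" for q r
    proof -
      obtain s where s: "s \<in> C" "\<And>f. s f \<le> q f" "\<And>f. s f \<le> r f"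
        using chain[OF qr] qr by auto
      have "u (\<lambda>x. f x + g x) \<le> s (\<lambda>x. f x + g x)"
        using le s f g by auto
      also have "\<dots> \<le> s f + s g"
        using C s f g by (intro sublinear_add) auto
      finally show ?thesis
        using s(2)[of f] s(3)[of g] by simp
    qed
    then have "u (\<lambda>x. f x + g x) - q f \<le> u g" if "q \<in> C" for q
      unfolding u[OF g] using C(1) *[OF that] by (intro cINF_greatest) (auto simp: algebra_simps)
    then have "u (\<lambda>x. f x + g x) - u g \<le> u f"
      unfolding u[OF f] using C by (intro cINF_greatest) (auto simp: algebra_simps)
    then show ?thesis
      by simp
  qed
  moreover have "u (\<lambda>x. a * f x) \<le> a * u f" if f: "f \<in> bounded_functions" and a: "a > 0" for f a
  proof -
    have "u (\<lambda>x. a * f x) / a \<le> u f"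
      unfolding u[OF f]
    proof (intro cINF_greatest)
      fix q assume q: "q \<in> C"
      have "u (\<lambda>x. a * f x) \<le> q (\<lambda>x. a * f x)"
        using q f by (intro le) auto
      also have "\<dots> = a * q f"
        using C q f a by (intro sublinear_scale) auto
      finally show "u (\<lambda>x. a * f x) / a \<le> q f"
        using a by (simp add: field_simps)
    qed (use C in auto)
    then show ?thesis
      using a by (simp add: field_simps)
  qed
  ultimately show "sublinear u"
    by (auto simp: sublinear_def)
qed

text \<open>A sublinear functional that is minimal in the pointwise order is linear: for fixed \<open>y\<close>,
  the functional \<open>\<lambda>x. INF t. q (x + t y) - t q y\<close> is sublinear and at most \<open>q\<close>, so it equals
  \<open>q\<close>, and \<open>t = 1\<close> gives superadditivity.\<close>

lemma minimal_sublinear_linear: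
  assumes q: "sublinear q" "\<And>f. f \<notin> bounded_functions \<Longrightarrow> q f = 0"
    and minimal: "\<And>r. sublinear r \<Longrightarrow> (\<And>f. r f \<le> q f) \<Longrightarrow> (\<And>f. f \<notin> bounded_functions \<Longrightarrow> r f = 0) \<Longrightarrow> r = q"
  shows "linear_functional q"
proof -
  have add: "q (\<lambda>x. f x + y x) = q f + q y" if f: "f \<in> bounded_functions" and y: "y \<in> bounded_functions" for f y
  proof -
    define k where "k f t = q (\<lambda>x. f x + t * y x) - t * q y" for f t
    define r where "r f = (if f \<in> bounded_functions then (INF t\<in>{0..}. k f t) else 0)" for f
    have ty: "q (\<lambda>x. t * y x) = t * q y" if "t \<ge> 0" for t
      using sublinear_scale[OF q(1) y, of t] sublinear_zero[OF q(1)] that by (cases "t = 0") auto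
    \<comment> \<open>Subadditivity cancels \<open>f\<close> against \<open>- f\<close>; the
      resulting bound does not depend on \<open>t\<close>, so the infimum over \<open>t\<close> is
      finite.\<close>
    have low: "k f t \<ge> - q (\<lambda>x. - f x)" if "f \<in> bounded_functions" "t \<ge> 0" for f t
    proof -
      have "q (\<lambda>x. (f x + t * y x) + (- f x)) \<le> q (\<lambda>x. f x + t * y x) + q (\<lambda>x. - f x)"
        using that y by (intro sublinear_add[OF q(1)]) auto
      then show ?thesis
        using ty[OF that(2)] by (simp add: k_def)
    qed
    have bdd: "bdd_below (k f ` {0..})" if "f \<in> bounded_functions" for f
      using low[OF that] by (intro bdd_belowI2) auto
    have upper: "r f \<le> k f t" if "f \<in> bounded_functions" "t \<ge> 0" for f t
      using that bdd by (auto simp: r_def intro!: cINF_lower)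
    have lower: "z \<le> r f" if "f \<in> bounded_functions" "\<And>t. t \<ge> 0 \<Longrightarrow> z \<le> k f t" for f z
      using that by (auto simp: r_def intro!: cINF_greatest)
    have "sublinear r"
      unfolding sublinear_def
    proof (intro conjI ballI allI impI)
      fix f g :: "'a \<Rightarrow> real"
      assume f: "f \<in> bounded_functions" and g: "g \<in> bounded_functions"
      have "r (\<lambda>x. f x + g x) \<le> k f s + k g t" if "s \<ge> 0" "t \<ge> 0" for s t
      proof -
        have "r (\<lambda>x. f x + g x) \<le> k (\<lambda>x. f x + g x) (s + t)"
          using f g that by (intro upper) auto
        also have "\<dots> \<le> k f s + k g t"
          using sublinear_add[OF q(1), of "\<lambda>x. f x + s * y x" "\<lambda>x. g x + t * y x"] f g y
          by (simp add: k_def bounded_functions_add bounded_functions_mult algebra_simps)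
        finally show ?thesis .
      qed
      then have "r (\<lambda>x. f x + g x) - k f s \<le> r g" if "s \<ge> 0" for s
        using that g by (intro lower) (auto simp: algebra_simps)
      then have "r (\<lambda>x. f x + g x) - r g \<le> r f"
        using f by (intro lower) (auto simp: algebra_simps)
      then show "r (\<lambda>x. f x + g x) \<le> r f + r g"
        by simp
    next
      fix f :: "'a \<Rightarrow> real" and a :: real
      assume f: "f \<in> bounded_functions" and a: "a > 0"
      have "r (\<lambda>x. a * f x) / a \<le> r f"
      proof (rule lower[OF f])
        fix t :: real assume t: "t \<ge> 0"
        \<comment> \<open>The parameter has to scale along with \<open>f\<close>: at
          \<open>a * t\<close> the factor \<open>a\<close> comes out of \<open>q\<close>.\<close>
        have "r (\<lambda>x. a * f x) \<le> k (\<lambda>x. a * f x) (a * t)"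
          using f a t by (intro upper) auto
        also have "\<dots> = a * k f t"
          using sublinear_scale[OF q(1), of "\<lambda>x. f x + t * y x" a] f y a
          by (simp add: k_def bounded_functions_add bounded_functions_mult algebra_simps)
        finally show "r (\<lambda>x. a * f x) / a \<le> k f t"
          using a by (simp add: field_simps)
      qed
      then show "r (\<lambda>x. a * f x) \<le> a * r f"
        using a by (simp add: field_simps)
    qed
    moreover have "r f \<le> q f" for f
      using upper[of f 0] q(2)[of f] by (cases "f \<in> bounded_functions") (auto simp: k_def r_def)
    ultimately have "r = q"
      by (intro minimal) (auto simp: r_def)
    then have "q f \<le> k f 1"
      using upper[OF f, of 1] by auto
    then show ?thesis
      using sublinear_add[OF q(1) f y] by (simp add: k_def)
  qed
  have neg: "q (\<lambda>x. - f x) = - q f" if "f \<in> bounded_functions" for f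
    using add[OF that bounded_functions_minus[OF that]] sublinear_zero[OF q(1)] by simp
  have "q (\<lambda>x. a * f x) = a * q f" if f: "f \<in> bounded_functions" for a f
  proof (cases a "0 :: real" rule: linorder_cases)
    case less
    have "q (\<lambda>x. - a * f x) = - a * q f"
      using less f by (intro sublinear_scale[OF q(1)]) auto
    moreover have "(\<lambda>x. a * f x) \<in> bounded_functions"
      using f by auto
    ultimately show ?thesis
      using neg[of "\<lambda>x. a * f x"] by simp
  qed (use sublinear_scale[OF q(1)] sublinear_zero[OF q(1)] f in auto)
  then show ?thesis
    using add by (auto simp: linear_functional_def)
qed

text \<open>Hahn-Banach without extension from a subspace: Zorn's lemma gives a minimal sublinear
  functional below \<open>p\<close>, and minimality forces linearity.\<close>

theorem sublinear_dominates_linear: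
  fixes p :: "('a \<Rightarrow> real) \<Rightarrow> real"
  assumes p: "sublinear p"
  obtains L where "linear_functional L" "\<And>f. f \<in> bounded_functions \<Longrightarrow> L f \<le> p f"
proof -
  let ?V = "bounded_functions :: ('a \<Rightarrow> real) set"
  \<comment> \<open>Were the value off the bounded functions left free, it could be lowered for ever
    and no element would be minimal; hence it is fixed to \<open>0\<close>.\<close>
  define A where "A = {q. sublinear q \<and> (\<forall>f\<in>?V. q f \<le> p f) \<and> (\<forall>f. f \<notin> ?V \<longrightarrow> q f = 0)}"
  \<comment> \<open>The order is reversed because \<open>predicate_Zorn\<close> produces maximal
    elements.\<close>
  define P where "P = (\<lambda>a b :: ('a \<Rightarrow> real) \<Rightarrow> real. \<forall>f. b f \<le> a f)"
  define p0 where "p0 = (\<lambda>f. if f \<in> ?V then p f else 0)"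
  have "sublinear p0"
    using p by (auto simp: sublinear_def p0_def bounded_functions_add bounded_functions_mult)
  then have p0: "p0 \<in> A"
    by (auto simp: A_def p0_def)
  have "\<exists>m\<in>A. \<forall>a\<in>A. P m a \<longrightarrow> a = m"
  proof (rule predicate_Zorn)
    show "partial_order_on A (relation_of P A)"
      by (auto simp: P_def intro!: partial_order_on_relation_ofI ext intro: order_trans antisym)
    fix C assume C: "C \<in> Chains (relation_of P A)"
    show "\<exists>u\<in>A. \<forall>a\<in>C. P a u"
    proof (cases "C = {}")
      case True
      then show ?thesis
        using p0 by auto
    next
      case False
      have CA: "C \<subseteq> A"
        using C by (auto simp: Chains_def relation_of_def)
      define u where "u = (\<lambda>f. if f \<in> ?V then (INF q\<in>C. q f) else 0)"
      have chain: "(\<forall>f. q f \<le> r f) \<or> (\<forall>f. r f \<le> q f)" if "q \<in> C" "r \<in> C" for q r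
        using C that by (auto simp: Chains_def relation_of_def P_def)
      have CD: "sublinear q" "f \<in> ?V \<Longrightarrow> q f \<le> p f" "f \<notin> ?V \<Longrightarrow> q f = 0" if "q \<in> C" for q f
        using CA that by (auto simp: A_def)
      have u: "u f = (INF q\<in>C. q f)" if "f \<in> ?V" for f
        using that by (simp add: u_def)
      have "sublinear u"
        by (rule INF_sublinear(1)[of C p u]) (fact False CD chain u)+
      have le: "u f \<le> q f" if "q \<in> C" "f \<in> ?V" for q f
        by (rule INF_sublinear(2)[of C p u]) (fact False CD chain u that)+
      obtain q0 where q0: "q0 \<in> C"
        using False by auto
      have "u f \<le> p f" if "f \<in> ?V" for f
        using le[OF q0 that] CD(2)[OF q0 that] by simp
      with \<open>sublinear u\<close> have "u \<in> A"
        by (auto simp: A_def u_def)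
      moreover have "P q u" if "q \<in> C" for q
        unfolding P_def using le[OF that] CD(3)[OF that] by (auto simp: u_def)
      ultimately show ?thesis
        by auto
    qed
  qed
  then obtain m where m: "m \<in> A" and min: "\<And>a. a \<in> A \<Longrightarrow> P m a \<Longrightarrow> a = m"
    by auto
  have "linear_functional m"
  proof (rule minimal_sublinear_linear)
    fix r assume "sublinear r" "\<And>f. r f \<le> m f" "\<And>f. f \<notin> ?V \<Longrightarrow> r f = 0"
    then show "r = m"
      using m by (intro min) (auto simp: A_def P_def intro: order_trans)
  qed (use m in \<open>auto simp: A_def\<close>)
  with m show ?thesis
    by (intro that[of m]) (auto simp: A_def)
qed

section \<open>Random nested cells\<close>

text \<open>The newest letter is the head of the word, so prepending refines the cell, and the
  letter in front of \<open>w\<close> decides the side of the set with index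
  \<open>length w\<close>.\<close>

primrec cell :: "(nat \<Rightarrow> 's set) \<Rightarrow> bool list \<Rightarrow> 's set" where
  "cell B [] = UNIV"
| "cell B (b # w) = cell B w \<inter> {y. (y \<in> B (length w)) = b}"

primrec code :: "(nat \<Rightarrow> 's set) \<Rightarrow> 's \<Rightarrow> nat \<Rightarrow> bool list" where
  "code B y 0 = []"
| "code B y (Suc k) = (y \<in> B k) # code B y k"

lemma length_code [simp]: "length (code B y k) = k"
  by (induction k) auto

lemma in_cell_iff: "y \<in> cell B w \<longleftrightarrow> w = code B y (length w)"
  by (induction w) auto

lemma in_cell_same_side:
  "y \<in> cell B w \<Longrightarrow> y' \<in> cell B w \<Longrightarrow> i < length w \<Longrightarrow> y \<in> B i \<longleftrightarrow> y' \<in> B i"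
  by (induction w) (auto simp: less_Suc_eq)

text \<open>By compactness finitely many basic sets of small diameter cover the space. A word longer
  than all their indices decides membership in each of them, so its whole cell lies inside one that
  contains any of its points.\<close>

lemma cell_small_diameter:
  fixes B :: "nat \<Rightarrow> 's::metric_space set"
  assumes "compact (UNIV :: 's set)"
    and B: "\<And>i. open (B i)" "\<And>U y. open U \<Longrightarrow> y \<in> U \<Longrightarrow> \<exists>i. y \<in> B i \<and> B i \<subseteq> U"
    and "\<epsilon> > 0"
  obtains k where "\<And>w y y'. k \<le> length w \<Longrightarrow> y \<in> cell B w \<Longrightarrow> y' \<in> cell B w \<Longrightarrow> dist y y' < \<epsilon>"
proof -
  define I where "I = {i. \<exists>z. B i \<subseteq> ball z (\<epsilon> / 2)}"
  have "UNIV \<subseteq> (\<Union>i\<in>I. B i)"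
  proof
    fix y :: 's
    obtain i where "y \<in> B i" "B i \<subseteq> ball y (\<epsilon> / 2)"
      using B(2)[of "ball y (\<epsilon> / 2)" y] \<open>\<epsilon> > 0\<close> by auto
    then show "y \<in> (\<Union>i\<in>I. B i)"
      by (auto simp: I_def)
  qed
  then obtain J where J: "J \<subseteq> I" "finite J" "UNIV \<subseteq> (\<Union>i\<in>J. B i)"
    using compactE_image[OF assms(1), of I B] B(1) by metis
  obtain k where k: "\<And>i. i \<in> J \<Longrightarrow> i < k"
    using finite_nat_bounded[OF J(2)] by auto
  show ?thesis
  proof (rule that[of k])
    fix w and y y' :: 's
    assume w: "k \<le> length w" and y: "y \<in> cell B w" "y' \<in> cell B w"
    obtain i where i: "i \<in> J" "y \<in> B i"
      using J(3) by auto
    obtain z where z: "B i \<subseteq> ball z (\<epsilon> / 2)"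
      using J(1) i(1) by (auto simp: I_def)
    have "y' \<in> B i"
      using in_cell_same_side[OF y, of i] k[OF i(1)] w i(2) by auto
    then have "dist z y < \<epsilon> / 2" "dist z y' < \<epsilon> / 2"
      using i(2) z by auto
    then show "dist y y' < \<epsilon>"
      by (metis dist_commute dist_triangle_half_r)
  qed
qed

lemma finite_words: "finite {w :: bool list. length w = k}"
  using finite_lists_length_eq[of "UNIV :: bool set" k] by simp

section \<open>A uniform variable and the point that it selects\<close>

definition unif :: "real measure" where
  "unif = uniform_measure lborel {0..<1}"

lemma sets_unif [measurable_cong, simp]: "sets unif = sets borel"
  by (simp add: unif_def)

lemma prob_space_unif: "prob_space unif"
  unfolding unif_def by (rule prob_space_uniform_measure) auto

lemma AE_unif: "AE u in unif. 0 \<le> u \<and> u < 1"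
  unfolding unif_def by (rule AE_uniform_measureI) auto

text \<open>The relations between the weights are required at every \<open>x\<close>, not just
  almost everywhere, so that the intervals tile \<open>[0,1)\<close> and a point can be selected for
  each \<open>x\<close>.\<close>

locale cell_tree =
  fixes B :: "nat \<Rightarrow> 's::polish_space set"
    and \<theta> :: "'e::polish_space \<Rightarrow> bool list \<Rightarrow> real"
  assumes compact: "compact (UNIV :: 's set)"
    and open_B: "\<And>i. open (B i)"
    and basis_B: "\<And>U y. open U \<Longrightarrow> y \<in> U \<Longrightarrow> \<exists>i. y \<in> B i \<and> B i \<subseteq> U"
    and measurable_weight [measurable]: "\<And>w. (\<lambda>x. \<theta> x w) \<in> borel_measurable borel"
    and weight_nonneg: "\<And>x w. 0 \<le> \<theta> x w"
    and weight_Nil: "\<And>x. \<theta> x [] = 1"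
    and weight_split: "\<And>x w. \<theta> x w = \<theta> x (True # w) + \<theta> x (False # w)"
    and weight_empty: "\<And>x w. cell B w = {} \<Longrightarrow> \<theta> x w = 0"
begin

text \<open>The word \<open>w\<close> owns the interval
  \<open>[left_end x w, left_end x w + \<theta> x w)\<close>, whose left part goes to
  \<open>True # w\<close> and whose right part goes to \<open>False # w\<close>.\<close>

primrec left_end :: "'e \<Rightarrow> bool list \<Rightarrow> real" where
  "left_end x [] = 0"
| "left_end x (b # w) = left_end x w + (if b then 0 else \<theta> x (True # w))"

primrec walk :: "'e \<Rightarrow> real \<Rightarrow> nat \<Rightarrow> bool list" where
  "walk x u 0 = []"
| "walk x u (Suc k) = (u < left_end x (walk x u k) + \<theta> x (True # walk x u k)) # walk x u k"

definition point :: "bool list \<Rightarrow> 's" where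
  "point w = (SOME y. y \<in> cell B w)"

text \<open>For \<open>u\<close> outside \<open>[0,1)\<close> the walk may enter empty cells. A
  constant sequence is taken there, so that the limit exists at every pair and the selection is
  measurable as a pointwise limit.\<close>

definition selection :: "'e \<times> real \<Rightarrow> 's" where
  "selection p = lim (\<lambda>k. if snd p \<in> {0..<1} then point (walk (fst p) (snd p) k) else undefined)"

lemma length_walk [simp]: "length (walk x u k) = k"
  by (induction k) auto

lemma left_end_bounds: "0 \<le> left_end x w \<and> left_end x w + \<theta> x w \<le> 1"
proof (induction w)
  case (Cons b w)
  then show ?case
    using weight_split[of x w] weight_nonneg[of x "True # w"] weight_nonneg[of x "False # w"]
    by (cases b) auto
qed (auto simp: weight_Nil)

text \<open>The half-open intervals of the two children tile the interval of the parent exactly, so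
  each \<open>u\<close> in \<open>[0,1)\<close> lies in the interval of one word of each length, and
  the walk reads off this word.\<close>

lemma walk_eq_iff:
  assumes "0 \<le> u" "u < 1"
  shows "walk x u (length w) = w \<longleftrightarrow> left_end x w \<le> u \<and> u < left_end x w + \<theta> x w"
proof (induction w)
  case (Cons b w)
  show ?case
  proof (cases "walk x u (length w) = w")
    case True
    then show ?thesis
      using Cons weight_split[of x w] by (cases b) auto
  next
    case False
    then show ?thesis
      using Cons weight_split[of x w] weight_nonneg[of x "True # w"] weight_nonneg[of x "False # w"]
      by (cases b) auto
  qed
qed (use assms in \<open>auto simp: weight_Nil\<close>)

text \<open>An empty cell has weight zero and hence an empty half-open interval, which contains no
  \<open>u\<close>. The conclusion therefore holds for every \<open>u\<close>, with no exceptional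
  set.\<close>

lemma cell_walk_nonempty:
  assumes "0 \<le> u" "u < 1"
  shows "cell B (walk x u k) \<noteq> {}"
proof
  assume "cell B (walk x u k) = {}"
  then have "\<theta> x (walk x u k) = 0"
    by (rule weight_empty)
  then show False
    using walk_eq_iff[OF assms, of x "walk x u k"] by auto
qed

lemma cell_walk_mono: "j \<le> k \<Longrightarrow> cell B (walk x u k) \<subseteq> cell B (walk x u j)"
  by (induction k rule: dec_induct) auto

lemma point_in_cell:
  assumes "0 \<le> u" "u < 1" "j \<le> k"
  shows "point (walk x u k) \<in> cell B (walk x u j)"
proof -
  have "point (walk x u k) \<in> cell B (walk x u k)"
    using cell_walk_nonempty[OF assms(1,2), of x k] unfolding point_def by (auto intro: someI)
  with cell_walk_mono[OF assms(3)] show ?thesis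
    by auto
qed

lemma point_walk_tendsto:
  assumes u: "0 \<le> u" "u < 1"
  shows "(\<lambda>k. point (walk x u k)) \<longlonglongrightarrow> selection (x, u)"
proof -
  have "Cauchy (\<lambda>k. point (walk x u k))"
  proof (rule metric_CauchyI)
    fix \<epsilon> :: real assume "\<epsilon> > 0"
    then obtain k where "\<And>w y y'. k \<le> length w \<Longrightarrow> y \<in> cell B w \<Longrightarrow> y' \<in> cell B w \<Longrightarrow> dist y y' < \<epsilon>"
      using cell_small_diameter[OF compact open_B basis_B] by metis
    then show "\<exists>k. \<forall>m\<ge>k. \<forall>n\<ge>k. dist (point (walk x u m)) (point (walk x u n)) < \<epsilon>"
      using point_in_cell[OF u] by (metis length_walk order_refl)
  qed
  then have "convergent (\<lambda>k. point (walk x u k))"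
    by (rule Cauchy_convergent)
  then show ?thesis
    using u by (simp add: selection_def convergent_LIMSEQ_iff)
qed

text \<open>Cells need not be closed, so the selected point may leave them. This is why infima over
  closures of cells appear from here on.\<close>

lemma selection_in_closure:
  assumes u: "0 \<le> u" "u < 1"
  shows "selection (x, u) \<in> closure (cell B (walk x u k))"
proof -
  have "eventually (\<lambda>j. point (walk x u j) \<in> closure (cell B (walk x u k))) sequentially"
    using eventually_ge_at_top[of k]
    by eventually_elim (use point_in_cell[OF u, of k] closure_subset in blast)
  then show ?thesis
    using Lim_in_closed_set[OF closed_closure _ _ point_walk_tendsto[OF u]] by auto
qed

lemma closure_cell_walk_small:
  assumes u: "0 \<le> u" "u < 1" and "\<epsilon> > 0"
  shows "\<exists>k. \<forall>j\<ge>k. \<forall>y\<in>closure (cell B (walk x u j)). dist y (selection (x, u)) < \<epsilon>"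
proof -
  have "\<epsilon> / 2 > 0"
    using \<open>\<epsilon> > 0\<close> by simp
  then obtain k where k: "\<And>w y y'. k \<le> length w \<Longrightarrow> y \<in> cell B w \<Longrightarrow> y' \<in> cell B w \<Longrightarrow> dist y y' < \<epsilon> / 2"
    using cell_small_diameter[OF compact open_B basis_B] by metis
  have "dist y (selection (x, u)) < \<epsilon>" if j: "j \<ge> k" and y: "y \<in> closure (cell B (walk x u j))" for j y
  proof -
    \<comment> \<open>The diameter bound passes to the closure one argument at a time: first for
      \<open>z\<close>, then for \<open>y\<close>.\<close>
    have "dist y' z \<le> \<epsilon> / 2" if "y' \<in> cell B (walk x u j)" "z \<in> closure (cell B (walk x u j))" for y' z
    proof -
      have "closure (cell B (walk x u j)) \<subseteq> cball y' (\<epsilon> / 2)"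
        using k[of "walk x u j" y'] j that(1)
        by (intro closure_minimal) (auto simp: less_eq_real_def)
      with that(2) show ?thesis
        by auto
    qed
    then have "closure (cell B (walk x u j)) \<subseteq> cball y (\<epsilon> / 2)"
      using y by (intro closure_minimal) (auto simp: dist_commute)
    then have "dist y (selection (x, u)) \<le> \<epsilon> / 2"
      using selection_in_closure[OF u, of x j] by auto
    then show ?thesis
      using \<open>\<epsilon> > 0\<close> by linarith
  qed
  then show ?thesis
    by blast
qed

lemma measurable_left_end [measurable]: "(\<lambda>x. left_end x w) \<in> borel_measurable borel"
  by (induction w) auto

lemma measurable_walk [measurable]:
  "(\<lambda>p. walk (fst p) (snd p) k) \<in> measurable (borel \<Otimes>\<^sub>M borel) (count_space UNIV)"
proof (induction k)
  case (Suc k)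
  note [measurable] = Suc
  \<comment> \<open>The word varies with \<open>x\<close> and \<open>u\<close> but has only
    countably many values, so measurability may be checked with the word fixed.\<close>
  have "(\<lambda>p. left_end (fst p) (walk (fst p) (snd p) k)) \<in> borel_measurable (borel \<Otimes>\<^sub>M borel)"
    by (rule measurable_compose_countable'[OF _ Suc]) auto
  moreover have "(\<lambda>p. \<theta> (fst p) (True # walk (fst p) (snd p) k)) \<in> borel_measurable (borel \<Otimes>\<^sub>M borel)"
    by (rule measurable_compose_countable'[where f = "\<lambda>w p. \<theta> (fst p) (True # w)", OF _ Suc]) auto
  ultimately have [measurable]: "Measurable.pred (borel \<Otimes>\<^sub>M borel)
      (\<lambda>p. snd p < left_end (fst p) (walk (fst p) (snd p) k) + \<theta> (fst p) (True # walk (fst p) (snd p) k))"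
    by measurable
  have "(\<lambda>p. case (snd p < left_end (fst p) (walk (fst p) (snd p) k) + \<theta> (fst p) (True # walk (fst p) (snd p) k),
      walk (fst p) (snd p) k) of (b, w) \<Rightarrow> b # w) \<in> measurable (borel \<Otimes>\<^sub>M borel) (count_space UNIV)"
    by measurable
  then show ?case
    by simp
qed simp

lemma measurable_walk_snd [measurable]: "(\<lambda>u. walk x u k) \<in> measurable borel (count_space UNIV)"
  using measurable_compose[OF measurable_Pair1'[of x borel borel] measurable_walk[of k]] by simp

lemma measurable_selection [measurable]: "selection \<in> measurable (borel \<Otimes>\<^sub>M borel) borel"
proof -
  let ?f = "\<lambda>k p. if snd p \<in> {0..<1::real} then point (walk (fst p) (snd p) k) else undefined"
  have "(\<lambda>p. lim (\<lambda>k. ?f k p)) \<in> measurable (borel \<Otimes>\<^sub>M borel) borel"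
  proof (rule borel_measurable_LIMSEQ_metric)
    fix p :: "'e \<times> real"
    show "(\<lambda>k. ?f k p) \<longlonglongrightarrow> lim (\<lambda>k. ?f k p)"
      using point_walk_tendsto[of "snd p" "fst p"]
      by (cases "snd p \<in> {0..<1}") (auto simp: selection_def)
  qed measurable
  then show ?thesis
    by (simp add: selection_def[abs_def])
qed

lemma emeasure_walk: "emeasure unif {u. walk x u (length w) = w} = ennreal (\<theta> x w)"
proof -
  have [measurable]: "{u. walk x u (length w) = w} \<in> sets borel"
    by measurable
  have "{0..<1} \<inter> {u. walk x u (length w) = w} = {left_end x w ..< left_end x w + \<theta> x w}"
    using walk_eq_iff[of _ x w] left_end_bounds[of x w] by auto
  then show ?thesis
    using weight_nonneg[of x w] by (simp add: unif_def divide_ennreal_def)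
qed

lemma nn_integral_walk:
  assumes [measurable]: "\<And>w. (\<lambda>x. \<psi> x w) \<in> borel_measurable borel" 
  shows "(\<integral>\<^sup>+u. \<psi> x (walk x u k) \<partial>unif) = (\<Sum>w | length w = k. \<psi> x w * ennreal (\<theta> x w))"
proof -
  have [measurable]: "{u. walk x u k = w} \<in> sets borel" for w
    by measurable
  have "\<psi> x (walk x u k) = (\<Sum>w | length w = k. \<psi> x w * indicator {u. walk x u k = w} u)" for u
    using finite_words[of k] by (simp add: indicator_def if_distrib sum.If_cases cong: if_cong)
  then have "(\<integral>\<^sup>+u. \<psi> x (walk x u k) \<partial>unif) =
      (\<Sum>w | length w = k. \<psi> x w * emeasure unif {u. walk x u k = w})"
    by (simp add: nn_integral_sum nn_integral_cmult_indicator)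
  then show ?thesis
    by (auto intro!: sum.cong simp flip: emeasure_walk)
qed

text \<open>Fatou's lemma for the walk: the closed cells visited shrink to the selected point, so lower
  semi-continuity bounds the value there by the infima over these cells.\<close>

lemma nn_integral_selection_le:
  fixes \<phi> :: "'e \<times> 's \<Rightarrow> ennreal" and \<eta> :: "'e measure"
  assumes [measurable_cong]: "sets \<eta> = sets borel"
    and lsc: "\<And>x y a. a < \<phi> (x, y) \<Longrightarrow> \<exists>\<delta>>0. \<forall>y'. dist y' y < \<delta> \<longrightarrow> a < \<phi> (x, y')"
    and [measurable]: "\<And>w. (\<lambda>x. INF y\<in>closure (cell B w). \<phi> (x, y)) \<in> borel_measurable borel"
    and bound: "\<And>k. (\<integral>\<^sup>+x. (\<Sum>w | length w = k. min (of_nat k) (INF y\<in>closure (cell B w). \<phi> (x, y)) * ennreal (\<theta> x w)) \<partial>\<eta>) \<le> d"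
  shows "(\<integral>\<^sup>+x. \<integral>\<^sup>+u. \<phi> (x, selection (x, u)) \<partial>unif \<partial>\<eta>) \<le> d"
proof -
  interpret unif: prob_space unif
    by (rule prob_space_unif)
  \<comment> \<open>The cap \<open>k\<close> makes these functions bounded, so that a functional on
    bounded functions can test them. A finite level \<open>a\<close> lies below the cap for all
    large \<open>k\<close>, so nothing is lost in the limit.\<close>
  define \<psi> where "\<psi> k x w = min (of_nat k) (INF y\<in>closure (cell B w). \<phi> (x, y))" for k x w
  have [measurable]: "(\<lambda>x. \<psi> k x w) \<in> borel_measurable borel" for k w
    unfolding \<psi>_def by measurable
  have [measurable]: "(\<lambda>p. \<psi> k (fst p) (walk (fst p) (snd p) k)) \<in> borel_measurable (borel \<Otimes>\<^sub>M borel)" for k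
    by (rule measurable_compose_countable'[where f = "\<lambda>w p. \<psi> k (fst p) w", OF _ measurable_walk]) auto
  have walk: "(\<integral>\<^sup>+u. \<psi> k x (walk x u k) \<partial>unif) = (\<Sum>w | length w = k. \<psi> k x w * ennreal (\<theta> x w))" for k x
    by (rule nn_integral_walk) simp
  have lim: "\<phi> (x, selection (x, u)) \<le> liminf (\<lambda>k. \<psi> k x (walk x u k))" if u: "0 \<le> u" "u < 1" for x u
  proof (rule dense_le)
    fix a assume a: "a < \<phi> (x, selection (x, u))"
    then obtain \<delta> where \<delta>: "\<delta> > 0" "\<And>y. dist y (selection (x, u)) < \<delta> \<Longrightarrow> a < \<phi> (x, y)"
      using lsc by metis
    obtain k where k: "\<And>j y. j \<ge> k \<Longrightarrow> y \<in> closure (cell B (walk x u j)) \<Longrightarrow> dist y (selection (x, u)) < \<delta>"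
      using closure_cell_walk_small[OF u \<delta>(1), of x] by blast
    have "a \<noteq> top"
      using a by auto
    then obtain n where n: "a \<le> of_nat n"
      by (metis ennreal_Ex_less_of_nat less_top less_imp_le)
    have "a \<le> \<psi> j x (walk x u j)" if "j \<ge> max k n" for j
    proof -
      have "a \<le> of_nat j"
        using n that by (meson max.boundedE of_nat_mono order_trans)
      moreover have "a \<le> (INF y\<in>closure (cell B (walk x u j)). \<phi> (x, y))"
        using k \<delta>(2) that by (intro INF_greatest) (auto intro!: less_imp_le)
      ultimately show ?thesis
        by (simp add: \<psi>_def)
    qed
    then show "a \<le> liminf (\<lambda>k. \<psi> k x (walk x u k))"
      by (intro Liminf_bounded) (auto simp: eventually_sequentially intro!: exI[of _ "max k n"])
  qed
  have "(\<integral>\<^sup>+x. \<integral>\<^sup>+u. \<phi> (x, selection (x, u)) \<partial>unif \<partial>\<eta>) \<le>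
      (\<integral>\<^sup>+x. \<integral>\<^sup>+u. liminf (\<lambda>k. \<psi> k x (walk x u k)) \<partial>unif \<partial>\<eta>)"
    using AE_unif by (intro nn_integral_mono nn_integral_mono_AE) (auto intro: lim)
  also have "\<dots> \<le> (\<integral>\<^sup>+x. liminf (\<lambda>k. \<integral>\<^sup>+u. \<psi> k x (walk x u k) \<partial>unif) \<partial>\<eta>)"
  proof (intro nn_integral_mono nn_integral_liminf)
    fix x k
    show "(\<lambda>u. \<psi> k x (walk x u k)) \<in> borel_measurable unif"
      by (rule measurable_compose_countable'[where f = "\<lambda>w u. \<psi> k x w" and g = "\<lambda>u. walk x u k" and I = UNIV])
        auto
  qed
  also have "\<dots> = (\<integral>\<^sup>+x. liminf (\<lambda>k. \<Sum>w | length w = k. \<psi> k x w * ennreal (\<theta> x w)) \<partial>\<eta>)"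
    by (simp add: walk)
  also have "\<dots> \<le> liminf (\<lambda>k. \<integral>\<^sup>+x. (\<Sum>w | length w = k. \<psi> k x w * ennreal (\<theta> x w)) \<partial>\<eta>)"
    by (intro nn_integral_liminf) measurable
  also have "\<dots> \<le> limsup (\<lambda>k. d)"
    using bound by (intro order_trans[OF Liminf_le_Limsup] Limsup_mono) (auto simp: \<psi>_def)
  finally show ?thesis
    by (simp add: Limsup_const)
qed

end

section \<open>Representation of positive functionals\<close>

text \<open>Bounded measurable functions are uniform limits of simple functions. The argument needs
  finite additivity and a bound by the supremum only, so it is available for \<open>L\<close>, where
  monotone or dominated convergence is not.\<close>

lemma bounded_measurable_functional_zero:
  fixes \<Phi> :: "('a \<Rightarrow> real) \<Rightarrow> real" and M :: "'a measure"
  defines "V \<equiv> borel_measurable M \<inter> bounded_functions"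
  assumes M: "space M = UNIV"
    and add: "\<And>f g. f \<in> V \<Longrightarrow> g \<in> V \<Longrightarrow> \<Phi> (\<lambda>x. f x + g x) = \<Phi> f + \<Phi> g"
    and scale: "\<And>f a. f \<in> V \<Longrightarrow> \<Phi> (\<lambda>x. a * f x) = a * \<Phi> f"
    and bound: "\<And>f \<epsilon>. f \<in> V \<Longrightarrow> (\<And>x. \<bar>f x\<bar> \<le> \<epsilon>) \<Longrightarrow> \<bar>\<Phi> f\<bar> \<le> K * \<epsilon>"
    and indicator: "\<And>A. A \<in> sets M \<Longrightarrow> \<Phi> (indicator A) = 0"
    and f: "f \<in> V"
  shows "\<Phi> f = 0"
proof -
  obtain C where C: "\<And>x. \<bar>f x\<bar> \<le> C"
    using f by (auto simp: V_def bounded_functions_iff)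
  have [measurable]: "f \<in> borel_measurable M"
    using f by (auto simp: V_def)
  have "\<bar>\<Phi> f\<bar> \<le> K * \<epsilon>" if "\<epsilon> > 0" for \<epsilon>
  proof -
    \<comment> \<open>The function is rounded down to multiples of \<epsilon>; its bound
      \<open>C\<close> leaves the finite range \<open>J\<close> of levels.\<close>
    define J where "J = {\<lfloor>- C / \<epsilon>\<rfloor>..\<lfloor>C / \<epsilon>\<rfloor>}"
    define A where "A i = {x. \<lfloor>f x / \<epsilon>\<rfloor> = i}" for i
    define s where "s J x = (\<Sum>i\<in>J. of_int i * \<epsilon> * indicator (A i) x)" for J x
    have A[measurable]: "A i \<in> sets M" for i
    proof -
      have "{x\<in>space M. \<lfloor>f x / \<epsilon>\<rfloor> = i} \<in> sets M"
        by measurable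
      then show ?thesis
        by (simp add: A_def M)
    qed
    have ind: "(\<lambda>x. a * indicator (A i) x) \<in> V" for i a
      by (auto simp: V_def)
    have s: "s J \<in> V \<and> \<Phi> (s J) = 0" if "finite J" for J
      using that
    proof (induction J)
      case empty
      show ?case
        using scale[OF f, of 0] by (simp add: s_def V_def)
    next
      case (insert i J)
      have "s (insert i J) = (\<lambda>x. of_int i * \<epsilon> * indicator (A i) x + s J x)"
        unfolding s_def by (intro ext sum.insert insert.hyps)
      moreover have "\<Phi> (\<lambda>x. of_int i * \<epsilon> * indicator (A i) x) = 0"
        using scale[of "indicator (A i)" "of_int i * \<epsilon>"] indicator[OF A, of i] ind[of 1 i] by simp
      moreover have "(\<lambda>x. of_int i * \<epsilon> * indicator (A i) x + s J x) \<in> V"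
        using ind[of "of_int i * \<epsilon>" i] insert.IH by (auto simp only: V_def intro!: borel_measurable_add bounded_functions_add)
      ultimately show ?case
        using insert.IH add[OF ind, of "s J" "of_int i * \<epsilon>" i] by simp
    qed
    have sx: "s J x = of_int \<lfloor>f x / \<epsilon>\<rfloor> * \<epsilon>" for x
    proof -
      have "\<lfloor>f x / \<epsilon>\<rfloor> \<in> J"
        using C[of x] \<open>\<epsilon> > 0\<close> unfolding J_def atLeastAtMost_iff
        by (intro conjI floor_mono divide_right_mono) linarith+
      moreover have "s J x = (\<Sum>i\<in>J. if i = \<lfloor>f x / \<epsilon>\<rfloor> then of_int i * \<epsilon> else 0)"
        unfolding s_def by (intro sum.cong) (auto simp: A_def indicator_def)
      ultimately show ?thesis
        by (simp add: J_def)
    qed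
    have "\<bar>f x - s J x\<bar> \<le> \<epsilon>" for x
    proof -
      have "f x / \<epsilon> - 1 \<le> of_int \<lfloor>f x / \<epsilon>\<rfloor>" "of_int \<lfloor>f x / \<epsilon>\<rfloor> \<le> f x / \<epsilon>"
        by linarith+
      then have "(f x / \<epsilon> - 1) * \<epsilon> \<le> s J x" "s J x \<le> f x / \<epsilon> * \<epsilon>"
        unfolding sx using \<open>\<epsilon> > 0\<close> by (intro mult_right_mono; simp)+
      then show ?thesis
        using \<open>\<epsilon> > 0\<close> by (simp add: left_diff_distrib abs_le_iff)
    qed
    moreover have sJ: "s J \<in> V" "\<Phi> (s J) = 0"
      using s[of J] by (auto simp: J_def)
    then have d: "(\<lambda>x. f x - s J x) \<in> V"
      using f by (auto simp: V_def)
    ultimately have "\<bar>\<Phi> (\<lambda>x. f x - s J x)\<bar> \<le> K * \<epsilon>"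
      by (intro bound)
    moreover have "\<Phi> (\<lambda>x. (f x - s J x) + s J x) = \<Phi> (\<lambda>x. f x - s J x) + \<Phi> (s J)"
      by (rule add[OF d sJ(1)])
    ultimately show ?thesis
      using sJ(2) by simp
  qed
  \<comment> \<open>The constant \<open>K\<close> may be zero or negative, so the error is divided
    by \<open>\<bar>K\<bar> + 1\<close>.\<close>
  moreover have "K * (\<epsilon> / (\<bar>K\<bar> + 1)) \<le> \<epsilon>" if "\<epsilon> > 0" for \<epsilon>
  proof -
    have "K * (\<epsilon> / (\<bar>K\<bar> + 1)) \<le> (\<bar>K\<bar> + 1) * (\<epsilon> / (\<bar>K\<bar> + 1))"
      using that by (intro mult_right_mono) auto
    then show ?thesis
      by simp
  qed
  ultimately have "\<bar>\<Phi> f\<bar> \<le> 0 + \<epsilon>" if "\<epsilon> > 0" for \<epsilon>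
    using that by (metis abs_ge_zero add_0 add_nonneg_pos divide_pos_pos order_trans zero_less_one)
  then have "\<bar>\<Phi> f\<bar> \<le> 0"
    by (rule field_le_epsilon)
  then show ?thesis
    by simp
qed

text \<open>No continuity of \<open>L\<close> along sequences is assumed. The only genuine measure
  in sight is the first marginal, and every limit in the first variable is borrowed from it.\<close>

locale positive_functional =
  fixes \<eta> :: "'e::polish_space measure" and L :: "('e \<times> 's::polish_space \<Rightarrow> real) \<Rightarrow> real"
  assumes prob: "prob_space \<eta>" and sets_marginal [measurable_cong, simp]: "sets \<eta> = sets borel"
    and linear: "linear_functional L"
    and mono: "\<And>f g. f \<in> bounded_functions \<Longrightarrow> g \<in> bounded_functions \<Longrightarrow> (\<And>p. f p \<le> g p) \<Longrightarrow> L f \<le> L g"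
    and marginal: "\<And>A. A \<in> sets borel \<Longrightarrow> L (\<lambda>p. indicator A (fst p)) = measure \<eta> A"
begin

sublocale prob_space \<eta>
  by (rule prob)

lemma space_marginal [simp]: "space \<eta> = UNIV"
  using sets_eq_imp_space_eq[OF sets_marginal] by simp

lemma L_add: "f \<in> bounded_functions \<Longrightarrow> g \<in> bounded_functions \<Longrightarrow> L (\<lambda>p. f p + g p) = L f + L g"
  using linear by (auto simp: linear_functional_def)

lemma L_scale: "f \<in> bounded_functions \<Longrightarrow> L (\<lambda>p. a * f p) = a * L f"
  using linear by (auto simp: linear_functional_def)

lemma L_zero [simp]: "L (\<lambda>p. 0) = 0"
  using L_scale[of "\<lambda>p. 0" 0] by simp

lemma L_one [simp]: "L (\<lambda>p. 1) = 1"
  using marginal[of UNIV] prob_space by simp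

lemma L_sum: "finite I \<Longrightarrow> (\<And>i. i \<in> I \<Longrightarrow> f i \<in> bounded_functions) \<Longrightarrow>
    L (\<lambda>p. \<Sum>i\<in>I. f i p) = (\<Sum>i\<in>I. L (f i))"
  by (induction I rule: finite_induct) (auto simp: L_add)

lemma L_bound:
  assumes f: "f \<in> bounded_functions" "\<And>p. \<bar>f p\<bar> \<le> c"
  shows "\<bar>L f\<bar> \<le> c"
proof -
  have "L (\<lambda>p. c * 1) = c" "L (\<lambda>p. - c * 1) = - c"
    by (subst L_scale; simp)+
  moreover have "L f \<le> L (\<lambda>p. c * 1)" "L (\<lambda>p. - c * 1) \<le> L f"
    using f(2) by (intro mono f(1); force simp: abs_le_iff minus_le_iff)+
  ultimately show ?thesis
    by linarith
qed

definition mass :: "'s set \<Rightarrow> 'e set \<Rightarrow> real" where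
  "mass C A = L (\<lambda>p. indicator A (fst p) * indicator C (snd p))"

lemma bounded_rectangle [simp]: "(\<lambda>p. indicator A (fst p) * indicator C (snd p) :: real) \<in> bounded_functions"
  by (rule bounded_functions_product) simp_all

lemma mass_nonneg: "0 \<le> mass C A"
  using mono[of "\<lambda>p. 0" "\<lambda>p. indicator A (fst p) * indicator C (snd p)"] by (simp add: mass_def)

lemma mass_le:
  assumes "A \<in> sets borel"
  shows "mass C A \<le> measure \<eta> A"
proof -
  have "mass C A \<le> L (\<lambda>p. indicator A (fst p))"
    unfolding mass_def
    by (intro mono bounded_rectangle bounded_functions_comp[of "indicator A" fst] bounded_functions_indicator)
      (auto split: split_indicator)
  then show ?thesis
    using marginal[OF assms] by simp
qed

lemma mass_Un:
  assumes "A \<inter> A' = {}"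
  shows "mass C (A \<union> A') = mass C A + mass C A'"
proof -
  have "(\<lambda>p. indicator (A \<union> A') (fst p) * indicator C (snd p) :: real) =
      (\<lambda>p. indicator A (fst p) * indicator C (snd p) + indicator A' (fst p) * indicator C (snd p))"
    using assms by (intro ext) (auto split: split_indicator)
  then show ?thesis
    by (simp add: mass_def L_add)
qed

text \<open>Being dominated by \<open>\<eta>\<close> turns finite additivity of \<open>mass C\<close> into countable additivity.\<close>

lemma mass_density:
  obtains D where "D \<in> borel_measurable borel" "\<And>x. 0 \<le> D x" "integrable \<eta> D"
    "\<And>A. A \<in> sets borel \<Longrightarrow> mass C A = (\<integral>x. indicator A x * D x \<partial>\<eta>)"
proof -
  define \<mu> where "\<mu> A = ennreal (mass C A)" for A
  define N where "N = measure_of UNIV (sets borel) \<mu>"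
  have borel_alg: "sigma_algebra UNIV (sets (borel :: 'e measure))"
    using sets.sigma_algebra_axioms[of "borel :: 'e measure"] by simp
  then interpret borel: sigma_algebra UNIV "sets (borel :: 'e measure)" .
  have empty: "mass C {} = 0"
    by (simp add: mass_def)
  have "countably_additive (sets borel) \<mu>"
  proof (rule borel.empty_continuous_imp_countably_additive)
    show "positive (sets borel) \<mu>" "additive (sets borel) \<mu>"
      using mass_nonneg by (auto simp: positive_def additive_def \<mu>_def empty mass_Un)
    fix A :: "nat \<Rightarrow> 'e set"
    assume A: "range A \<subseteq> sets borel" "decseq A" "(\<Inter>i. A i) = {}"
    have "(\<lambda>i. measure \<eta> (A i)) \<longlonglongrightarrow> measure \<eta> (\<Inter>i. A i)"
      using A by (intro finite_Lim_measure_decseq) auto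
    then have lim: "(\<lambda>i. measure \<eta> (A i)) \<longlonglongrightarrow> 0"
      by (simp add: A(3))
    have "(\<lambda>i. mass C (A i)) \<longlonglongrightarrow> 0"
    proof (rule tendsto_sandwich[OF always_eventually always_eventually tendsto_const lim], safe)
      show "0 \<le> mass C (A i)" "mass C (A i) \<le> measure \<eta> (A i)" for i
        using A(1) by (auto intro: mass_nonneg mass_le)
    qed
    then show "(\<lambda>i. \<mu> (A i)) \<longlonglongrightarrow> 0"
      unfolding \<mu>_def using tendsto_ennrealI[of _ 0] by simp
  qed (auto simp: \<mu>_def)
  moreover have "positive (sets borel) \<mu>"
    by (auto simp: positive_def \<mu>_def empty)
  ultimately have N: "emeasure N A = \<mu> A" if "A \<in> sets borel" for A
    unfolding N_def using borel_alg that by (intro emeasure_measure_of_sigma)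
  have sets_N: "sets N = sets borel" "space N = UNIV"
    using borel_alg by (auto simp: N_def borel.sets_measure_of_eq)
  have fin: "finite_measure N"
    using N[of UNIV] sets_N by (intro finite_measureI) (auto simp: \<mu>_def)
  have "absolutely_continuous \<eta> N"
    unfolding absolutely_continuous_def
  proof
    fix A assume A: "A \<in> null_sets \<eta>"
    then have "A \<in> sets borel" "measure \<eta> A = 0"
      by (auto simp: null_sets_def measure_def)
    then show "A \<in> null_sets N"
      using mass_le[of A C] mass_nonneg[of C A] by (auto simp: null_sets_def sets_N N \<mu>_def)
  qed
  moreover have "sets N = sets \<eta>"
    by (simp add: sets_N)
  ultimately obtain D where D: "D \<in> borel_measurable \<eta>" "AE x in \<eta>. RN_deriv \<eta> N x = ennreal (D x)" "\<And>x. 0 \<le> D x"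
    using real_RN_deriv[OF fin] by metis
  have [measurable]: "D \<in> borel_measurable borel"
    using D(1) by simp
  have dens: "density \<eta> D = N"
    using density_RN_deriv[OF \<open>absolutely_continuous \<eta> N\<close> \<open>sets N = sets \<eta>\<close>]
      density_cong[OF borel_measurable_RN_deriv _ D(2)] by simp
  have mass: "ennreal (mass C A) = (\<integral>\<^sup>+x. ennreal (indicator A x * D x) \<partial>\<eta>)" if [measurable]: "A \<in> sets borel" for A
  proof -
    have "ennreal (mass C A) = emeasure (density \<eta> D) A"
      using N[OF that] by (simp add: dens \<mu>_def)
    also have "\<dots> = (\<integral>\<^sup>+x. ennreal (indicator A x * D x) \<partial>\<eta>)"
      by (subst emeasure_density) (auto intro!: nn_integral_cong simp: indicator_def)
    finally show ?thesis .
  qed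
  show ?thesis
  proof (rule that[OF _ D(3)])
    show "integrable \<eta> D"
      using mass[of UNIV] D(3) by (intro integrableI_nonneg) (auto simp: less_top[symmetric] dest: sym)
    fix A :: "'e set" assume [measurable]: "A \<in> sets borel"
    have "(\<integral>x. indicator A x * D x \<partial>\<eta>) = enn2real (\<integral>\<^sup>+x. ennreal (indicator A x * D x) \<partial>\<eta>)"
      using D(3) by (intro integral_eq_nn_integral) auto
    then show "mass C A = (\<integral>x. indicator A x * D x \<partial>\<eta>)"
      using mass_nonneg by (simp flip: mass)
  qed simp
qed

text \<open>Both sides are linear in \<open>f\<close>, controlled by its supremum, and equal on
  indicators, so uniform approximation suffices.\<close>

lemma L_product_indicator:
  assumes D: "D \<in> borel_measurable borel" "\<And>x. 0 \<le> D x" "integrable \<eta> D"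
      "\<And>A. A \<in> sets borel \<Longrightarrow> mass C A = (\<integral>x. indicator A x * D x \<partial>\<eta>)"
    and f: "f \<in> borel_measurable borel" "f \<in> bounded_functions"
  shows "L (\<lambda>p. f (fst p) * indicator C (snd p)) = (\<integral>x. f x * D x \<partial>\<eta>)"
proof -
  let ?f = "\<lambda>f p. f (fst p) * indicator C (snd p) :: real"
  have bf: "?f f \<in> bounded_functions" if "f \<in> bounded_functions" for f
    by (rule bounded_functions_product[OF that bounded_functions_indicator])
  have int: "integrable \<eta> (\<lambda>x. f x * D x)" if "f \<in> borel_measurable borel" "f \<in> bounded_functions" for f
  proof -
    obtain K where "\<And>x. \<bar>f x\<bar> \<le> K"
      using \<open>f \<in> bounded_functions\<close> by (auto simp: bounded_functions_iff)
    then have "norm (f x * D x) \<le> norm (K * D x)" for x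
      using D(2)[of x] by (auto simp: abs_mult intro!: mult_right_mono order_trans[OF _ abs_ge_self])
    then show ?thesis
      using that(1) D(1) by (intro Bochner_Integration.integrable_bound[OF integrable_mult_right[OF D(3), of K]]) auto
  qed
  have "L (?f f) - (\<integral>x. f x * D x \<partial>\<eta>) = 0"
  \<comment> \<open>The constant is the sum of the norm \<open>1\<close> of \<open>L\<close> and the
    total mass of the density.\<close>
  proof (rule bounded_measurable_functional_zero[where M = borel and K = "1 + (\<integral>x. D x \<partial>\<eta>)"
        and \<Phi> = "\<lambda>f. L (?f f) - (\<integral>x. f x * D x \<partial>\<eta>)"])
    fix f g :: "'e \<Rightarrow> real" and a \<epsilon>
    assume f: "f \<in> borel_measurable borel \<inter> bounded_functions"
    show "L (?f (\<lambda>x. a * f x)) - (\<integral>x. a * f x * D x \<partial>\<eta>) = a * (L (?f f) - (\<integral>x. f x * D x \<partial>\<eta>))"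
      using f L_scale[OF bf, of f a] by (simp add: algebra_simps)
    { assume g: "g \<in> borel_measurable borel \<inter> bounded_functions"
      show "L (?f (\<lambda>x. f x + g x)) - (\<integral>x. (f x + g x) * D x \<partial>\<eta>) =
          L (?f f) - (\<integral>x. f x * D x \<partial>\<eta>) + (L (?f g) - (\<integral>x. g x * D x \<partial>\<eta>))"
        using f g L_add[OF bf bf, of f g] Bochner_Integration.integral_add[OF int[of f] int[of g]]
        by (simp add: distrib_right) }
    { assume \<epsilon>: "\<And>x. \<bar>f x\<bar> \<le> \<epsilon>"
      have "\<epsilon> \<ge> 0"
        using \<epsilon>[of undefined] by linarith
      then have "\<bar>L (?f f)\<bar> \<le> \<epsilon>"
        using f \<epsilon> by (intro L_bound bf) (auto simp: indicator_def)
      moreover have "\<bar>\<integral>x. f x * D x \<partial>\<eta>\<bar> \<le> (\<integral>x. \<epsilon> * D x \<partial>\<eta>)"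
        using f \<epsilon> D(2,3) int[of f]
        by (intro integral_abs_bound[THEN order_trans] integral_mono integrable_abs)
          (auto simp: abs_mult intro!: mult_right_mono)
      ultimately show "\<bar>L (?f f) - (\<integral>x. f x * D x \<partial>\<eta>)\<bar> \<le> (1 + (\<integral>x. D x \<partial>\<eta>)) * \<epsilon>"
        by (simp add: algebra_simps) }
  next
    fix A :: "'e set" assume "A \<in> sets borel"
    then show "L (?f (indicator A)) - (\<integral>x. indicator A x * D x \<partial>\<eta>) = 0"
      using D(4) by (simp add: mass_def)
  qed (use f in auto)
  then show ?thesis
    by simp
qed

text \<open>Densities are determined only almost everywhere, and so are the relations between them.
  As words are countable, one null set collects all failures, and the weights are redefined
  there.\<close>

lemma cell_weights:
  fixes B :: "nat \<Rightarrow> 's set"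
  obtains \<theta> where "\<And>w. (\<lambda>x. \<theta> x w) \<in> borel_measurable borel" "\<And>x w. 0 \<le> \<theta> x w" "\<And>x. \<theta> x [] = 1"
    "\<And>x w. \<theta> x w = \<theta> x (True # w) + \<theta> x (False # w)" "\<And>x w. cell B w = {} \<Longrightarrow> \<theta> x w = 0"
    "\<And>w. integrable \<eta> (\<lambda>x. \<theta> x w)"
    "\<And>w A. A \<in> sets borel \<Longrightarrow> mass (cell B w) A = (\<integral>x. indicator A x * \<theta> x w \<partial>\<eta>)"
proof -
  have "\<exists>D. D \<in> borel_measurable borel \<and> (\<forall>x. 0 \<le> D x) \<and> integrable \<eta> D \<and>
    (\<forall>A\<in>sets borel. mass (cell B w) A = (\<integral>x. indicator A x * D x \<partial>\<eta>))" for w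
    using mass_density[of "cell B w"] by metis
  then obtain D where D [measurable]: "\<And>w. D w \<in> borel_measurable borel" and D_nonneg: "\<And>w x. 0 \<le> D w x"
    and D_int: "\<And>w. integrable \<eta> (D w)"
    and D_mass: "\<And>w A. A \<in> sets borel \<Longrightarrow> mass (cell B w) A = (\<integral>x. indicator A x * D w x \<partial>\<eta>)"
    by metis
  have eq: "AE x in \<eta>. f x = g x"
    if "integrable \<eta> f" "integrable \<eta> g"
      "\<And>A. A \<in> sets borel \<Longrightarrow> (\<integral>x. indicator A x * f x \<partial>\<eta>) = (\<integral>x. indicator A x * g x \<partial>\<eta>)" for f g :: "'e \<Rightarrow> real"
    using that by (intro density_unique_real) (auto simp: set_lebesgue_integral_def)
  define good where "good x \<longleftrightarrow> D [] x = 1 \<and> (\<forall>w. D w x = D (True # w) x + D (False # w) x) \<and>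
      (\<forall>w\<in>{w. cell B w = {}}. D w x = 0)" for x
  have "AE x in \<eta>. D [] x = 1"
    using D_int[of "[]"] by (intro eq) (auto simp: D_mass[symmetric] mass_def marginal)
  moreover have "AE x in \<eta>. \<forall>w. D w x = D (True # w) x + D (False # w) x"
    unfolding AE_all_countable
  proof (intro allI eq)
    fix w and A :: "'e set" assume [measurable]: "A \<in> sets borel"
    have i: "integrable \<eta> (\<lambda>x. indicator A x * D w x)" for w
      using integrable_mult_indicator[OF _ D_int[of w], of A] by simp
    have "(\<lambda>p. indicator A (fst p) * indicator (cell B w) (snd p) :: real) =
        (\<lambda>p. indicator A (fst p) * indicator (cell B (True # w)) (snd p) +
              indicator A (fst p) * indicator (cell B (False # w)) (snd p))"
      by (intro ext) (auto split: split_indicator)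
    then have "mass (cell B w) A = mass (cell B (True # w)) A + mass (cell B (False # w)) A"
      by (simp only: mass_def L_add[OF bounded_rectangle bounded_rectangle])
    then show "(\<integral>x. indicator A x * D w x \<partial>\<eta>) = (\<integral>x. indicator A x * (D (True # w) x + D (False # w) x) \<partial>\<eta>)"
      using i by (simp add: D_mass distrib_left del: cell.simps)
  qed (auto intro: D_int)
  moreover have "AE x in \<eta>. \<forall>w\<in>{w. cell B w = {}}. D w x = 0"
  proof (intro AE_ball_countable'[OF eq])
    fix w and A :: "'e set" assume "w \<in> {w. cell B w = {}}" "A \<in> sets borel"
    then show "(\<integral>x. indicator A x * D w x \<partial>\<eta>) = (\<integral>x. indicator A x * 0 \<partial>\<eta>)"
      by (simp add: D_mass[symmetric] mass_def)
  qed (auto intro: D_int)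
  ultimately have good: "AE x in \<eta>. good x"
    by eventually_elim (unfold good_def, intro conjI)
  have [measurable]: "Measurable.pred borel good"
    unfolding good_def by measurable
  \<comment> \<open>Any point will do: the weights of the point mass at \<open>y0\<close> satisfy
    all relations exactly.\<close>
  define y0 :: 's where "y0 = undefined"
  define \<theta> where "\<theta> x w = (if good x then D w x else indicator (cell B w) y0)" for x w
  have AE: "AE x in \<eta>. D w x = \<theta> x w" for w
    using good by eventually_elim (simp add: \<theta>_def)
  have meas: "(\<lambda>x. \<theta> x w) \<in> borel_measurable borel" for w
    unfolding \<theta>_def by measurable
  note [measurable] = meas
  show ?thesis
  proof (rule that[of \<theta>])
    show "integrable \<eta> (\<lambda>x. \<theta> x w)" for w
      using D_int[of w] AE[of w] by (subst integrable_cong_AE[symmetric]) auto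
    show "mass (cell B w) A = (\<integral>x. indicator A x * \<theta> x w \<partial>\<eta>)" if [measurable]: "A \<in> sets borel" for w A
      unfolding D_mass[OF that] using AE[of w] by (intro integral_cong_AE) auto
    show "\<theta> x w = \<theta> x (True # w) + \<theta> x (False # w)" for x w
    proof (cases "good x")
      case True
      then have "D w x = D (True # w) x + D (False # w) x"
        unfolding good_def by blast
      with True show ?thesis
        by (simp add: \<theta>_def)
    qed (auto simp: \<theta>_def split: split_indicator)
    show "\<theta> x [] = 1" "cell B w = {} \<Longrightarrow> \<theta> x w = 0" for x w
      unfolding \<theta>_def by (cases "good x"; simp; unfold good_def; blast)+
  qed (auto simp: \<theta>_def D_nonneg meas)
qed

text \<open>Riesz representation of \<open>L\<close>, in the form of a joint law of \<open>(x, Y (x, u))\<close> with \<open>u\<close> uniform.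
  Only an inequality is stated: applied to \<open>\<phi>\<close> and \<open>- \<phi>\<close> it becomes an equality for functions
  continuous in the second variable.\<close>

theorem representation:
  assumes compact: "compact (UNIV :: 's set)"
  obtains Y :: "'e \<times> real \<Rightarrow> 's" where "Y \<in> measurable (borel \<Otimes>\<^sub>M borel) borel"
    "\<And>\<phi> d. (\<And>x y a. a < \<phi> (x, y) \<Longrightarrow> \<exists>\<delta>>0. \<forall>y'. dist y' y < \<delta> \<longrightarrow> a < \<phi> (x, y')) \<Longrightarrow>
       (\<And>C. closed C \<Longrightarrow> (\<lambda>x. INF y\<in>C. \<phi> (x, y)) \<in> borel_measurable borel) \<Longrightarrow>
       (\<And>f. f \<in> bounded_functions \<Longrightarrow> (\<And>p. ennreal (f p) \<le> \<phi> p) \<Longrightarrow> L f \<le> d) \<Longrightarrow>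
       (\<integral>\<^sup>+x. \<integral>\<^sup>+u. \<phi> (x, Y (x, u)) \<partial>unif \<partial>\<eta>) \<le> ennreal d"
proof -
  obtain \<B> :: "'s set set" where \<B>: "countable \<B>" "topological_basis \<B>"
    using ex_countable_basis by auto
  then have ne: "\<B> \<noteq> {}"
    by (metis Union_empty UNIV_I all_not_in_conv empty_iff open_UNIV subset_empty topological_basis_def)
  define B where "B = from_nat_into \<B>"
  have B\<B>: "B i \<in> \<B>" for i
    unfolding B_def by (rule from_nat_into[OF ne])
  have open_B: "open (B i)" for i
    by (rule topological_basis_open[OF \<B>(2) B\<B>])
  have basis_B: "\<exists>i. y \<in> B i \<and> B i \<subseteq> U" if U: "open U" "y \<in> U" for U y
  proof -
    obtain C where "C \<in> \<B>" "y \<in> C" "C \<subseteq> U"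
      using topological_basisE[OF \<B>(2) U] by metis
    then show ?thesis
      using from_nat_into_surj[OF \<B>(1)] unfolding B_def by metis
  qed
  obtain \<theta> where \<theta>: "\<And>w. (\<lambda>x. \<theta> x w) \<in> borel_measurable borel" "\<And>x w. 0 \<le> \<theta> x w" "\<And>x. \<theta> x [] = 1"
    "\<And>x w. \<theta> x w = \<theta> x (True # w) + \<theta> x (False # w)" "\<And>x w. cell B w = {} \<Longrightarrow> \<theta> x w = 0"
    "\<And>w. integrable \<eta> (\<lambda>x. \<theta> x w)"
    "\<And>w A. A \<in> sets borel \<Longrightarrow> mass (cell B w) A = (\<integral>x. indicator A x * \<theta> x w \<partial>\<eta>)"
    by (rule cell_weights[of B]) (rule that)
  interpret cell_tree B \<theta>
    by unfold_locales (fact compact open_B basis_B \<theta>)+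
  show ?thesis
  proof (rule that[OF measurable_selection])
    fix \<phi> :: "'e \<times> 's \<Rightarrow> ennreal" and d :: real
    assume lsc: "\<And>x y a. a < \<phi> (x, y) \<Longrightarrow> \<exists>\<delta>>0. \<forall>y'. dist y' y < \<delta> \<longrightarrow> a < \<phi> (x, y')"
      and inf: "\<And>C. closed C \<Longrightarrow> (\<lambda>x. INF y\<in>C. \<phi> (x, y)) \<in> borel_measurable borel"
      and L_le: "\<And>f. f \<in> bounded_functions \<Longrightarrow> (\<And>p. ennreal (f p) \<le> \<phi> p) \<Longrightarrow> L f \<le> d"
    show "(\<integral>\<^sup>+x. \<integral>\<^sup>+u. \<phi> (x, selection (x, u)) \<partial>unif \<partial>\<eta>) \<le> ennreal d"
    proof (rule nn_integral_selection_le[OF _ lsc])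
      show meas: "(\<lambda>x. INF y\<in>closure (cell B w). \<phi> (x, y)) \<in> borel_measurable borel" for w
        by (rule inf) simp
      fix k :: nat
      define m where "m w x = min (of_nat k) (INF y\<in>closure (cell B w). \<phi> (x, y))" for w x
      define f where "f w x = enn2real (m w x)" for w x
      have [measurable]: "m w \<in> borel_measurable borel" for w
        unfolding m_def using meas by measurable
      have [measurable]: "f w \<in> borel_measurable borel" for w
        unfolding f_def by measurable
      have "m w x < top" for w x
        unfolding m_def by (simp add: min_less_iff_disj of_nat_less_top)
      then have mf: "m w x = ennreal (f w x)" for w x
        by (simp add: f_def)
      have "f w x \<le> k" for w x
        using enn2real_mono[of "m w x" "of_nat k"] by (simp add: f_def m_def of_nat_less_top)
      then have f: "f w \<in> bounded_functions" for w
        by (intro bounded_functionsI[of _ k]) (simp add: f_def)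
      have bf: "(\<lambda>p. f w (fst p) * indicator C (snd p)) \<in> bounded_functions" for w and C :: "'s set"
        by (rule bounded_functions_product[OF f bounded_functions_indicator])
      \<comment> \<open>A step function below \<open>\<phi>\<close>: on each cell it is the capped
        infimum over the closure of that cell. Hence \<open>L F \<le> d\<close>, while finite
        additivity expresses \<open>L F\<close> through the weights.\<close>
      define F where "F p = (\<Sum>w | length w = k. f w (fst p) * indicator (cell B w) (snd p))" for p
      have "F p = (\<Sum>w | length w = k. if w = code B (snd p) k then f w (fst p) else 0)" for p
        unfolding F_def by (intro sum.cong) (auto simp: in_cell_iff indicator_def)
      then have F: "F p = f (code B (snd p) k) (fst p)" for p
        using finite_words[of k] by simp
      have "ennreal (F (x, y)) \<le> \<phi> (x, y)" for x y
      proof -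
        have "ennreal (F (x, y)) \<le> (INF y\<in>closure (cell B (code B y k)). \<phi> (x, y))"
          unfolding F mf[symmetric] by (simp add: m_def)
        also have "\<dots> \<le> \<phi> (x, y)"
          using closure_subset[of "cell B (code B y k)"] by (intro INF_lower) (auto simp: in_cell_iff)
        finally show ?thesis .
      qed
      then have L_F_le: "L F \<le> d"
        using bf by (intro L_le) (auto simp: F_def[abs_def] intro!: bounded_functions_sum)
      have L_F: "L F = (\<Sum>w | length w = k. \<integral>x. f w x * \<theta> x w \<partial>\<eta>)"
        unfolding F_def[abs_def] L_sum[OF finite_words bf]
        by (intro sum.cong refl L_product_indicator \<theta>) (auto simp: f)
      have sum_eq: "(\<integral>\<^sup>+x. (\<Sum>w | length w = k. m w x * ennreal (\<theta> x w)) \<partial>\<eta>) =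
          (\<Sum>w | length w = k. \<integral>\<^sup>+x. ennreal (f w x * \<theta> x w) \<partial>\<eta>)"
        unfolding mf by (subst nn_integral_sum) (auto simp: ennreal_mult f_def \<theta>(2))
      have int: "(\<integral>\<^sup>+x. ennreal (f w x * \<theta> x w) \<partial>\<eta>) = ennreal (\<integral>x. f w x * \<theta> x w \<partial>\<eta>)" for w
      proof (rule nn_integral_eq_integral)
        show "integrable \<eta> (\<lambda>x. f w x * \<theta> x w)"
          using \<open>\<And>w x. f w x \<le> k\<close> \<theta>(2)
          by (intro Bochner_Integration.integrable_bound[OF integrable_mult_right[OF \<theta>(6)[of w], of "real k"]])
            (auto simp: abs_mult f_def intro!: mult_right_mono)
      qed (simp add: f_def \<theta>(2))
      have "(\<Sum>w | length w = k. \<integral>\<^sup>+x. ennreal (f w x * \<theta> x w) \<partial>\<eta>) =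
          (\<Sum>w | length w = k. ennreal (\<integral>x. f w x * \<theta> x w \<partial>\<eta>))"
        by (simp only: int)
      also have "\<dots> = ennreal (L F)"
        unfolding L_F by (intro sum_ennreal integral_nonneg_AE) (auto simp: f_def \<theta>(2))
      also have "\<dots> \<le> ennreal d"
        by (rule ennreal_leI[OF L_F_le])
      finally show "(\<integral>\<^sup>+x. (\<Sum>w | length w = k. min (of_nat k) (INF y\<in>closure (cell B w). \<phi> (x, y)) * ennreal (\<theta> x w)) \<partial>\<eta>) \<le> ennreal d"
        unfolding sum_eq[symmetric] m_def .
    qed simp
  qed
qed

end

section \<open>Couplings given by a random selection\<close>

lemma lower_semicontinuous_snd:
  fixes c :: "'a::metric_space \<times> 'b::metric_space \<Rightarrow> ennreal"
  assumes "lower_semicontinuous c" "a < c (x, y)"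
  shows "\<exists>\<delta>>0. \<forall>y'. dist y' y < \<delta> \<longrightarrow> a < c (x, y')"
proof -
  have "open {p. a < c p}"
    using assms(1) by (auto simp: lower_semicontinuous_def)
  then obtain \<delta> where \<delta>: "\<delta> > 0" "\<And>q. dist q (x, y) < \<delta> \<Longrightarrow> a < c q"
    using assms(2) unfolding open_dist by blast
  then show ?thesis
    by (auto simp: dist_Pair_Pair intro!: exI[of _ \<delta>])
qed

lemma lower_semicontinuous_borel [measurable_dest]:
  "lower_semicontinuous f \<Longrightarrow> f \<in> borel_measurable borel"
  unfolding lower_semicontinuous_def by (intro borel_measurableI_greater) simp

text \<open>The tube lemma turns the bound on \<open>{x} \<times> C\<close> into one on a
  neighbourhood of \<open>x\<close>; the intermediate level \<open>b\<close> keeps the inequality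
  strict once the infimum is taken.\<close>

lemma lower_semicontinuous_INF:
  fixes c :: "'a::topological_space \<times> 'b::topological_space \<Rightarrow> ennreal"
  assumes c: "lower_semicontinuous c" and C: "compact C"
  shows "lower_semicontinuous (\<lambda>x. INF y\<in>C. c (x, y))"
  unfolding lower_semicontinuous_def
proof
  fix a
  show "open {x. a < (INF y\<in>C. c (x, y))}"
  proof (subst open_subopen, safe)
    fix x assume "a < (INF y\<in>C. c (x, y))"
    then obtain b where b: "a < b" "b < (INF y\<in>C. c (x, y))"
      using dense by blast
    have "open {p. b < c p}"
      using c by (auto simp: lower_semicontinuous_def)
    moreover have "{x} \<times> C \<subseteq> {p. b < c p}"
      using b(2) by (auto intro: less_INF_D)
    ultimately obtain X where X: "x \<in> X" "open X" "X \<times> C \<subseteq> {p. b < c p}"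
      using Elementary_Topology.tube_lemma[OF C, of "{p. b < c p}" x] by auto
    have "a < (INF y\<in>C. c (x', y))" if "x' \<in> X" for x'
    proof -
      have "b \<le> (INF y\<in>C. c (x', y))"
        using X(3) that by (intro INF_greatest less_imp_le) auto
      with b(1) show ?thesis
        by simp
    qed
    then show "\<exists>T. open T \<and> x \<in> T \<and> T \<subseteq> {x. a < (INF y\<in>C. c (x, y))}"
      using X by auto
  qed
qed

text \<open>Continuity in the second variable reduces the infimum to a countable dense subset of
  \<open>C\<close>. This serves functions that are merely Borel in the first variable, for which
  semi-continuity gives nothing.\<close>

lemma measurable_INF_continuous:
  fixes \<phi> :: "'a::topological_space \<times> 'b::{second_countable_topology, metric_space} \<Rightarrow> ennreal"
  assumes [measurable]: "\<And>y. (\<lambda>x. \<phi> (x, y)) \<in> borel_measurable borel"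
    and cont: "\<And>x. continuous_on UNIV (\<lambda>y. \<phi> (x, y))"
  shows "(\<lambda>x. INF y\<in>C. \<phi> (x, y)) \<in> borel_measurable borel"
proof -
  obtain D where D: "countable D" "D \<subseteq> C" "C \<subseteq> closure D"
    using separable by metis
  have "(INF y\<in>C. \<phi> (x, y)) = (INF y\<in>D. \<phi> (x, y))" for x
  proof (rule antisym)
    show "(INF y\<in>C. \<phi> (x, y)) \<le> (INF y\<in>D. \<phi> (x, y))"
      by (rule INF_superset_mono[OF D(2)]) simp
    have "closed {y. (INF y\<in>D. \<phi> (x, y)) \<le> \<phi> (x, y)}"
      using cont[of x] by (intro closed_Collect_le) auto
    then have "closure D \<subseteq> {y. (INF y\<in>D. \<phi> (x, y)) \<le> \<phi> (x, y)}"
      by (intro closure_minimal) (auto intro: INF_lower)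
    then show "(INF y\<in>D. \<phi> (x, y)) \<le> (INF y\<in>C. \<phi> (x, y))"
      using D(3) by (intro INF_greatest) auto
  qed
  moreover have "(\<lambda>x. INF y\<in>D. \<phi> (x, y)) \<in> borel_measurable borel"
    using D(1) by (intro borel_measurable_INF) auto
  ultimately show ?thesis
    by simp
qed

section \<open>Laws of random graphs and their kernels\<close>

definition graph_law :: "'e measure \<Rightarrow> ('e::polish_space \<times> real \<Rightarrow> 's::polish_space) \<Rightarrow> ('e \<times> 's) measure" where
  "graph_law \<eta> Y = distr (\<eta> \<Otimes>\<^sub>M unif) borel (\<lambda>p. (fst p, Y p))"

text \<open>Describing the plan by a map \<open>Y\<close> gives its disintegration explicitly, as a
  probability for every \<open>x\<close>, and Tonelli's theorem identifies it as an associated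
  kernel.\<close>

definition graph_kernel :: "('e::polish_space \<times> real \<Rightarrow> 's::polish_space) \<Rightarrow> 'e \<Rightarrow> 's measure" where
  "graph_kernel Y x = distr unif borel (\<lambda>u. Y (x, u))"

locale graph_coupling = prob_space \<eta> for \<eta> :: "'e::polish_space measure" +
  fixes Y :: "'e \<times> real \<Rightarrow> 's::polish_space"
  assumes sets_first [measurable_cong, simp]: "sets \<eta> = sets borel"
    and Y [measurable]: "Y \<in> measurable (borel \<Otimes>\<^sub>M borel) borel"
begin

sublocale unif: prob_space unif
  by (rule prob_space_unif)

sublocale pair_prob_space \<eta> unif
  by unfold_locales

lemma space_first [simp]: "space \<eta> = UNIV"
  using sets_eq_imp_space_eq[OF sets_first] by simp

lemma measurable_pair_Y [measurable]: "(\<lambda>p. (fst p, Y p)) \<in> measurable (\<eta> \<Otimes>\<^sub>M unif) borel"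
  unfolding borel_prod[symmetric] by measurable

lemma nn_integral_graph_law:
  assumes [measurable]: "\<phi> \<in> borel_measurable borel"
  shows "(\<integral>\<^sup>+p. \<phi> p \<partial>graph_law \<eta> Y) = (\<integral>\<^sup>+x. \<integral>\<^sup>+u. \<phi> (x, Y (x, u)) \<partial>unif \<partial>\<eta>)"
proof -
  have "(\<integral>\<^sup>+p. \<phi> p \<partial>graph_law \<eta> Y) = (\<integral>\<^sup>+p. \<phi> (fst p, Y p) \<partial>(\<eta> \<Otimes>\<^sub>M unif))"
    unfolding graph_law_def by (rule nn_integral_distr) auto
  also have "\<dots> = (\<integral>\<^sup>+x. \<integral>\<^sup>+u. \<phi> (x, Y (x, u)) \<partial>unif \<partial>\<eta>)"
    by (subst unif.nn_integral_fst[symmetric]) auto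
  finally show ?thesis .
qed

lemma sets_graph_law [simp, measurable_cong]: "sets (graph_law \<eta> Y) = sets borel"
  by (simp add: graph_law_def)

lemma measurable_fst_graph_law [measurable]: "fst \<in> measurable (graph_law \<eta> Y) borel"
  and measurable_snd_graph_law [measurable]: "snd \<in> measurable (graph_law \<eta> Y) borel"
  unfolding measurable_cong_sets[OF sets_graph_law refl]
  by (auto intro!: borel_measurable_continuous_onI continuous_intros)

lemma prob_space_graph_law: "prob_space (graph_law \<eta> Y)"
  unfolding graph_law_def by (rule prob_space_distr) simp

lemma prob_algebra_graph_law: "graph_law \<eta> Y \<in> space (prob_algebra borel)"
  by (simp add: space_prob_algebra prob_space_graph_law)

lemma prob_algebra_graph_kernel: "graph_kernel Y x \<in> space (prob_algebra borel)"
  unfolding space_prob_algebra graph_kernel_def by (simp add: unif.prob_space_distr)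

lemma distr_graph_law_fst: "distr (graph_law \<eta> Y) borel fst = \<eta>"
proof -
  have "distr (graph_law \<eta> Y) borel fst = distr (\<eta> \<Otimes>\<^sub>M unif) borel fst"
    unfolding graph_law_def by (subst distr_distr) (auto simp: comp_def simp flip: borel_prod)
  also have "\<dots> = distr (\<eta> \<Otimes>\<^sub>M unif) \<eta> fst"
    by (rule distr_cong) auto
  also have "\<dots> = \<eta>"
    by (rule unif.distr_pair_fst)
  finally show ?thesis .
qed

lemma emeasure_graph_kernel:
  "B \<in> sets borel \<Longrightarrow> emeasure (graph_kernel Y x) B = (\<integral>\<^sup>+u. indicator B (Y (x, u)) \<partial>unif)"
  using nn_integral_distr[of "\<lambda>u. Y (x, u)" unif borel "indicator B"]
  by (simp add: graph_kernel_def)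

lemma associated_kernel_graph: "associated_kernel \<eta> (graph_law \<eta> Y) (graph_kernel Y)"
proof -
  interpret K: prob_space "graph_kernel Y x" for x
    using prob_algebra_graph_kernel by (simp add: space_prob_algebra)
  interpret G: prob_space "graph_law \<eta> Y"
    by (rule prob_space_graph_law)
  have meas: "(\<lambda>x. measure (graph_kernel Y x) B) \<in> borel_measurable borel" if [measurable]: "B \<in> sets borel" for B
  proof -
    have "(\<lambda>x. emeasure (graph_kernel Y x) B) \<in> borel_measurable borel"
      unfolding emeasure_graph_kernel[OF that] by measurable
    then show ?thesis
      unfolding measure_def by measurable
  qed
  have "measure (graph_law \<eta> Y) (A \<times> B) = (LINT x:A|\<eta>. measure (graph_kernel Y x) B)"
    if [measurable]: "A \<in> sets borel" "B \<in> sets borel" for A B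
  proof -
    note [measurable] = meas
    have "A \<times> B \<in> sets borel"
      unfolding borel_prod[symmetric] by measurable
    then have "emeasure (graph_law \<eta> Y) (A \<times> B) = (\<integral>\<^sup>+p. indicator (A \<times> B) p \<partial>graph_law \<eta> Y)"
      by simp
    also have "\<dots> = (\<integral>\<^sup>+x. \<integral>\<^sup>+u. indicator A x * indicator B (Y (x, u)) \<partial>unif \<partial>\<eta>)"
      using \<open>A \<times> B \<in> sets borel\<close> by (subst nn_integral_graph_law) (auto simp: indicator_times)
    also have "\<dots> = (\<integral>\<^sup>+x. indicator A x * emeasure (graph_kernel Y x) B \<partial>\<eta>)"
      by (intro nn_integral_cong) (simp add: nn_integral_cmult emeasure_graph_kernel)
    also have "\<dots> = (\<integral>\<^sup>+x. ennreal (indicator A x * measure (graph_kernel Y x) B) \<partial>\<eta>)"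
      by (intro nn_integral_cong) (auto simp: K.emeasure_eq_measure split: split_indicator)
    finally have "ennreal (measure (graph_law \<eta> Y) (A \<times> B)) =
        (\<integral>\<^sup>+x. ennreal (indicator A x * measure (graph_kernel Y x) B) \<partial>\<eta>)"
      by (simp add: G.emeasure_eq_measure)
    then show ?thesis
      unfolding set_lebesgue_integral_def
      by (subst integral_eq_nn_integral) (auto simp flip: \<open>ennreal _ = _\<close>)
  qed
  then show ?thesis
    using prob_algebra_graph_kernel meas by (auto simp: associated_kernel_def)
qed

lemma integral_graph_law:
  fixes f :: "'e \<times> 's \<Rightarrow> real"
  assumes [measurable]: "f \<in> borel_measurable borel" and f: "\<And>p. 0 \<le> f p"
  shows "(\<integral>p. f p \<partial>graph_law \<eta> Y) = enn2real (\<integral>\<^sup>+x. \<integral>\<^sup>+u. ennreal (f (x, Y (x, u))) \<partial>unif \<partial>\<eta>)"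
  using f by (subst integral_eq_nn_integral) (auto simp: nn_integral_graph_law)

lemma integrable_graph_law:
  assumes "f \<in> borel_measurable borel" "f \<in> bounded_functions"
  shows "integrable (graph_law \<eta> Y) f"
proof -
  interpret G: prob_space "graph_law \<eta> Y"
    by (rule prob_space_graph_law)
  obtain M where "\<And>p. \<bar>f p\<bar> \<le> M"
    using assms(2) by (auto simp: bounded_functions_iff)
  then show ?thesis
    using assms(1) by (intro G.integrable_const_bound[of _ M]) auto
qed

end

context positive_functional
begin

text \<open>The two classes of functions meet the measurability demand of
  \<open>representation\<close> differently: infima of a lower semi-continuous cost over closed,
  hence compact, sets are lower semi-continuous, while for functions continuous in \<open>y\<close>
  a countable dense set suffices.\<close>

lemma graph_coupling_exists:
  assumes compact: "compact (UNIV :: 's set)"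
  obtains Y where "graph_coupling \<eta> Y"
    "\<And>c d. lower_semicontinuous c \<Longrightarrow> (\<And>f. f \<in> bounded_functions \<Longrightarrow> (\<And>p. ennreal (f p) \<le> c p) \<Longrightarrow> L f \<le> d) \<Longrightarrow>
      (\<integral>\<^sup>+p. c p \<partial>graph_law \<eta> Y) \<le> ennreal d"
    "\<And>f. f \<in> borel_measurable borel \<Longrightarrow> f \<in> bounded_functions \<Longrightarrow> (\<And>x. continuous_on UNIV (\<lambda>y. f (x, y))) \<Longrightarrow>
      (\<integral>p. f p \<partial>graph_law \<eta> Y) = L f"
proof (rule representation[OF compact])
  fix Y :: "'e \<times> real \<Rightarrow> 's"
  assume Y_R: "Y \<in> measurable (borel \<Otimes>\<^sub>M borel) borel"
    "\<And>\<phi> d. (\<And>x y a. a < \<phi> (x, y) \<Longrightarrow> \<exists>\<delta>>0. \<forall>y'. dist y' y < \<delta> \<longrightarrow> a < \<phi> (x, y')) \<Longrightarrow>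
       (\<And>C. closed C \<Longrightarrow> (\<lambda>x. INF y\<in>C. \<phi> (x, y)) \<in> borel_measurable borel) \<Longrightarrow>
       (\<And>f. f \<in> bounded_functions \<Longrightarrow> (\<And>p. ennreal (f p) \<le> \<phi> p) \<Longrightarrow> L f \<le> d) \<Longrightarrow>
       (\<integral>\<^sup>+x. \<integral>\<^sup>+u. \<phi> (x, Y (x, u)) \<partial>unif \<partial>\<eta>) \<le> ennreal d"
  interpret graph_coupling \<eta> Y
    by unfold_locales (auto simp: Y_R(1))
  interpret G: prob_space "graph_law \<eta> Y"
    by (rule prob_space_graph_law)
  have upper: "(\<integral>p. f p \<partial>graph_law \<eta> Y) \<le> L f"
    if [measurable]: "f \<in> borel_measurable borel" and f: "f \<in> bounded_functions"
      and cont: "\<And>x. continuous_on UNIV (\<lambda>y. f (x, y))" for f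
  proof -
    obtain M where M: "\<And>p. \<bar>f p\<bar> \<le> M"
      using f by (auto simp: bounded_functions_iff)
    \<comment> \<open>The representation is stated for non-negative functions; adding the bound
      \<open>M\<close> brings \<open>f\<close> into its scope, and \<open>L\<close> and the law both
      have total mass one.\<close>
    have nonneg: "0 \<le> f p + M" for p
      using M[of p] by linarith
    have L_fM: "L (\<lambda>p. f p + M) = L f + M"
      using L_add[OF f bounded_functions_const, of M] L_scale[of "\<lambda>p. 1" M] by simp
    have L_nonneg: "0 \<le> L (\<lambda>p. f p + M)"
      using mono[of "\<lambda>p. 0" "\<lambda>p. f p + M"] f nonneg by (auto intro: bounded_functions_add)
    define \<phi> where "\<phi> p = ennreal (f p + M)" for p
    have cont_\<phi>: "continuous_on UNIV (\<lambda>y. \<phi> (x, y))" for x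
      unfolding \<phi>_def using cont by (intro continuous_on_ennreal continuous_intros)
    have "(\<integral>\<^sup>+x. \<integral>\<^sup>+u. \<phi> (x, Y (x, u)) \<partial>unif \<partial>\<eta>) \<le> ennreal (L f + M)"
    proof (rule Y_R(2))
      fix x y a assume "a < \<phi> (x, y)"
      moreover have "open {y. a < \<phi> (x, y)}"
        by (rule open_Collect_less[OF continuous_on_const cont_\<phi>])
      ultimately show "\<exists>\<delta>>0. \<forall>y'. dist y' y < \<delta> \<longrightarrow> a < \<phi> (x, y')"
        unfolding open_dist by blast
    next
      have "(\<lambda>x. f (x, y)) \<in> borel_measurable borel" for y
        by (rule measurable_compose[of "\<lambda>x. (x, y)" _ borel])
          (auto intro!: borel_measurable_continuous_onI continuous_intros)
      then show "(\<lambda>x. INF y\<in>C. \<phi> (x, y)) \<in> borel_measurable borel" for C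
        by (intro measurable_INF_continuous cont_\<phi>) (simp add: \<phi>_def)
    next
      fix g assume g: "g \<in> bounded_functions" "\<And>p. ennreal (g p) \<le> \<phi> p"
      have "g p \<le> f p + M" for p
        using g(2)[of p] unfolding \<phi>_def ennreal_le_iff[OF nonneg] .
      then have "L g \<le> L (\<lambda>p. f p + M)"
        using f by (intro mono g(1) bounded_functions_add bounded_functions_const)
      then show "L g \<le> L f + M"
        by (simp add: L_fM)
    qed
    then have "(\<integral>p. f p + M \<partial>graph_law \<eta> Y) \<le> L f + M"
      using L_nonneg nonneg unfolding \<phi>_def
      by (subst integral_graph_law) (auto simp: L_fM intro!: enn2real_leI)
    moreover have "(\<integral>p. f p + M \<partial>graph_law \<eta> Y) = (\<integral>p. f p \<partial>graph_law \<eta> Y) + M"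
      using integrable_graph_law[OF _ f] by (subst Bochner_Integration.integral_add) (auto simp: G.prob_space)
    ultimately show ?thesis
      by simp
  qed
  have compact_closed: "compact C" if "closed C" for C :: "'s set"
    using compact_Int_closed[OF compact that] by simp
  show thesis
  proof (rule that)
    show "graph_coupling \<eta> Y" ..
  next
    fix c d assume c: "lower_semicontinuous c"
      and d: "\<And>f. f \<in> bounded_functions \<Longrightarrow> (\<And>p. ennreal (f p) \<le> c p) \<Longrightarrow> L f \<le> d"
    have "(\<integral>\<^sup>+x. \<integral>\<^sup>+u. c (x, Y (x, u)) \<partial>unif \<partial>\<eta>) \<le> ennreal d"
      by (rule Y_R(2)[OF lower_semicontinuous_snd[OF c]
            lower_semicontinuous_borel[OF lower_semicontinuous_INF[OF c compact_closed]] d])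
    then show "(\<integral>\<^sup>+p. c p \<partial>graph_law \<eta> Y) \<le> ennreal d"
      using c by (simp add: nn_integral_graph_law lower_semicontinuous_borel)
  next
    fix f :: "'e \<times> 's \<Rightarrow> real"
    assume f: "f \<in> borel_measurable borel" "f \<in> bounded_functions" "\<And>x. continuous_on UNIV (\<lambda>y. f (x, y))"
    have "(\<integral>p. - f p \<partial>graph_law \<eta> Y) \<le> L (\<lambda>p. - f p)"
      using f by (intro upper) (auto intro: continuous_on_minus)
    moreover have "L (\<lambda>p. - f p) = - L f"
      using L_scale[OF f(2), of "-1"] by simp
    ultimately show "(\<integral>p. f p \<partial>graph_law \<eta> Y) = L f"
      using upper[OF f] by simp
  qed
qed

end

section \<open>Completed sigma-fields and conditional expectation\<close>

lemma sets_completed_by: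
  "sets (completed_by \<eta> G) = sigma_sets UNIV (sets G \<union> null_sets (completion \<eta>))"
  by (simp add: completed_by_def)

lemma space_completed_by [simp]: "space (completed_by \<eta> G) = UNIV"
  by (simp add: completed_by_def)

lemma sets_completed_by_subset:
  assumes "space \<eta> = UNIV" "sets G \<subseteq> sets \<eta>"
  shows "sets (completed_by \<eta> G) \<subseteq> sets (completion \<eta>)"
proof -
  have "sigma_sets (space (completion \<eta>)) (sets G \<union> null_sets (completion \<eta>)) \<subseteq> sets (completion \<eta>)"
    using assms by (intro sets.sigma_sets_subset) auto
  then show ?thesis
    using assms by (simp add: sets_completed_by)
qed

text \<open>Preimages under \<open>f\<close> and \<open>g\<close> differ by subsets of the
  negligible set \<open>{x. f x \<noteq> g x}\<close>, and the completion contains all of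
  these.\<close>

lemma borel_measurable_completed_by_cong:
  fixes f g :: "'a \<Rightarrow> real"
  assumes \<eta>: "space \<eta> = UNIV"
    and f: "f \<in> borel_measurable (completed_by \<eta> G)" and fg: "AE x in \<eta>. f x = g x"
  shows "g \<in> borel_measurable (completed_by \<eta> G)"
proof (rule measurableI)
  fix B :: "real set" assume B: "B \<in> sets borel"
  have "AE x in completion \<eta>. f x = g x"
    using fg by (rule AE_completion)
  then have N: "{x. f x \<noteq> g x} \<in> null_sets (completion \<eta>)"
    using \<eta> by (simp add: completion.AE_iff_null_sets)
  have null: "A \<in> sets (completed_by \<eta> G)" if "A \<subseteq> {x. f x \<noteq> g x}" for A
    using completion.complete2[OF that N] by (auto simp: sets_completed_by)
  have "f -` B \<in> sets (completed_by \<eta> G)"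
    using measurable_sets[OF f B] by simp
  then have "(f -` B - {x \<in> f -` B. f x \<noteq> g x}) \<union> {x \<in> g -` B. f x \<noteq> g x} \<in> sets (completed_by \<eta> G)"
    by (intro sets.Un sets.Diff) (assumption | rule null, auto)+
  also have "(f -` B - {x \<in> f -` B. f x \<noteq> g x}) \<union> {x \<in> g -` B. f x \<noteq> g x} = g -` B"
    by auto
  finally show "g -` B \<inter> space (completed_by \<eta> G) \<in> sets (completed_by \<eta> G)"
    by simp
qed simp

section \<open>Conditional expectation and centered functions\<close>

definition centered :: "'e::polish_space measure \<Rightarrow> 'e measure \<Rightarrow> ('e \<Rightarrow> real) \<Rightarrow> bool" where
  "centered \<eta> F g \<longleftrightarrow> g \<in> borel_measurable borel \<and> bounded (range g) \<and>
     (\<exists>X \<in> borel_measurable \<eta>. (\<exists>K. AE x in \<eta>. \<bar>X x\<bar> \<le> K) \<and>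
        (AE x in \<eta>. g x = X x - real_cond_exp (completion \<eta>) (completed_by \<eta> F) X x))"

text \<open>The completed sigma-field may leave \<open>sets \<eta>\<close> and is a sub-sigma-field
  of the completion only. Conditional expectations are therefore formed over
  \<open>completion \<eta>\<close>, and \<open>AE_completion_iff\<close> carries statements back to
  \<open>\<eta>\<close>.\<close>

locale sub_borel = prob_space \<eta> for \<eta> :: "'e::polish_space measure" +
  fixes F :: "'e measure"
  assumes sets_borel [measurable_cong, simp]: "sets \<eta> = sets borel"
    and F: "sets F \<subseteq> sets borel"
begin

lemma space_UNIV [simp]: "space \<eta> = UNIV"
  using sets_eq_imp_space_eq[OF sets_borel] by simp

abbreviation "G \<equiv> completed_by \<eta> F"

sublocale completion: prob_space "completion \<eta>"
  by (rule prob_space_completion)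

sublocale completion: finite_measure_subalgebra "completion \<eta>" G
  by unfold_locales (use F sets_completed_by_subset[of \<eta> F] in \<open>simp add: subalgebra_def\<close>)

lemma integrable_bounded:
  fixes X :: "'e \<Rightarrow> real"
  assumes "X \<in> borel_measurable (completion \<eta>)" "AE x in \<eta>. \<bar>X x\<bar> \<le> K"
  shows "integrable (completion \<eta>) X"
  using assms by (intro completion.integrable_const_bound[of _ K]) (auto simp: AE_completion_iff)

lemma real_cond_exp_bounded:
  assumes "X \<in> borel_measurable \<eta>" "AE x in \<eta>. \<bar>X x\<bar> \<le> K"
  shows "AE x in \<eta>. \<bar>real_cond_exp (completion \<eta>) G X x\<bar> \<le> K"
proof -
  have int: "integrable (completion \<eta>) X"
    using assms by (intro integrable_bounded measurable_completion)
  have "AE x in completion \<eta>. real_cond_exp (completion \<eta>) G X x \<le> K"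
    using assms(2) int by (intro completion.real_cond_exp_le_c) (auto simp: AE_completion_iff abs_le_iff)
  moreover have "AE x in completion \<eta>. real_cond_exp (completion \<eta>) G X x \<ge> - K"
    using assms(2) int by (intro completion.real_cond_exp_ge_c) (auto simp: AE_completion_iff abs_le_iff minus_le_iff)
  ultimately show ?thesis
    unfolding AE_completion_iff by eventually_elim auto
qed

text \<open>A bounded factor measurable for \<open>G\<close> can be moved inside the conditional
  expectation, so \<open>X\<close> and its conditional expectation have the same integral against
  \<open>\<phi>\<close>.\<close>

lemma centered_orthogonal:
  assumes g: "centered \<eta> F g" and \<phi>: "\<phi> \<in> borel_measurable G" "\<phi> \<in> borel_measurable borel" "\<And>x. \<bar>\<phi> x\<bar> \<le> C"
  shows "(\<integral>x. g x * \<phi> x \<partial>\<eta>) = 0"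
proof -
  obtain X K where [measurable]: "g \<in> borel_measurable borel"
    and X: "X \<in> borel_measurable \<eta>" "AE x in \<eta>. \<bar>X x\<bar> \<le> K"
      "AE x in \<eta>. g x = X x - real_cond_exp (completion \<eta>) G X x"
    using g by (auto simp: centered_def)
  let ?E = "real_cond_exp (completion \<eta>) G X"
  note [measurable] = \<phi>(2) X(1)
  have Xc: "X \<in> borel_measurable (completion \<eta>)"
    using X(1) by (rule measurable_completion)
  have int: "integrable (completion \<eta>) (\<lambda>x. \<phi> x * X x)"
  proof (rule integrable_bounded)
    show "(\<lambda>x. \<phi> x * X x) \<in> borel_measurable (completion \<eta>)"
      by (intro measurable_completion) measurable
    show "AE x in \<eta>. \<bar>\<phi> x * X x\<bar> \<le> C * K"
      using X(2) by eventually_elim (auto simp: abs_mult intro!: mult_mono \<phi>(3) order_trans[OF abs_ge_zero \<phi>(3)])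
  qed
  note E = completion.real_cond_exp_intg[OF int \<phi>(1) Xc]
  have "(\<integral>x. g x * \<phi> x \<partial>\<eta>) = (\<integral>x. g x * \<phi> x \<partial>completion \<eta>)"
    by (rule integral_completion[symmetric]) measurable
  also have "\<dots> = (\<integral>x. \<phi> x * X x - \<phi> x * ?E x \<partial>completion \<eta>)"
  proof (rule integral_cong_AE)
    show "AE x in completion \<eta>. g x * \<phi> x = \<phi> x * X x - \<phi> x * ?E x"
      unfolding AE_completion_iff using X(3) by eventually_elim (simp add: right_diff_distrib mult.commute)
    show "(\<lambda>x. g x * \<phi> x) \<in> borel_measurable (completion \<eta>)"
      by (intro measurable_completion) measurable
  qed (use int E in auto)
  also have "\<dots> = 0"
    using int E by simp
  finally show ?thesis .
qed

text \<open>The difference between \<open>\<phi>\<close> and its conditional expectation is itself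
  centered. It is orthogonal to \<open>\<phi>\<close> by hypothesis and to the conditional
  expectation by \<open>centered_orthogonal\<close>, so its square integrates to zero, and the
  completion absorbs the null set.\<close>

lemma measurable_of_centered_orthogonal:
  assumes \<phi>: "\<phi> \<in> borel_measurable borel" "\<And>x. \<bar>\<phi> x\<bar> \<le> C"
    and orth: "\<And>g. centered \<eta> F g \<Longrightarrow> (\<integral>x. g x * \<phi> x \<partial>\<eta>) = 0"
  shows "\<phi> \<in> borel_measurable G"
proof -
  let ?E = "real_cond_exp (completion \<eta>) G \<phi>"
  have C: "0 \<le> C"
    using \<phi>(2)[of undefined] by linarith
  have \<phi>_meas [measurable]: "\<phi> \<in> borel_measurable \<eta>"
    using \<phi>(1) by simp
  have \<phi>c: "\<phi> \<in> borel_measurable (completion \<eta>)"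
    by (rule measurable_completion) measurable
  have bound: "AE x in \<eta>. \<bar>?E x\<bar> \<le> C"
    using \<phi>(2) by (intro real_cond_exp_bounded) auto
  have Ec: "?E \<in> borel_measurable (completion \<eta>)"
    by simp
  obtain \<psi> where \<psi>: "\<psi> \<in> borel_measurable \<eta>" "AE x in \<eta>. ?E x = \<psi> x"
    using completion_ex_borel_measurable_real[OF Ec] by auto
  \<comment> \<open>A centered function must be Borel and bounded at every point, so a Borel version
    of the conditional expectation is truncated at the almost sure bound \<open>C\<close>.\<close>
  define \<psi>' where "\<psi>' x = max (- C) (min C (\<psi> x))" for x
  have \<psi>'_E: "AE x in \<eta>. \<psi>' x = ?E x"
    using bound \<psi>(2) by eventually_elim (auto simp: \<psi>'_def abs_le_iff)
  have [measurable]: "\<psi>' \<in> borel_measurable borel"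
    using \<psi>(1) unfolding \<psi>'_def by measurable
  have \<psi>'_bound: "\<bar>\<psi>' x\<bar> \<le> C" for x
    using C by (auto simp: \<psi>'_def)
  have diff_bound: "\<bar>\<phi> x - \<psi>' x\<bar> \<le> C + C" for x
    using \<phi>(2)[of x] \<psi>'_bound[of x] by linarith
  have cent: "centered \<eta> F (\<lambda>x. \<phi> x - \<psi>' x)"
    unfolding centered_def
  proof (intro conjI bexI exI)
    show "bounded (range (\<lambda>x. \<phi> x - \<psi>' x))"
      using diff_bound by (intro boundedI[of _ "C + C"]) auto
    show "AE x in \<eta>. \<phi> x - \<psi>' x = \<phi> x - ?E x"
      using \<psi>'_E by eventually_elim simp
    show "AE x in \<eta>. \<bar>\<phi> x\<bar> \<le> C"
      using \<phi>(2) by simp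
  qed (use \<phi>(1) in auto)
  have E_meas: "?E \<in> borel_measurable G"
    by simp
  have \<psi>'_G: "\<psi>' \<in> borel_measurable G"
    using \<psi>'_E by (intro borel_measurable_completed_by_cong[OF _ E_meas]) (auto elim: eventually_mono)
  have int: "integrable \<eta> (\<lambda>x. (\<phi> x - \<psi>' x) * h x)"
    if [measurable]: "h \<in> borel_measurable borel" and "\<And>x. \<bar>h x\<bar> \<le> D" for h D
  proof (rule integrable_const_bound[of _ "(C + C) * D"])
    show "AE x in \<eta>. norm ((\<phi> x - \<psi>' x) * h x) \<le> (C + C) * D"
      using that(2) diff_bound C by (simp add: abs_mult mult_mono)
  qed measurable
  have "(\<integral>x. (\<phi> x - \<psi>' x) * \<phi> x \<partial>\<eta>) = 0"
    by (rule orth[OF cent])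
  moreover have "(\<integral>x. (\<phi> x - \<psi>' x) * \<psi>' x \<partial>\<eta>) = 0"
    by (rule centered_orthogonal[OF cent \<psi>'_G _ \<psi>'_bound]) measurable
  ultimately have "(\<integral>x. (\<phi> x - \<psi>' x) * \<phi> x - (\<phi> x - \<psi>' x) * \<psi>' x \<partial>\<eta>) = 0"
    using int[OF \<phi>] int[OF _ \<psi>'_bound] by (subst Bochner_Integration.integral_diff) auto
  then have "(\<integral>x. (\<phi> x - \<psi>' x)\<^sup>2 \<partial>\<eta>) = 0"
    by (simp add: power2_eq_square right_diff_distrib)
  moreover have "integrable \<eta> (\<lambda>x. (\<phi> x - \<psi>' x)\<^sup>2)"
    using Bochner_Integration.integrable_diff[OF int[OF \<phi>] int[OF _ \<psi>'_bound]]
    by (simp add: power2_eq_square right_diff_distrib)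
  ultimately have "AE x in \<eta>. (\<phi> x - \<psi>' x)\<^sup>2 = 0"
    using integral_nonneg_eq_0_iff_AE[of \<eta> "\<lambda>x. (\<phi> x - \<psi>' x)\<^sup>2"] by auto
  then have "AE x in \<eta>. \<psi>' x = \<phi> x"
    by eventually_elim simp
  then show ?thesis
    by (rule borel_measurable_completed_by_cong[OF space_UNIV \<psi>'_G])
qed

lemma centered_scale:
  assumes "centered \<eta> F g"
  shows "centered \<eta> F (\<lambda>x. a * g x)"
proof -
  obtain X K where g: "g \<in> borel_measurable borel" "bounded (range g)"
    and X: "X \<in> borel_measurable \<eta>" "AE x in \<eta>. \<bar>X x\<bar> \<le> K"
      "AE x in \<eta>. g x = X x - real_cond_exp (completion \<eta>) G X x"
    using assms by (auto simp: centered_def)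
  have "integrable (completion \<eta>) X"
    using X by (intro integrable_bounded measurable_completion)
  then have "AE x in completion \<eta>. real_cond_exp (completion \<eta>) G (\<lambda>x. a * X x) x = a * real_cond_exp (completion \<eta>) G X x"
    by simp
  then have *: "AE x in \<eta>. a * g x = a * X x - real_cond_exp (completion \<eta>) G (\<lambda>x. a * X x) x"
    unfolding AE_completion_iff using X(3) by eventually_elim (simp add: right_diff_distrib)
  have bd: "AE x in \<eta>. \<bar>a * X x\<bar> \<le> \<bar>a\<bar> * K"
    using X(2) by eventually_elim (simp add: abs_mult mult_left_mono)
  have "(\<lambda>x. a * g x) \<in> bounded_functions"
    using g(2) by (intro bounded_functions_scale) (simp add: bounded_functions_def)
  then show ?thesis
    unfolding centered_def using g X(1) * bd
    by (intro conjI bexI[of _ "\<lambda>x. a * X x"] exI[of _ "\<bar>a\<bar> * K"]) (auto simp: bounded_functions_def)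
qed

end

text \<open>In the completed trivial sigma-field every event or its complement is almost sure, so
  conditional expectations are constants. This is the case of the extra index
  \<open>None\<close>.\<close>

lemma centered_trivial:
  fixes \<eta> :: "'e::polish_space measure"
  assumes "prob_space \<eta>" and sets [measurable_cong]: "sets \<eta> = sets borel"
    and A: "A \<in> sets borel"
  shows "centered \<eta> (sigma UNIV {{}, UNIV}) (\<lambda>x. indicator A x - measure \<eta> A)"
proof -
  have trivial: "sets (sigma UNIV {{}, UNIV :: 'e set}) = {{}, UNIV}"
    by (simp add: sigma_algebra.sigma_sets_eq[OF sigma_algebra_trivial])
  interpret sub_borel \<eta> "sigma UNIV {{}, UNIV}"
    using assms by (simp add: sub_borel_def sub_borel_axioms_def trivial)
  have int: "integrable (completion \<eta>) (indicator A :: 'e \<Rightarrow> real)"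
    using A by (intro integrable_bounded[of _ 1] measurable_completion) (auto simp: sets)
  have dich: "(AE x in completion \<eta>. x \<in> B) \<or> (AE x in completion \<eta>. x \<notin> B)" if "B \<in> sets G" for B
  proof -
    have "B \<in> sigma_sets UNIV ({{}, UNIV} \<union> null_sets (completion \<eta>))"
      using that unfolding sets_completed_by trivial .
    then show ?thesis
    proof (induction B rule: sigma_sets.induct)
      case (Basic B)
      then show ?case
        by (auto intro: AE_not_in)
    next
      case (Union B)
      show ?case
      proof (cases "\<exists>i. AE x in completion \<eta>. x \<in> B i")
        case True
        then show ?thesis
          by (auto elim: eventually_mono)
      next
        case False
        then have "AE x in completion \<eta>. \<forall>i. x \<notin> B i"
          using Union.IH by (simp add: AE_all_countable)
        then show ?thesis
          by (auto elim: eventually_mono)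
      qed
    qed auto
  qed
  have "AE x in completion \<eta>. real_cond_exp (completion \<eta>) G (indicator A) x = measure \<eta> A"
  proof (rule completion.real_cond_exp_charact[OF _ int])
    fix B assume B: "B \<in> sets G"
    have Bc: "B \<in> sets (completion \<eta>)"
      using B completion.subalg by (auto simp: subalgebra_def)
    have mA: "measure (completion \<eta>) A = measure \<eta> A"
      using A by (simp add: sets)
    have Ac: "A \<in> sets (completion \<eta>)"
      using A by (simp add: sets)
    show "(\<integral>x\<in>B. indicator A x \<partial>completion \<eta>) = (\<integral>x\<in>B. measure \<eta> A \<partial>completion \<eta>)"
      using dich[OF B]
    proof
      assume ae: "AE x in completion \<eta>. x \<in> B"
      have "(\<integral>x\<in>B. indicator A x \<partial>completion \<eta>) = (\<integral>x. (indicator A x :: real) \<partial>completion \<eta>)"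
        unfolding set_lebesgue_integral_def using ae Ac Bc by (intro integral_cong_AE) auto
      moreover have "(\<integral>x\<in>B. measure \<eta> A \<partial>completion \<eta>) = (\<integral>x. measure \<eta> A \<partial>completion \<eta>)"
        unfolding set_lebesgue_integral_def
      proof (rule integral_cong_AE)
        show "AE x in completion \<eta>. indicator B x *\<^sub>R measure \<eta> A = measure \<eta> A"
          using ae by eventually_elim simp
      qed (use Bc in auto)
      ultimately show ?thesis
        using Ac mA completion.prob_space by simp
    next
      assume ae: "AE x in completion \<eta>. x \<notin> B"
      have "(\<integral>x\<in>B. f x \<partial>completion \<eta>) = 0" for f :: "'e \<Rightarrow> real"
        unfolding set_lebesgue_integral_def using ae by (intro integral_eq_zero_AE) auto
      then show ?thesis
        by simp
    qed
  qed auto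
  then have *: "AE x in \<eta>. indicator A x - measure \<eta> A = indicator A x - real_cond_exp (completion \<eta>) G (indicator A) x"
    unfolding AE_completion_iff by eventually_elim simp
  have "(\<lambda>x. indicator A x - measure \<eta> A) \<in> bounded_functions"
    by (intro bounded_functions_diff) simp_all
  then show ?thesis
    unfolding centered_def using * A
    by (intro conjI bexI[of _ "indicator A"] exI[of _ 1]) (auto simp: bounded_functions_def sets)
qed

lemma centered_measurable: "centered \<eta> F g \<Longrightarrow> g \<in> borel_measurable borel"
  and centered_bounded: "centered \<eta> F g \<Longrightarrow> g \<in> bounded_functions"
  by (auto simp: centered_def bounded_functions_def)

text \<open>Continuous functions converging to the indicator of an open set \<open>U\<close> from
  inside. The case \<open>U = UNIV\<close> is separate because the distance to the empty set is
  \<open>0\<close> by convention.\<close>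

definition inner_approx :: "'a::metric_space set \<Rightarrow> nat \<Rightarrow> 'a \<Rightarrow> real" where
  "inner_approx U n x = (if U = UNIV then 1 else min 1 (real n * infdist x (- U)))"

lemma inner_approx_bounds: "0 \<le> inner_approx U n x" "inner_approx U n x \<le> 1"
  by (auto simp: inner_approx_def infdist_nonneg)

lemma continuous_inner_approx: "continuous_on S (inner_approx U n)"
  unfolding inner_approx_def[abs_def] by (cases "U = UNIV") (auto intro!: continuous_intros)

lemma inner_approx_bcontfun: "inner_approx U n \<in> bcontfun"
  by (auto simp: bcontfun_def continuous_inner_approx inner_approx_bounds intro!: boundedI[of _ 1])

lemma infdist_compl_pos:
  assumes "open U" "U \<noteq> UNIV"
  shows "0 < infdist x (- U) \<longleftrightarrow> x \<in> U"
proof -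
  have "infdist x (- U) = 0 \<longleftrightarrow> x \<in> - U"
    using assms by (intro in_closed_iff_infdist_zero[symmetric]) auto
  then show ?thesis
    using infdist_nonneg[of x "- U"] by auto
qed

lemma inner_approx_tendsto:
  assumes "open U"
  shows "(\<lambda>n. inner_approx U n x) \<longlonglongrightarrow> indicator U x"
proof (cases "U = UNIV \<or> x \<notin> U")
  case True
  then have "inner_approx U n x = indicator U x" for n
    by (auto simp: inner_approx_def)
  then show ?thesis
    by simp
next
  case False
  then have pos: "0 < infdist x (- U)"
    using infdist_compl_pos[OF assms] by auto
  then obtain N where N: "1 < real N * infdist x (- U)"
    using reals_Archimedean3 by blast
  have "inner_approx U n x = indicator U x" if "n \<ge> N" for n
  proof -
    have "real N * infdist x (- U) \<le> real n * infdist x (- U)"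
      using that pos by (intro mult_right_mono) auto
    then show ?thesis
      using N False by (auto simp: inner_approx_def)
  qed
  then show ?thesis
    by (intro tendsto_eventually) (auto simp: eventually_sequentially)
qed

section \<open>Measures determined by open sets and continuous functions\<close>

lemma measure_eqI_bcontfun:
  fixes M N :: "'a::metric_space measure"
  assumes "prob_space M" "prob_space N" and sets: "sets M = sets borel" "sets N = sets borel"
    and eq: "\<And>g :: 'a \<Rightarrow> real. g \<in> bcontfun \<Longrightarrow> (\<integral>x. g x \<partial>M) = (\<integral>x. g x \<partial>N)"
  shows "M = N"
proof (rule measure_eqI_generator_eq[where \<Omega> = UNIV and E = "{U. open U}" and A = "\<lambda>_. UNIV"])
  interpret M: prob_space M by fact
  interpret N: prob_space N by fact
  fix U :: "'a set" assume "U \<in> {U. open U}"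
  then have U: "open U"
    by simp
  have lim: "(\<lambda>n. \<integral>x. inner_approx U n x \<partial>Q) \<longlonglongrightarrow> measure Q U"
    if "prob_space Q" "sets Q = sets borel" for Q :: "'a measure"
  proof -
    interpret Q: prob_space Q by fact
    note [measurable_cong] = that(2)
    have [measurable]: "inner_approx U n \<in> borel_measurable borel" for n
      by (intro borel_measurable_continuous_onI continuous_inner_approx)
    have [measurable]: "U \<in> sets borel"
      using U by simp
    have "(\<lambda>n. \<integral>x. inner_approx U n x \<partial>Q) \<longlonglongrightarrow> (\<integral>x. indicator U x \<partial>Q)"
      by (rule integral_dominated_convergence[where w = "\<lambda>_. 1"])
        (auto simp: inner_approx_bounds intro!: AE_I2 inner_approx_tendsto U)
    then show ?thesis
      using that(2) by simp
  qed
  have "measure M U = measure N U"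
    using lim[OF \<open>prob_space M\<close> sets(1)] lim[OF \<open>prob_space N\<close> sets(2)]
    by (auto simp: eq[OF inner_approx_bcontfun] intro: LIMSEQ_unique)
  then show "emeasure M U = emeasure N U"
    by (simp add: M.emeasure_eq_measure N.emeasure_eq_measure)
next
  interpret M: prob_space M by fact
  show "emeasure M UNIV \<noteq> \<infinity>"
    by simp
qed (auto simp: sets borel_def Int_stable_def)

text \<open>Dynkin's lemma for the intersection-stable family of open sets; disjointness in the last
  case is what allows measures to be summed.\<close>

lemma open_induct_disjoint [consumes 1, case_names base compl union]:
  assumes "B \<in> sets (borel :: 'a::topological_space measure)"
    and "\<And>U. open U \<Longrightarrow> P U"
    and compl: "\<And>A. A \<in> sets borel \<Longrightarrow> P A \<Longrightarrow> P (- A)"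
    and "\<And>A :: nat \<Rightarrow> 'a set. disjoint_family A \<Longrightarrow> range A \<subseteq> sets borel \<Longrightarrow> (\<And>i. P (A i)) \<Longrightarrow> P (\<Union>i. A i)"
  shows "P B"
proof -
  have borel: "sets (borel :: 'a measure) = sigma_sets UNIV {U. open U}"
    by (simp add: borel_def)
  have "Int_stable {U :: 'a set. open U}" "{U :: 'a set. open U} \<subseteq> Pow UNIV"
    by (auto simp: Int_stable_def)
  moreover have "B \<in> sigma_sets UNIV {U. open U}"
    using assms(1) by (simp add: borel)
  ultimately show ?thesis
  proof (induction rule: sigma_sets_induct_disjoint)
    case empty
    show ?case
      by (rule assms(2)) simp
  next
    case (compl A)
    then show ?case
      using assms(3)[of A] by (simp add: borel Compl_eq_Diff_UNIV)
  next
    case (union A)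
    then show ?case
      using assms(4)[of A] by (simp add: borel)
  qed (use assms(2) in simp)
qed

lemma (in prob_space) abs_integral_le_bound:
  fixes f :: "'a \<Rightarrow> real"
  assumes "integrable M f" "\<And>x. \<bar>f x\<bar> \<le> c"
  shows "\<bar>\<integral>x. f x \<partial>M\<bar> \<le> c"
proof -
  have "\<bar>\<integral>x. f x \<partial>M\<bar> \<le> (\<integral>x. \<bar>f x\<bar> \<partial>M)"
    by (rule integral_abs_bound)
  also have "\<dots> \<le> (\<integral>x. c \<partial>M)"
    using assms by (intro integral_mono) auto
  finally show ?thesis
    by (simp add: prob_space)
qed

text \<open>The kernel is defined through rectangles; uniform approximation in the first variable
  extends its property to bounded \<open>g\<close>.\<close>

lemma associated_kernel_integral:
  fixes \<eta> :: "'e::polish_space measure" and \<gamma> :: "('e \<times> 's::polish_space) measure"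
  assumes K: "associated_kernel \<eta> \<gamma> \<Theta>" and \<eta>: "\<eta> \<in> space (prob_algebra borel)"
    and \<gamma>: "\<gamma> \<in> space (prob_algebra borel)"
    and g: "g \<in> borel_measurable borel" "g \<in> bounded_functions" and B: "B \<in> sets borel"
  shows "(\<integral>p. g (fst p) * indicator B (snd p) \<partial>\<gamma>) = (\<integral>x. g x * measure (\<Theta> x) B \<partial>\<eta>)"
proof -
  have \<eta>': "prob_space \<eta>" "sets \<eta> = sets borel" and \<gamma>': "prob_space \<gamma>" "sets \<gamma> = sets borel"
    using \<eta> \<gamma> by (auto simp: space_prob_algebra)
  interpret E: prob_space \<eta> by (rule \<eta>')
  interpret G: prob_space \<gamma> by (rule \<gamma>')
  note [measurable_cong] = \<eta>'(2) \<gamma>'(2)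
  note [measurable] = B
  have [measurable]: "(\<lambda>x. measure (\<Theta> x) B) \<in> borel_measurable borel"
    using K B by (auto simp: associated_kernel_def)
  have prob: "prob_space (\<Theta> x)" for x
    using K by (auto simp: associated_kernel_def space_prob_algebra)
  have \<Theta>: "\<bar>measure (\<Theta> x) B\<bar> \<le> 1" for x
    using prob_space.prob_le_1[OF prob, of x B] by simp
  have [measurable]: "fst \<in> measurable borel (borel :: 'e measure)" "snd \<in> measurable borel (borel :: 's measure)"
    by (auto intro!: borel_measurable_continuous_onI continuous_intros)
  let ?V = "borel_measurable (borel :: 'e measure) \<inter> bounded_functions"
  have int: "integrable \<gamma> (\<lambda>p. f (fst p) * indicator B (snd p))" "integrable \<eta> (\<lambda>x. f x * measure (\<Theta> x) B)"
    and bound: "\<And>c. (\<And>x. \<bar>f x\<bar> \<le> c) \<Longrightarrow> \<bar>\<integral>p. f (fst p) * indicator B (snd p) \<partial>\<gamma>\<bar> \<le> c"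
      "\<And>c. (\<And>x. \<bar>f x\<bar> \<le> c) \<Longrightarrow> \<bar>\<integral>x. f x * measure (\<Theta> x) B \<partial>\<eta>\<bar> \<le> c"
    if f: "f \<in> ?V" for f
  proof -
    have [measurable]: "f \<in> borel_measurable borel"
      using f by simp
    have le: "\<bar>f (fst p) * indicator B (snd p)\<bar> \<le> c" "\<bar>f x * measure (\<Theta> x) B\<bar> \<le> c"
      if "\<And>x. \<bar>f x\<bar> \<le> c" for c p x
    proof -
      show "\<bar>f (fst p) * indicator B (snd p)\<bar> \<le> c"
        using that[of "fst p"] abs_ge_zero[of "f (fst p)"] by (auto split: split_indicator)
      have "\<bar>f x\<bar> * \<bar>measure (\<Theta> x) B\<bar> \<le> c * 1"
        using that[of x] abs_ge_zero[of "f x"] by (intro mult_mono \<Theta>) linarith+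
      then show "\<bar>f x * measure (\<Theta> x) B\<bar> \<le> c"
        by (simp add: abs_mult)
    qed
    obtain c where c: "\<And>x. \<bar>f x\<bar> \<le> c"
      using f by (auto simp: bounded_functions_iff)
    show i: "integrable \<gamma> (\<lambda>p. f (fst p) * indicator B (snd p))" "integrable \<eta> (\<lambda>x. f x * measure (\<Theta> x) B)"
      using le[OF c] by (auto intro!: G.integrable_const_bound[of _ c] E.integrable_const_bound[of _ c])
    fix c assume "\<And>x. \<bar>f x\<bar> \<le> c"
    note c = le[OF this]
    show "\<bar>\<integral>p. f (fst p) * indicator B (snd p) \<partial>\<gamma>\<bar> \<le> c"
      using i(1) c(1) by (intro G.abs_integral_le_bound)
    show "\<bar>\<integral>x. f x * measure (\<Theta> x) B \<partial>\<eta>\<bar> \<le> c"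
      using i(2) c(2) by (intro E.abs_integral_le_bound)
  qed
  have "(\<integral>p. g (fst p) * indicator B (snd p) \<partial>\<gamma>) - (\<integral>x. g x * measure (\<Theta> x) B \<partial>\<eta>) = 0"
  \<comment> \<open>The constant \<open>2\<close> counts two integrals, each bounded by the
    supremum.\<close>
  proof (rule bounded_measurable_functional_zero[where M = borel and K = 2
        and \<Phi> = "\<lambda>g. (\<integral>p. g (fst p) * indicator B (snd p) \<partial>\<gamma>) - (\<integral>x. g x * measure (\<Theta> x) B \<partial>\<eta>)"])
    fix f h :: "'e \<Rightarrow> real" and a
    assume f: "f \<in> ?V"
    show "(\<integral>p. a * f (fst p) * indicator B (snd p) \<partial>\<gamma>) - (\<integral>x. a * f x * measure (\<Theta> x) B \<partial>\<eta>) =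
      a * ((\<integral>p. f (fst p) * indicator B (snd p) \<partial>\<gamma>) - (\<integral>x. f x * measure (\<Theta> x) B \<partial>\<eta>))"
      by (simp add: mult.assoc right_diff_distrib)
    assume h: "h \<in> ?V"
    show "(\<integral>p. (f (fst p) + h (fst p)) * indicator B (snd p) \<partial>\<gamma>) - (\<integral>x. (f x + h x) * measure (\<Theta> x) B \<partial>\<eta>) =
      (\<integral>p. f (fst p) * indicator B (snd p) \<partial>\<gamma>) - (\<integral>x. f x * measure (\<Theta> x) B \<partial>\<eta>) +
      ((\<integral>p. h (fst p) * indicator B (snd p) \<partial>\<gamma>) - (\<integral>x. h x * measure (\<Theta> x) B \<partial>\<eta>))"
      using int[OF f] int[OF h] by (simp add: distrib_right)
  next
    fix f :: "'e \<Rightarrow> real" and c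
    assume f: "f \<in> ?V" "\<And>x. \<bar>f x\<bar> \<le> c"
    show "\<bar>(\<integral>p. f (fst p) * indicator B (snd p) \<partial>\<gamma>) - (\<integral>x. f x * measure (\<Theta> x) B \<partial>\<eta>)\<bar> \<le> 2 * c"
      using bound(1)[OF f] bound(2)[OF f] by linarith
  next
    fix A :: "'e set" assume A: "A \<in> sets borel"
    then have "A \<times> B \<in> sets borel"
      using B by (subst borel_prod[symmetric]) simp
    moreover have "(\<lambda>p. indicator A (fst p) * indicator B (snd p) :: real) = indicator (A \<times> B)"
      by (auto simp: fun_eq_iff split: split_indicator)
    moreover have "measure \<gamma> (A \<times> B) = (LINT x:A|\<eta>. measure (\<Theta> x) B)"
      using K A B by (auto simp: associated_kernel_def)
    ultimately show "(\<integral>p. indicator A (fst p) * indicator B (snd p) \<partial>\<gamma>) - (\<integral>x. indicator A x * measure (\<Theta> x) B \<partial>\<eta>) = 0"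
      using \<gamma>'(2) by (simp add: set_lebesgue_integral_def)
  qed (use g in auto)
  then show ?thesis
    by simp
qed

section \<open>Test functions and weak duality\<close>

text \<open>Negative reals become \<open>0\<close> in \<open>ennreal\<close>, which does no harm
  below a non-negative cost. The dual constraints can thus be handled in \<open>ennreal\<close>,
  where infinite costs are ordinary values.\<close>

lemma ereal_le_enn2ereal_iff: "ereal x \<le> enn2ereal c \<longleftrightarrow> ennreal x \<le> c"
proof (cases "0 \<le> x")
  case True
  then show ?thesis
    by (simp add: less_eq_ennreal.rep_eq)
next
  case False
  then show ?thesis
    by (simp add: ennreal_neg order_trans[OF _ enn2ereal_nonneg])
qed

lemma (in prob_space) ennreal_integral_le:
  fixes f :: "'a \<Rightarrow> real"
  assumes "integrable M f"
  shows "ennreal (\<integral>x. f x \<partial>M) \<le> (\<integral>\<^sup>+x. ennreal (f x) \<partial>M)"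
proof -
  have int: "integrable M (\<lambda>x. max 0 (f x))"
    using assms by simp
  have "(\<integral>x. f x \<partial>M) \<le> (\<integral>x. max 0 (f x) \<partial>M)"
    by (intro integral_mono assms int) auto
  then have "ennreal (\<integral>x. f x \<partial>M) \<le> ennreal (\<integral>x. max 0 (f x) \<partial>M)"
    by (rule ennreal_leI)
  also have "\<dots> = (\<integral>\<^sup>+x. ennreal (max 0 (f x)) \<partial>M)"
    using int by (intro nn_integral_eq_integral[symmetric]) auto
  also have "\<dots> = (\<integral>\<^sup>+x. ennreal (f x) \<partial>M)"
    by (intro nn_integral_cong) (auto simp: max_def ennreal_neg)
  finally show ?thesis .
qed

locale causal_setting =
  fixes BE :: "'i::linorder \<Rightarrow> 'e::polish_space measure"
    and BS :: "'i \<Rightarrow> 's::polish_space measure"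
    and \<eta> :: "'e measure"
  assumes BE: "borel_filtration BE" and BS: "borel_filtration BS"
    and \<eta>: "\<eta> \<in> space (prob_algebra borel)"
    and regular: "regular_filtration BS"
begin

lemma prob_eta: "prob_space \<eta>" and sets_eta [simp, measurable_cong]: "sets \<eta> = sets borel"
  using \<eta> by (auto simp: space_prob_algebra)

lemma adjoin_BE: "sets (adjoin_trivial BE t) \<subseteq> sets borel"
proof (cases t)
  case None
  then show ?thesis
    using sigma_algebra.sigma_sets_eq[OF sigma_algebra_trivial, of "UNIV :: 'e set"] by (simp add: adjoin_trivial_def)
next
  case (Some s)
  then show ?thesis
    using BE by (simp add: adjoin_trivial_def borel_filtration_def subalgebra_def)
qed

lemma BS_borel: "A \<in> sets (BS t) \<Longrightarrow> A \<in> sets borel"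
  using BS by (auto simp: borel_filtration_def subalgebra_def)

lemma adjoin_BS_cases:
  assumes "A \<in> sets (adjoin_trivial BS t)"
  obtains "A = {}" | "A = UNIV" | s where "t = Some s" "A \<in> sets (BS s)"
  using assms sigma_algebra.sigma_sets_eq[OF sigma_algebra_trivial, of "UNIV :: 's set"]
  by (cases t) (auto simp: adjoin_trivial_def)

lemma sub_borel_BE: "sub_borel \<eta> (adjoin_trivial BE t)"
  using prob_eta adjoin_BE by (simp add: sub_borel_def sub_borel_axioms_def)

definition projection :: "'i \<Rightarrow> 's \<Rightarrow> 's" where
  "projection = (SOME \<rho>. (\<forall>t. continuous_on UNIV (\<rho> t)) \<and> (\<forall>t. sets (BS t) = {\<rho> t -` B | B. B \<in> sets borel}))"

lemma continuous_projection: "continuous_on UNIV (projection t)"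
  and sets_BS: "sets (BS t) = {projection t -` B | B. B \<in> sets borel}"
proof -
  let ?P = "\<lambda>\<rho> :: 'i \<Rightarrow> 's \<Rightarrow> 's. (\<forall>t. continuous_on UNIV (\<rho> t)) \<and> (\<forall>t. sets (BS t) = {\<rho> t -` B | B. B \<in> sets borel})"
  obtain \<rho> where "?P \<rho>"
    using regular unfolding regular_filtration_def by blast
  then have "?P projection"
    unfolding projection_def by (rule someI[of ?P])
  then show "continuous_on UNIV (projection t)" "sets (BS t) = {projection t -` B | B. B \<in> sets borel}"
    by blast+
qed

section \<open>The vector space of causal test functions\<close>

abbreviation "\<H> \<equiv> causal_test_functions BE BS \<eta>"

lemma test_function_iff:
  "h \<in> \<H> \<longleftrightarrow> h \<in> borel_measurable borel \<and> (\<exists>(N::nat) g A t.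
     (\<forall>x y. h (x, y) = (\<Sum>i\<in>{1..N}. g i x * indicator (A i) y)) \<and>
     (\<forall>i\<in>{1..N}. A i \<in> sets (adjoin_trivial BS (t i)) \<and> centered \<eta> (adjoin_trivial BE (t i)) (g i)))"
  by (simp add: causal_test_functions_def centered_def conj_assoc)

lemma test_function_measurable: "h \<in> \<H> \<Longrightarrow> h \<in> borel_measurable borel"
  by (simp add: test_function_iff)

lemma test_functionE:
  assumes "h \<in> \<H>"
  obtains N :: nat and g A t where
    "h = (\<lambda>p. \<Sum>i\<in>{1..N}. g i (fst p) * indicator (A i) (snd p))"
    "\<And>i. i \<in> {1..N} \<Longrightarrow> A i \<in> sets (adjoin_trivial BS (t i))"
    "\<And>i. i \<in> {1..N} \<Longrightarrow> centered \<eta> (adjoin_trivial BE (t i)) (g i)"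
proof -
  obtain N :: nat and g A t where *: "\<And>x y. h (x, y) = (\<Sum>i\<in>{1..N}. g i x * indicator (A i) y)"
    "\<And>i. i \<in> {1..N} \<Longrightarrow> A i \<in> sets (adjoin_trivial BS (t i))"
    "\<And>i. i \<in> {1..N} \<Longrightarrow> centered \<eta> (adjoin_trivial BE (t i)) (g i)"
    using assms unfolding test_function_iff by blast
  have "h = (\<lambda>p. \<Sum>i\<in>{1..N}. g i (fst p) * indicator (A i) (snd p))"
    by (intro ext) (simp only: *(1)[symmetric] prod.collapse)
  then show ?thesis
    using *(2,3) by (rule that)
qed

lemma test_function_bounded:
  assumes "h \<in> \<H>"
  shows "h \<in> bounded_functions"
  using assms
proof (rule test_functionE)
  fix N :: nat and g A t
  assume h: "h = (\<lambda>p. \<Sum>i\<in>{1..N}. g i (fst p) * indicator (A i) (snd p))"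
    and "\<And>i. i \<in> {1..N} \<Longrightarrow> centered \<eta> (adjoin_trivial BE (t i)) (g i)"
  then show ?thesis
    unfolding h by (intro bounded_functions_sum bounded_functions_product) (auto intro: centered_bounded)
qed

lemma test_function_scale:
  assumes h: "h \<in> \<H>"
  shows "(\<lambda>p. a * h p) \<in> \<H>"
  using h
proof (rule test_functionE)
  fix N :: nat and g A t
  assume *: "h = (\<lambda>p. \<Sum>i\<in>{1..N}. g i (fst p) * indicator (A i) (snd p))"
    "\<And>i. i \<in> {1..N} \<Longrightarrow> A i \<in> sets (adjoin_trivial BS (t i))"
    "\<And>i. i \<in> {1..N} \<Longrightarrow> centered \<eta> (adjoin_trivial BE (t i)) (g i)"
  show ?thesis
    unfolding test_function_iff
  proof (intro conjI exI allI ballI)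
    show "(\<lambda>p. a * h p) \<in> borel_measurable borel"
      using test_function_measurable[OF h] by simp
    show "a * h (x, y) = (\<Sum>i\<in>{1..N}. (a * g i x) * indicator (A i) y)" for x y
      by (simp only: *(1) sum_distrib_left mult.assoc fst_conv snd_conv)
    show "centered \<eta> (adjoin_trivial BE (t i)) (\<lambda>x. a * g i x)" if "i \<in> {1..N}" for i
      by (rule sub_borel.centered_scale[OF sub_borel_BE *(3)[OF that]])
  qed (use *(2) in auto)
qed

lemma test_function_add:
  assumes h: "h \<in> \<H>" and k: "k \<in> \<H>"
  shows "(\<lambda>p. h p + k p) \<in> \<H>"
  using h
proof (rule test_functionE)
  fix N :: nat and g A t
  assume *: "h = (\<lambda>p. \<Sum>i\<in>{1..N}. g i (fst p) * indicator (A i) (snd p))"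
    "\<And>i. i \<in> {1..N} \<Longrightarrow> A i \<in> sets (adjoin_trivial BS (t i))"
    "\<And>i. i \<in> {1..N} \<Longrightarrow> centered \<eta> (adjoin_trivial BE (t i)) (g i)"
  show ?thesis
    using k
  proof (rule test_functionE)
    fix N' :: nat and g' A' t'
    assume **: "k = (\<lambda>p. \<Sum>i\<in>{1..N'}. g' i (fst p) * indicator (A' i) (snd p))"
      "\<And>i. i \<in> {1..N'} \<Longrightarrow> A' i \<in> sets (adjoin_trivial BS (t' i))"
      "\<And>i. i \<in> {1..N'} \<Longrightarrow> centered \<eta> (adjoin_trivial BE (t' i)) (g' i)"
    show ?thesis
      unfolding test_function_iff
    proof (intro conjI exI allI ballI)
      show "(\<lambda>p. h p + k p) \<in> borel_measurable borel"
        using test_function_measurable[OF h] test_function_measurable[OF k] by simp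
      fix x y
      \<comment> \<open>The two sums are concatenated: indices above \<open>N\<close> are lowered by
        \<open>N\<close>, and as counting starts at \<open>1\<close> they run through
        \<open>{1..N'}\<close>.\<close>
      have "(\<Sum>i\<in>{1..N + N'}. (if i \<le> N then g i else g' (i - N)) x *
            indicator (if i \<le> N then A i else A' (i - N)) y) =
          (\<Sum>i\<in>{1..N}. g i x * indicator (A i) y) +
          (\<Sum>i\<in>{N + 1..N + N'}. g' (i - N) x * indicator (A' (i - N)) y)"
        by (subst sum.ub_add_nat) (auto intro!: sum.cong)
      also have "(\<Sum>i\<in>{N + 1..N + N'}. g' (i - N) x * indicator (A' (i - N)) y) =
          (\<Sum>i\<in>{1..N'}. g' i x * indicator (A' i) y)"
        by (rule sum.reindex_bij_witness[of _ "\<lambda>i. i + N" "\<lambda>i. i - N"]) auto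
      finally show "h (x, y) + k (x, y) = (\<Sum>i\<in>{1..N + N'}. (if i \<le> N then g i else g' (i - N)) x *
            indicator (if i \<le> N then A i else A' (i - N)) y)"
        by (simp add: *(1) **(1))
    next
      fix i assume i: "i \<in> {1..N + N'}"
      show "(if i \<le> N then A i else A' (i - N)) \<in> sets (adjoin_trivial BS (if i \<le> N then t i else t' (i - N)))"
        "centered \<eta> (adjoin_trivial BE (if i \<le> N then t i else t' (i - N))) (if i \<le> N then g i else g' (i - N))"
        using i *(2,3)[of i] **(2,3)[of "i - N"] by (cases "i \<le> N"; force)+
    qed
  qed
qed

lemma test_function_single:
  assumes g: "centered \<eta> (adjoin_trivial BE t) g" and A: "A \<in> sets (adjoin_trivial BS t)"
  shows "(\<lambda>p. g (fst p) * indicator A (snd p)) \<in> \<H>"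
  unfolding test_function_iff
proof (intro conjI exI allI ballI)
  have [measurable]: "g \<in> borel_measurable borel" "A \<in> sets borel"
    using centered_measurable[OF g] A by (auto elim: adjoin_BS_cases intro: BS_borel)
  show "(\<lambda>p. g (fst p) * indicator A (snd p)) \<in> borel_measurable borel"
    unfolding borel_prod[symmetric] by measurable
  show "g (fst (x, y)) * indicator A (snd (x, y)) = (\<Sum>i\<in>{1..1::nat}. g x * indicator A y)" for x y
    by simp
qed (use g A in auto)

text \<open>The index \<open>None\<close> with the full set admits centered functions of
  \<open>x\<close> alone. A normalised functional vanishing on test functions therefore has first
  marginal \<open>\<eta>\<close>.\<close>

lemma test_function_indicator:
  assumes "A \<in> sets borel"
  shows "(\<lambda>p. indicator A (fst p) - measure \<eta> A) \<in> \<H>"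
proof -
  have "(\<lambda>p :: 'e \<times> 's. (indicator A (fst p) - measure \<eta> A) * indicator UNIV (snd p)) \<in> \<H>"
  proof (rule test_function_single[where t = None])
    show "centered \<eta> (adjoin_trivial BE None) (\<lambda>x. indicator A x - measure \<eta> A)"
      using centered_trivial[OF prob_eta sets_eta assms] by (simp add: adjoin_trivial_def)
  qed (simp add: adjoin_trivial_def sigma_sets_top)
  then show ?thesis
    by simp
qed

lemma test_function_zero: "(\<lambda>p. 0) \<in> \<H>"
  using test_function_scale[OF test_function_indicator[of "{}"], of 0] by simp

text \<open>Continuity sets suffice in the definition of causality: \<open>\<rho>\<^sub>t\<close> pulls superlevel sets of a
  continuous function back to sets in \<open>BS t\<close> that are continuity sets for all but countably many
  levels.\<close>

lemma kernel_adapted: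
  fixes \<Theta> :: "'e \<Rightarrow> 's measure"
  assumes \<nu>: "\<nu> \<in> space (prob_algebra borel)"
    and \<Theta>: "\<And>x. \<Theta> x \<in> space (prob_algebra borel)"
    and causal: "sets (kernel_sigma_field BS \<eta> \<nu> \<Theta> t) \<subseteq> sets (completed_by \<eta> (BE t))"
    and C: "C \<in> sets (BS t)"
  shows "(\<lambda>x. measure (\<Theta> x) C) \<in> borel_measurable (completed_by \<eta> (BE t))"
proof -
  let ?G = "completed_by \<eta> (BE t)"
  have \<nu>': "prob_space \<nu>" "sets \<nu> = sets borel" and \<Theta>': "prob_space (\<Theta> x)" "sets (\<Theta> x) = sets borel" for x
    using \<nu> \<Theta> by (auto simp: space_prob_algebra)
  interpret N: prob_space \<nu> by (rule \<nu>')
  interpret T: prob_space "\<Theta> x" for x by (rule \<Theta>')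
  have spaces [simp]: "space \<nu> = UNIV" "space (\<Theta> x) = UNIV" for x
    using sets_eq_imp_space_eq[OF \<nu>'(2)] sets_eq_imp_space_eq[OF \<Theta>'(2)] by auto
  define \<rho> where "\<rho> = projection t"
  have \<rho>: "continuous_on UNIV \<rho>" and BS_t: "sets (BS t) = {\<rho> -` B | B. B \<in> sets borel}"
    unfolding \<rho>_def by (rule continuous_projection, rule sets_BS)
  have [measurable]: "\<rho> \<in> measurable borel borel"
    using \<rho> by (rule borel_measurable_continuous_onI)
  have pre: "\<rho> -` B \<in> sets borel" if "B \<in> sets borel" for B
    using measurable_sets[OF \<open>\<rho> \<in> measurable borel borel\<close> that] by simp
  have continuity: "(\<lambda>x. measure (\<Theta> x) C) \<in> borel_measurable ?G"
    if "C \<in> sets (BS t)" "measure \<nu> (frontier C) = 0" for C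
  proof (rule measurableI)
    fix B :: "real set" assume "B \<in> sets borel"
    then have "(\<lambda>x. measure (\<Theta> x) C) -` B \<in> sets (kernel_sigma_field BS \<eta> \<nu> \<Theta> t)"
      using that by (auto simp: kernel_sigma_field_def sets_completed_by intro!: sigma_sets.Basic)
    then show "(\<lambda>x. measure (\<Theta> x) C) -` B \<inter> space ?G \<in> sets ?G"
      using causal by auto
  qed simp
  obtain B where B: "B \<in> sets borel" "C = \<rho> -` B"
    using C by (auto simp: BS_t)
  have "(\<lambda>x. measure (\<Theta> x) (\<rho> -` B)) \<in> borel_measurable ?G"
    using B(1)
  proof (induction B rule: open_induct_disjoint)
    case (base U)
    show ?case
    proof (cases "U = UNIV")
      case True
      then show ?thesis
        using T.prob_space by simp
    next
      case False
      define f where "f y = infdist (\<rho> y) (- U)" for y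
      have f_cont: "continuous_on UNIV f"
        unfolding f_def using \<rho> by (intro continuous_intros)
      then have [measurable]: "f \<in> borel_measurable borel"
        by (rule borel_measurable_continuous_onI)
      have f_pos: "0 < f y \<longleftrightarrow> \<rho> y \<in> U" for y
        unfolding f_def by (rule infdist_compl_pos[OF base False])
      interpret D: prob_space "distr \<nu> borel f"
        by (rule N.prob_space_distr) (simp add: measurable_cong_sets[OF \<nu>'(2) refl])
      \<comment> \<open>The law of \<open>f\<close> has countably many atoms, so each of these open
        intervals contains a level that is not an atom. The intervals are disjoint and move towards
        zero, so the levels decrease to zero and the superlevel sets exhaust the positivity set of
        \<open>f\<close>.\<close>
      have "\<exists>r. r \<in> {1 / real (n + 2)<..<1 / real (n + 1)} \<and> measure (distr \<nu> borel f) {r} = 0" for n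
      proof -
        have "open {1 / real (n + 2)<..<1 / real (n + 1)}"
          by simp
        moreover have "{1 / real (n + 2)<..<1 / real (n + 1)} \<noteq> {}"
          by (simp add: field_simps)
        ultimately show ?thesis
          using open_minus_countable[OF D.countable_support] by blast
      qed
      then obtain r where r: "\<And>n. r n \<in> {1 / real (n + 2)<..<1 / real (n + 1)}"
        and r_null: "\<And>n. measure (distr \<nu> borel f) {r n} = 0"
        by metis
      have r_pos: "0 < r n" for n
        using r[of n] by (auto intro: less_trans[rotated])
      define A where "A n = {y. r n < f y}" for n
      have A_BS: "A n \<in> sets (BS t)" for n
      proof -
        have "A n = \<rho> -` {z. r n < infdist z (- U)}"
          by (auto simp: A_def f_def)
        moreover have "{z. r n < infdist z (- U)} \<in> sets borel"
          by (intro borel_open open_Collect_less continuous_intros)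
        ultimately show ?thesis
          unfolding BS_t by blast
      qed
      have frontier: "measure \<nu> (frontier (A n)) = 0" for n
      proof -
        have "open (A n)"
          unfolding A_def using f_cont by (intro open_Collect_less continuous_on_const)
        moreover have "closed {y. r n \<le> f y}"
          using f_cont by (intro closed_Collect_le continuous_on_const)
        then have "closure (A n) \<subseteq> {y. r n \<le> f y}"
          by (intro closure_minimal) (auto simp: A_def)
        \<comment> \<open>A frontier point is in the closure but not in the open set
          \<open>A n\<close>, so \<open>f\<close> equals \<open>r n\<close> there.\<close>
        ultimately have "frontier (A n) \<subseteq> f -` {r n}"
          by (auto simp: frontier_def interior_open A_def)
        then have "measure \<nu> (frontier (A n)) \<le> measure \<nu> (f -` {r n})"
          using measurable_sets[OF \<open>f \<in> borel_measurable borel\<close>, of "{r n}"]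
          by (intro N.finite_measure_mono) (auto simp: \<nu>'(2))
        also have "\<dots> = measure (distr \<nu> borel f) {r n}"
          by (subst measure_distr) (auto simp: measurable_cong_sets[OF \<nu>'(2) refl])
        finally show ?thesis
          using r_null[of n] measure_nonneg[of \<nu> "frontier (A n)"] by simp
      qed
      have "incseq A"
      proof (rule incseq_SucI)
        fix n
        have "r (Suc n) < r n"
          using r[of "Suc n"] r[of n] by (auto intro: less_trans)
        then show "A n \<subseteq> A (Suc n)"
          by (auto simp: A_def)
      qed
      moreover have "(\<Union>n. A n) = \<rho> -` U"
      proof (intro equalityI subsetI)
        fix y assume "y \<in> (\<Union>n. A n)"
        then obtain n where "r n < f y"
          by (auto simp: A_def)
        then show "y \<in> \<rho> -` U"
          using r_pos[of n] f_pos[of y] by simp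
      next
        fix y assume "y \<in> \<rho> -` U"
        then have "0 < f y"
          by (simp add: f_pos)
        then obtain n where "1 / real (Suc n) < f y"
          using nat_approx_posE by blast
        then have "r n < f y"
          using r[of n] by auto
        then show "y \<in> (\<Union>n. A n)"
          by (auto simp: A_def)
      qed
      ultimately have "(\<lambda>n. measure (\<Theta> x) (A n)) \<longlonglongrightarrow> measure (\<Theta> x) (\<rho> -` U)" for x
        using T.finite_Lim_measure_incseq[of A x] BS_borel[OF A_BS] by (auto simp: \<Theta>')
      then show ?thesis
        by (rule borel_measurable_LIMSEQ_real) (rule continuity[OF A_BS frontier])
    qed
  next
    case (compl B)
    have "measure (\<Theta> x) (\<rho> -` (- B)) = 1 - measure (\<Theta> x) (\<rho> -` B)" for x
      using T.prob_compl[of "\<rho> -` B" x] pre[OF compl(1)] by (simp add: \<Theta>' vimage_Diff Compl_eq_Diff_UNIV)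
    then show ?case
      using compl(2) by simp
  next
    case (union B)
    have "(\<lambda>x. \<Sum>n. measure (\<Theta> x) (\<rho> -` B n)) \<in> borel_measurable ?G"
      using union(3) by (rule borel_measurable_suminf)
    moreover have "measure (\<Theta> x) (\<rho> -` (\<Union>n. B n)) = (\<Sum>n. measure (\<Theta> x) (\<rho> -` B n))" for x
    proof -
      have "(\<lambda>n. measure (\<Theta> x) (\<rho> -` B n)) sums measure (\<Theta> x) (\<Union>n. \<rho> -` B n)"
        using union(1,2) pre by (intro T.finite_measure_UNION) (auto simp: \<Theta>' disjoint_family_on_def)
      then show ?thesis
        by (simp add: sums_iff vimage_UN)
    qed
    ultimately show ?case
      by simp
  qed
  then show ?thesis
    by (simp add: B(2))
qed

text \<open>Integrating out the second variable replaces the indicator of \<open>A\<close> by the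
  kernel's mass of \<open>A\<close>. Causality makes this mass measurable for the completed
  sigma-field, and centered functions are orthogonal to it.\<close>

lemma causal_plan_test_function:
  assumes \<gamma>: "\<gamma> \<in> causal_plans_from BE BS \<eta>" and h: "h \<in> \<H>"
  shows "(\<integral>p. h p \<partial>\<gamma>) = 0"
proof -
  obtain \<nu> \<Theta> where \<nu>: "\<nu> \<in> space (prob_algebra borel)" and plan: "\<gamma> \<in> transference_plans \<eta> \<nu>"
    and K: "associated_kernel \<eta> \<gamma> \<Theta>"
    and causal: "\<And>t. sets (kernel_sigma_field BS \<eta> \<nu> \<Theta> t) \<subseteq> sets (completed_by \<eta> (BE t))"
    using \<gamma> by (auto simp: causal_plans_from_def causal_plans_def)
  have \<gamma>': "\<gamma> \<in> space (prob_algebra borel)"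
    using plan by (simp add: transference_plans_def)
  then interpret G: prob_space \<gamma>
    by (simp add: space_prob_algebra)
  have sets_\<gamma> [measurable_cong]: "sets \<gamma> = sets borel"
    using \<gamma>' by (simp add: space_prob_algebra)
  have \<Theta>: "\<Theta> x \<in> space (prob_algebra borel)" for x
    using K by (simp add: associated_kernel_def)
  have single: "(\<integral>p. g (fst p) * indicator A (snd p) \<partial>\<gamma>) = 0"
    if A: "A \<in> sets (adjoin_trivial BS t)" and g: "centered \<eta> (adjoin_trivial BE t) g" for g A t
  proof -
    interpret sub_borel \<eta> "adjoin_trivial BE t"
      by (rule sub_borel_BE)
    have A_borel: "A \<in> sets borel"
      using A by (auto elim: adjoin_BS_cases intro: BS_borel)
    have "(\<lambda>x. measure (\<Theta> x) A) \<in> borel_measurable G"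
      using A
    proof (cases rule: adjoin_BS_cases)
      case 2
      have "measure (\<Theta> x) UNIV = 1" for x
        using \<Theta>[of x] prob_space.prob_space[of "\<Theta> x"] sets_eq_imp_space_eq[of "\<Theta> x" borel]
        by (auto simp: space_prob_algebra)
      then show ?thesis
        by (simp add: 2)
    next
      case (3 s)
      then show ?thesis
        using kernel_adapted[OF \<nu> \<Theta> causal] by (simp add: adjoin_trivial_def)
    qed simp
    moreover have "(\<lambda>x. measure (\<Theta> x) A) \<in> borel_measurable borel"
      using K A_borel by (simp add: associated_kernel_def)
    moreover have "\<bar>measure (\<Theta> x) A\<bar> \<le> 1" for x
      using \<Theta>[of x] prob_space.prob_le_1[of "\<Theta> x" A] by (simp add: space_prob_algebra)
    ultimately have "(\<integral>x. g x * measure (\<Theta> x) A \<partial>\<eta>) = 0"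
      by (rule centered_orthogonal[OF g])
    then show ?thesis
      using associated_kernel_integral[OF K \<eta> \<gamma>' centered_measurable[OF g] centered_bounded[OF g] A_borel] by simp
  qed
  show ?thesis
    using h
  proof (rule test_functionE)
    fix N :: nat and g A t
    assume *: "h = (\<lambda>p. \<Sum>i\<in>{1..N}. g i (fst p) * indicator (A i) (snd p))"
      "\<And>i. i \<in> {1..N} \<Longrightarrow> A i \<in> sets (adjoin_trivial BS (t i))"
      "\<And>i. i \<in> {1..N} \<Longrightarrow> centered \<eta> (adjoin_trivial BE (t i)) (g i)"
    have int: "integrable \<gamma> (\<lambda>p. g i (fst p) * indicator (A i) (snd p))" if i: "i \<in> {1..N}" for i
    proof -
      let ?h = "\<lambda>p. g i (fst p) * indicator (A i) (snd p)"
      have "?h \<in> \<H>"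
        by (rule test_function_single[OF *(3)[OF i] *(2)[OF i]])
      then obtain M where "\<And>p. \<bar>?h p\<bar> \<le> M" "?h \<in> borel_measurable borel"
        using test_function_bounded test_function_measurable unfolding bounded_functions_iff by meson
      then show ?thesis
        by (intro G.integrable_const_bound[of _ M]) (auto simp: measurable_cong_sets[OF sets_\<gamma> refl])
    qed
    have "(\<integral>p. h p \<partial>\<gamma>) = (\<Sum>i\<in>{1..N}. \<integral>p. g i (fst p) * indicator (A i) (snd p) \<partial>\<gamma>)"
      unfolding *(1) by (rule Bochner_Integration.integral_sum) (rule int)
    also have "\<dots> = 0"
      by (intro sum.neutral ballI single[OF *(2) *(3)])
    finally show ?thesis .
  qed
qed

text \<open>The constraint is integrated against \<open>\<gamma>\<close>: the test function
  contributes zero, and \<open>g \<circ> e\<close> contributes the integral of \<open>g\<close>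
  against the image measure.\<close>

lemma weak_duality:
  fixes c :: "'e \<times> 's \<Rightarrow> ennreal" and e :: "'e \<times> 's \<Rightarrow> 'z::polish_space"
  assumes \<gamma>: "\<gamma> \<in> causal_plans_from BE BS \<eta>" and e: "continuous_on UNIV e" and \<mu>: "distr \<gamma> borel e = \<mu>"
  shows "dual_value_target BE BS c e \<eta> \<mu> \<le> enn2ereal (\<integral>\<^sup>+p. c p \<partial>\<gamma>)"
  unfolding dual_value_target_def
proof (rule Sup_least, safe)
  fix g :: "'z \<Rightarrow> real" and h
  assume g: "g \<in> bcontfun" and h: "h \<in> \<H>"
    and le: "\<forall>x y. ereal (h (x, y) + g (e (x, y))) \<le> enn2ereal (c (x, y))"
  have \<gamma>': "prob_space \<gamma>" "sets \<gamma> = sets borel"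
    using \<gamma> by (auto simp: causal_plans_from_def causal_plans_def transference_plans_def space_prob_algebra)
  interpret G: prob_space \<gamma> by (rule \<gamma>')
  note [measurable_cong] = \<gamma>'(2)
  have [measurable]: "e \<in> measurable borel borel" "g \<in> borel_measurable borel" "h \<in> borel_measurable borel"
    using e g test_function_measurable[OF h] by (auto simp: bcontfun_def intro: borel_measurable_continuous_onI)
  obtain M N where M: "\<And>z. \<bar>g z\<bar> \<le> M" and N: "\<And>p. \<bar>h p\<bar> \<le> N"
    using g test_function_bounded[OF h] unfolding bcontfun_def bounded_functions_iff bounded_iff by fastforce
  have int: "integrable \<gamma> (\<lambda>p. g (e p))" "integrable \<gamma> h"
    by (rule G.integrable_const_bound[of _ M]; simp add: M)
      (rule G.integrable_const_bound[of _ N]; simp add: N del: split_paired_All)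
  have "(\<integral>z. g z \<partial>\<mu>) = (\<integral>p. g (e p) \<partial>\<gamma>)"
    unfolding \<mu>[symmetric] by (rule integral_distr) measurable
  also have "\<dots> = (\<integral>p. h p + g (e p) \<partial>\<gamma>)"
    using int causal_plan_test_function[OF \<gamma> h] by simp
  finally have "ennreal (\<integral>z. g z \<partial>\<mu>) \<le> (\<integral>\<^sup>+p. ennreal (h p + g (e p)) \<partial>\<gamma>)"
    using G.ennreal_integral_le[of "\<lambda>p. h p + g (e p)"] int by simp
  also have "\<dots> \<le> (\<integral>\<^sup>+p. c p \<partial>\<gamma>)"
    using le by (intro nn_integral_mono) (auto simp: ereal_le_enn2ereal_iff)
  finally show "ereal (\<integral>z. g z \<partial>\<mu>) \<le> enn2ereal (\<integral>\<^sup>+p. c p \<partial>\<gamma>)"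
    by (simp add: ereal_le_enn2ereal_iff)
qed

end

lemma bcontfun_iff: "g \<in> bcontfun \<longleftrightarrow> continuous_on UNIV g \<and> g \<in> bounded_functions"
  by (simp add: bcontfun_def bounded_functions_def)

lemma bcontfun_add_real: "f \<in> bcontfun \<Longrightarrow> g \<in> bcontfun \<Longrightarrow> (\<lambda>x. f x + g x :: real) \<in> bcontfun"
  and bcontfun_scale_real: "g \<in> bcontfun \<Longrightarrow> (\<lambda>x. a * g x :: real) \<in> bcontfun"
  by (auto simp: bcontfun_iff intro!: continuous_intros)

lemma ennreal_add_le: "ennreal (a + b) \<le> ennreal a + ennreal b"
proof (cases "0 \<le> a \<and> 0 \<le> b")
  case False
  then have "a + b \<le> a \<or> a + b \<le> b"
    by linarith
  then show ?thesis
    by (metis add_increasing add_increasing2 ennreal_leI zero_le)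
qed simp

lemma ennreal_mult_le: "0 \<le> s \<Longrightarrow> ennreal (s * x) \<le> ennreal s * ennreal x"
  by (cases "0 \<le> x") (auto simp: ennreal_mult ennreal_neg mult_nonneg_nonpos)

section \<open>Causality of graph laws\<close>

context causal_setting
begin

lemma graph_law_causal:
  assumes Y: "graph_coupling \<eta> Y"
    and adapted: "\<And>t C. C \<in> sets (BS t) \<Longrightarrow>
      (\<lambda>x. measure (graph_kernel Y x) C) \<in> borel_measurable (completed_by \<eta> (BE t))"
  shows "graph_law \<eta> Y \<in> causal_plans_from BE BS \<eta>"
proof -
  interpret graph_coupling \<eta> Y
    by (rule Y)
  let ?\<gamma> = "graph_law \<eta> Y"
  let ?\<nu> = "distr ?\<gamma> borel snd"
  have \<nu>: "?\<nu> \<in> space (prob_algebra borel)"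
    by (simp add: space_prob_algebra prob_space.prob_space_distr[OF prob_space_graph_law])
  have "sets (kernel_sigma_field BS \<eta> ?\<nu> (graph_kernel Y) t) \<subseteq> sets (completed_by \<eta> (BE t))" for t
  proof -
    let ?A = "{(\<lambda>x. measure (graph_kernel Y x) C) -` B | B C.
          B \<in> sets borel \<and> C \<in> sets (BS t) \<and> measure ?\<nu> (frontier C) = 0}"
    have "?A \<subseteq> sets (completed_by \<eta> (BE t))"
      using measurable_sets[OF adapted] by auto
    then have "sets (sigma UNIV ?A) \<subseteq> sets (completed_by \<eta> (BE t))"
      using sets.sigma_sets_subset[of ?A "completed_by \<eta> (BE t)"] by simp
    moreover have "null_sets (completion \<eta>) \<subseteq> sets (completed_by \<eta> (BE t))"
      by (auto simp: sets_completed_by)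
    ultimately show ?thesis
      unfolding kernel_sigma_field_def
      using sets.sigma_sets_subset[of "sets (sigma UNIV ?A) \<union> null_sets (completion \<eta>)" "completed_by \<eta> (BE t)"]
      by (simp only: sets_completed_by[of \<eta> "sigma UNIV ?A"] space_completed_by Un_subset_iff)
  qed
  then have "?\<gamma> \<in> causal_plans BE BS \<eta> ?\<nu>"
    using prob_algebra_graph_law distr_graph_law_fst associated_kernel_graph
    by (auto simp: causal_plans_def transference_plans_def)
  then show ?thesis
    using \<nu> by (auto simp: causal_plans_from_def)
qed

text \<open>A constant second coordinate has a kernel independent of \<open>x\<close>, which is
  adapted to any filtration. The plan is needed for attainment when the dual value is
  infinite.\<close>

lemma causal_plan_exists: "causal_plans_from BE BS \<eta> \<noteq> {}"
proof -
  let ?Y = "\<lambda>p :: 'e \<times> real. undefined :: 's"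
  have "graph_coupling \<eta> ?Y"
    using prob_eta by (simp add: graph_coupling_def graph_coupling_axioms_def)
  then have "graph_law \<eta> ?Y \<in> causal_plans_from BE BS \<eta>"
    by (rule graph_law_causal) (simp add: graph_kernel_def)
  then show ?thesis
    by auto
qed

text \<open>Causality is derived from functions on which \<open>\<gamma>\<close> and
  \<open>L\<close> can be compared. Orthogonality spreads from continuous functions of
  \<open>\<rho>\<close> to indicators of open sets and then, by Dynkin's lemma, to all of
  \<open>BS t\<close>; there it forces the kernel to be adapted, by
  \<open>measurable_of_centered_orthogonal\<close>.\<close>

lemma graph_law_test_functions_causal:
  assumes Y: "graph_coupling \<eta> Y"
    and orth: "\<And>t g v. centered \<eta> (BE t) g \<Longrightarrow> continuous_on UNIV v \<Longrightarrow> v \<in> borel_measurable (BS t) \<Longrightarrow>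
      v \<in> bounded_functions \<Longrightarrow> (\<integral>p. g (fst p) * v (snd p) \<partial>graph_law \<eta> Y) = 0"
  shows "graph_law \<eta> Y \<in> causal_plans_from BE BS \<eta>"
proof (rule graph_law_causal[OF Y])
  fix t C assume C: "C \<in> sets (BS t)"
  interpret graph_coupling \<eta> Y
    by (rule Y)
  interpret sub_borel \<eta> "BE t"
    using sub_borel_BE[of "Some t"] by (simp add: adjoin_trivial_def)
  interpret G: prob_space "graph_law \<eta> Y"
    by (rule prob_space_graph_law)
  have K: "associated_kernel \<eta> (graph_law \<eta> Y) (graph_kernel Y)"
    by (rule associated_kernel_graph)
  define \<rho> where "\<rho> = projection t"
  have \<rho>: "continuous_on UNIV \<rho>" and BS_t: "sets (BS t) = {\<rho> -` B | B. B \<in> sets borel}"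
    unfolding \<rho>_def by (rule continuous_projection, rule sets_BS)
  have space_BS: "space (BS t) = UNIV"
    using BS by (auto simp: borel_filtration_def subalgebra_def)
  have [measurable]: "\<rho> \<in> measurable borel borel"
    using \<rho> by (rule borel_measurable_continuous_onI)
  obtain B where B: "B \<in> sets borel" "C = \<rho> -` B"
    using C by (auto simp: BS_t)
  show "(\<lambda>x. measure (graph_kernel Y x) C) \<in> borel_measurable (completed_by \<eta> (BE t))"
  proof (rule measurable_of_centered_orthogonal)
    show "(\<lambda>x. measure (graph_kernel Y x) C) \<in> borel_measurable borel"
      using K BS_borel[OF C] by (simp add: associated_kernel_def)
    show "\<bar>measure (graph_kernel Y x) C\<bar> \<le> 1" for x
      using K prob_space.prob_le_1[of "graph_kernel Y x" C] by (simp add: associated_kernel_def space_prob_algebra)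
    fix g assume g: "centered \<eta> (BE t) g"
    note [measurable] = centered_measurable[OF g]
    obtain M where M: "\<And>x. \<bar>g x\<bar> \<le> M"
      using centered_bounded[OF g] unfolding bounded_functions_iff by auto
    have bound: "norm (g (fst p) * w (\<rho> (snd p))) \<le> M" if "\<And>y. 0 \<le> w y" "\<And>y. w y \<le> 1" for w :: "'s \<Rightarrow> real" and p
    proof -
      have "\<bar>g (fst p)\<bar> * \<bar>w (\<rho> (snd p))\<bar> \<le> M * 1"
        using that[of "\<rho> (snd p)"] M[of "fst p"] abs_ge_zero[of "g (fst p)"] by (intro mult_mono) auto
      then show ?thesis
        by (simp add: abs_mult)
    qed
    have int: "integrable (graph_law \<eta> Y) (\<lambda>p. g (fst p) * w (\<rho> (snd p)))"
      if [measurable]: "w \<in> borel_measurable borel" and "\<And>y. 0 \<le> w y" "\<And>y. w y \<le> 1" for w :: "'s \<Rightarrow> real"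
      by (rule G.integrable_const_bound[of _ M], intro AE_I2 bound that) measurable
    \<comment> \<open>Composing \<open>inner_approx U n\<close> with \<open>\<rho>\<close> gives a
      function both continuous and measurable for \<open>BS t\<close>, the form that
      \<open>orth\<close> accepts; this is where continuity of \<open>\<rho>\<close> is
      used.\<close>
    have base_case: "(\<integral>p. g (fst p) * indicator U (\<rho> (snd p)) \<partial>graph_law \<eta> Y) = 0" if U: "open U" for U
    proof -
      have [measurable]: "U \<in> sets borel"
        using U by simp
      have [measurable]: "inner_approx U n \<in> borel_measurable borel" for n
        by (intro borel_measurable_continuous_onI continuous_inner_approx)
      have "(\<lambda>n. \<integral>p. g (fst p) * inner_approx U n (\<rho> (snd p)) \<partial>graph_law \<eta> Y) \<longlonglongrightarrow>
          (\<integral>p. g (fst p) * indicator U (\<rho> (snd p)) \<partial>graph_law \<eta> Y)"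
      proof (rule integral_dominated_convergence[where w = "\<lambda>_. M"])
        show "AE p in graph_law \<eta> Y. (\<lambda>n. g (fst p) * inner_approx U n (\<rho> (snd p))) \<longlonglongrightarrow> g (fst p) * indicator U (\<rho> (snd p))"
          by (intro AE_I2 tendsto_mult_left inner_approx_tendsto U)
        show "AE p in graph_law \<eta> Y. norm (g (fst p) * inner_approx U n (\<rho> (snd p))) \<le> M" for n
          by (intro AE_I2 bound inner_approx_bounds)
      qed auto
      moreover have "(\<integral>p. g (fst p) * inner_approx U n (\<rho> (snd p)) \<partial>graph_law \<eta> Y) = 0" for n
      proof (rule orth[OF g])
        show "continuous_on UNIV (\<lambda>y. inner_approx U n (\<rho> y))"
          using \<rho> by (intro continuous_on_compose2[OF continuous_inner_approx[of UNIV]]) auto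
        show "(\<lambda>y. inner_approx U n (\<rho> y)) \<in> borel_measurable (BS t)"
        proof (rule measurableI)
          fix A :: "real set" assume "A \<in> sets borel"
          then have "inner_approx U n -` A \<in> sets borel"
            using measurable_sets[OF \<open>inner_approx U n \<in> borel_measurable borel\<close>, of A] by simp
          then show "(\<lambda>y. inner_approx U n (\<rho> y)) -` A \<inter> space (BS t) \<in> sets (BS t)"
            unfolding BS_t space_BS by (auto intro!: exI[of _ "inner_approx U n -` A"])
        qed simp
        show "(\<lambda>y. inner_approx U n (\<rho> y)) \<in> bounded_functions"
          by (intro bounded_functionsI[of _ 1]) (simp add: inner_approx_bounds)
      qed
      ultimately show ?thesis
        by (simp add: LIMSEQ_const_iff)
    qed
    have "(\<integral>p. g (fst p) * indicator B (\<rho> (snd p)) \<partial>graph_law \<eta> Y) = 0"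
      using B(1)
    proof (induction B rule: open_induct_disjoint)
      case (base U)
      then show ?case
        by (rule base_case)
    next
      case (compl A)
      note [measurable] = compl(1)
      have "(\<integral>p. g (fst p) * indicator (- A) (\<rho> (snd p)) \<partial>graph_law \<eta> Y) =
          (\<integral>p. g (fst p) * indicator UNIV (\<rho> (snd p)) - g (fst p) * indicator A (\<rho> (snd p)) \<partial>graph_law \<eta> Y)"
        by (intro Bochner_Integration.integral_cong refl) (auto split: split_indicator)
      also have "\<dots> = (\<integral>p. g (fst p) * indicator UNIV (\<rho> (snd p)) \<partial>graph_law \<eta> Y) -
          (\<integral>p. g (fst p) * indicator A (\<rho> (snd p)) \<partial>graph_law \<eta> Y)"
        by (intro Bochner_Integration.integral_diff int) (auto split: split_indicator)
      finally show ?case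
        using compl(2) base_case[of UNIV] by (simp only: open_UNIV)
    next
      case (union A)
      have [measurable]: "A i \<in> sets borel" "(\<Union>i. A i) \<in> sets borel" "(\<Union>i<n. A i) \<in> sets borel" for i n
        using union(2) by auto
      let ?S = "\<lambda>n p. \<Sum>i<n. g (fst p) * indicator (A i) (\<rho> (snd p))"
      have S: "?S n p = g (fst p) * indicator (\<Union>i<n. A i) (\<rho> (snd p))" for n p
        using union(1) by (simp only: sum_distrib_left[symmetric])
          (subst indicator_UN_disjoint, auto intro: disjoint_family_on_mono)
      have "(\<lambda>n. \<integral>p. ?S n p \<partial>graph_law \<eta> Y) \<longlonglongrightarrow>
          (\<integral>p. g (fst p) * indicator (\<Union>i. A i) (\<rho> (snd p)) \<partial>graph_law \<eta> Y)"
        unfolding S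
      proof (rule integral_dominated_convergence[where w = "\<lambda>_. M"])
        show "AE p in graph_law \<eta> Y. (\<lambda>n. g (fst p) * indicator (\<Union>i<n. A i) (\<rho> (snd p))) \<longlonglongrightarrow>
            g (fst p) * indicator (\<Union>i. A i) (\<rho> (snd p))"
          by (intro AE_I2 tendsto_mult_left LIMSEQ_indicator_UN)
        show "AE p in graph_law \<eta> Y. norm (g (fst p) * indicator (\<Union>i<n. A i) (\<rho> (snd p))) \<le> M" for n
          by (intro AE_I2 bound) (auto split: split_indicator)
      qed auto
      moreover have "(\<integral>p. ?S n p \<partial>graph_law \<eta> Y) = 0" for n
      proof -
        have "(\<integral>p. ?S n p \<partial>graph_law \<eta> Y) = (\<Sum>i<n. \<integral>p. g (fst p) * indicator (A i) (\<rho> (snd p)) \<partial>graph_law \<eta> Y)"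
          by (intro Bochner_Integration.integral_sum int) (auto split: split_indicator)
        then show ?thesis
          by (simp only: union(3) sum.neutral_const)
      qed
      ultimately show ?case
        by (simp add: LIMSEQ_const_iff)
    qed
    moreover have "indicator B (\<rho> y) = (indicator C y :: real)" for y
      by (auto simp: B(2) split: split_indicator)
    ultimately have "(\<integral>p. g (fst p) * indicator C (snd p) \<partial>graph_law \<eta> Y) = 0"
      by simp
    then show "(\<integral>x. g x * measure (graph_kernel Y x) C \<partial>\<eta>) = 0"
      using associated_kernel_integral[OF K \<eta> prob_algebra_graph_law centered_measurable[OF g]
          centered_bounded[OF g] BS_borel[OF C]] by simp
  qed
qed

end

section \<open>Strong duality\<close>

context causal_setting
begin

text \<open>All real terms stand on one side, so nothing is subtracted from a possibly infinite
  \<open>c\<close>. For \<open>s = 0\<close> the right side is \<open>0\<close> even where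
  \<open>c\<close> is infinite, so the constraint is then \<open>f p \<le> h p + g (e p)\<close>
  everywhere.\<close>

definition admissible ::
  "('e \<times> 's \<Rightarrow> ennreal) \<Rightarrow> ('e \<times> 's \<Rightarrow> 'z::polish_space) \<Rightarrow> ('e \<times> 's \<Rightarrow> real) \<Rightarrow>
   ('z \<Rightarrow> real) \<Rightarrow> ('e \<times> 's \<Rightarrow> real) \<Rightarrow> real \<Rightarrow> bool" where
  "admissible c e f g h s \<longleftrightarrow> g \<in> bcontfun \<and> h \<in> \<H> \<and> 0 \<le> s \<and>
     (\<forall>p. ennreal (f p - h p - g (e p)) \<le> ennreal s * c p)"

text \<open>The multiple of \<open>c\<close> in the constraint makes every functional below \<open>dual_bound\<close> at most \<open>d\<close> on
  the bounded functions below \<open>c\<close>, although \<open>c\<close> itself may be unbounded or infinite.\<close>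

definition dual_bound ::
  "('e \<times> 's \<Rightarrow> ennreal) \<Rightarrow> ('e \<times> 's \<Rightarrow> 'z::polish_space) \<Rightarrow> 'z measure \<Rightarrow> real \<Rightarrow> ('e \<times> 's \<Rightarrow> real) \<Rightarrow> real" where
  "dual_bound c e \<mu> d f = Inf {(\<integral>z. g z \<partial>\<mu>) + s * d | g h s. admissible c e f g h s}"

lemma admissibleI:
  assumes "g \<in> bcontfun" "h \<in> \<H>" "0 \<le> s"
    "\<And>p. ennreal (f p - h p - g (e p)) \<le> ennreal s * c p"
  shows "admissible c e f g h s"
  using assms by (simp add: admissible_def)

lemma admissibleD: "admissible c e f g h s \<Longrightarrow> ennreal (f p - h p - g (e p)) \<le> ennreal s * c p"
  unfolding admissible_def by blast

lemma admissible_add: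
  assumes "admissible c e f g h s" "admissible c e f' g' h' s'"
  shows "admissible c e (\<lambda>p. f p + f' p) (\<lambda>z. g z + g' z) (\<lambda>p. h p + h' p) (s + s')"
proof (rule admissibleI)
  fix p
  have "ennreal (f p + f' p - (h p + h' p) - (g (e p) + g' (e p))) =
      ennreal ((f p - h p - g (e p)) + (f' p - h' p - g' (e p)))"
    by (simp add: algebra_simps)
  also have "\<dots> \<le> ennreal (f p - h p - g (e p)) + ennreal (f' p - h' p - g' (e p))"
    by (rule ennreal_add_le)
  also have "\<dots> \<le> ennreal s * c p + ennreal s' * c p"
    by (intro add_mono admissibleD assms)
  also have "\<dots> = ennreal (s + s') * c p"
    using assms by (simp add: admissible_def distrib_right)
  finally show "ennreal (f p + f' p - (h p + h' p) - (g (e p) + g' (e p))) \<le> ennreal (s + s') * c p" .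
qed (use assms in \<open>auto simp: admissible_def bcontfun_add_real test_function_add\<close>)

lemma admissible_scale:
  assumes "admissible c e f g h s" "0 \<le> a"
  shows "admissible c e (\<lambda>p. a * f p) (\<lambda>z. a * g z) (\<lambda>p. a * h p) (a * s)"
proof (rule admissibleI)
  fix p
  have "ennreal (a * f p - a * h p - a * g (e p)) = ennreal (a * (f p - h p - g (e p)))"
    by (simp add: algebra_simps)
  also have "\<dots> \<le> ennreal a * ennreal (f p - h p - g (e p))"
    by (rule ennreal_mult_le[OF assms(2)])
  also have "\<dots> \<le> ennreal a * (ennreal s * c p)"
    by (intro mult_left_mono admissibleD[OF assms(1)]) simp
  also have "\<dots> = ennreal (a * s) * c p"
    using assms by (simp add: admissible_def ennreal_mult mult.assoc)
  finally show "ennreal (a * f p - a * h p - a * g (e p)) \<le> ennreal (a * s) * c p" .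
qed (use assms in \<open>auto simp: admissible_def bcontfun_scale_real test_function_scale\<close>)

end

text \<open>Here \<open>d\<close> is any real bound for the values of the dual problem; it becomes
  the dual value itself in \<open>strong_duality\<close>.\<close>

locale finite_dual = causal_setting BE BS \<eta>
  for BE :: "'i::linorder \<Rightarrow> 'e::polish_space measure" and BS :: "'i \<Rightarrow> 's::polish_space measure" and \<eta> +
  fixes c :: "'e \<times> 's \<Rightarrow> ennreal" and e :: "'e \<times> 's \<Rightarrow> 'z::polish_space" and \<mu> :: "'z measure" and d :: real
  assumes c: "lower_semicontinuous c" and e: "continuous_on UNIV e"
    and \<mu>: "\<mu> \<in> space (prob_algebra borel)"
    and compact: "compact (UNIV :: 's set)"
    and dual: "\<And>g h. g \<in> bcontfun \<Longrightarrow> h \<in> \<H> \<Longrightarrow> (\<And>p. ennreal (h p + g (e p)) \<le> c p) \<Longrightarrow> (\<integral>z. g z \<partial>\<mu>) \<le> d"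
begin

lemma prob_mu: "prob_space \<mu>" and sets_mu [simp, measurable_cong]: "sets \<mu> = sets borel"
  using \<mu> by (auto simp: space_prob_algebra)

sublocale mu: prob_space \<mu>
  by (rule prob_mu)

lemma integrable_bcontfun:
  assumes "g \<in> bcontfun"
  shows "integrable \<mu> (g :: 'z \<Rightarrow> real)"
proof -
  obtain M where "\<And>z. \<bar>g z\<bar> \<le> M"
    using assms by (auto simp: bcontfun_iff bounded_functions_iff)
  moreover have "g \<in> borel_measurable borel"
    using assms by (intro borel_measurable_continuous_onI) (simp add: bcontfun_iff)
  ultimately show ?thesis
    by (intro mu.integrable_const_bound[of _ M]) auto
qed

lemma d_nonneg: "0 \<le> d"
  using dual[OF const_bcontfun[of 0] test_function_zero] by simp

text \<open>This keeps \<open>dual_bound\<close> finite. Dividing \<open>- g\<close> and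
  \<open>- h\<close> by \<open>s + \<epsilon>\<close> gives a competitor of the dual problem, hence
  a bound by \<open>d\<close>; the \<epsilon> is there because \<open>s\<close> may be zero, and it
  is removed at the end.\<close>

lemma admissible_zero_nonneg:
  assumes "admissible c e (\<lambda>p. 0) g h s"
  shows "0 \<le> (\<integral>z. g z \<partial>\<mu>) + s * d"
proof -
  have g: "g \<in> bcontfun" and h: "h \<in> \<H>" and s: "0 \<le> s"
    and le: "\<And>p. ennreal (- h p - g (e p)) \<le> ennreal s * c p"
    using assms by (auto simp: admissible_def)
  have step: "- (\<integral>z. g z \<partial>\<mu>) \<le> (s + \<epsilon>) * d" if \<epsilon>: "\<epsilon> > 0" for \<epsilon>
  proof -
    let ?a = "- inverse (s + \<epsilon>)"
    have pos: "s + \<epsilon> > 0"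
      using s \<epsilon> by simp
    have "(\<integral>z. ?a * g z \<partial>\<mu>) \<le> d"
    proof (rule dual)
      fix p
      have "ennreal (?a * h p + ?a * g (e p)) = ennreal (inverse (s + \<epsilon>) * (- h p - g (e p)))"
        by (simp add: algebra_simps)
      also have "\<dots> \<le> ennreal (inverse (s + \<epsilon>)) * ennreal (- h p - g (e p))"
        using pos by (intro ennreal_mult_le) simp
      also have "\<dots> \<le> ennreal (inverse (s + \<epsilon>)) * (ennreal (s + \<epsilon>) * c p)"
        using \<epsilon> by (intro mult_left_mono order_trans[OF le] mult_right_mono ennreal_leI) auto
      also have "\<dots> = ennreal (inverse (s + \<epsilon>) * (s + \<epsilon>)) * c p"
        using pos by (subst ennreal_mult) (auto simp: mult.assoc)
      also have "\<dots> = c p"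
        using pos by simp
      finally show "ennreal (?a * h p + ?a * g (e p)) \<le> c p" .
    qed (intro bcontfun_scale_real g test_function_scale h)+
    then show ?thesis
      using pos by (simp add: field_simps)
  qed
  have "- (\<integral>z. g z \<partial>\<mu>) - s * d \<le> 0 + \<delta>" if "\<delta> > 0" for \<delta>
  proof -
    \<comment> \<open>As \<open>d\<close> may be zero, the error is divided by
      \<open>d + 1\<close>.\<close>
    have "\<delta> / (d + 1) * d \<le> \<delta> / (d + 1) * (d + 1)"
      using d_nonneg that by (intro mult_left_mono) auto
    also have "\<dots> = \<delta>"
      using d_nonneg by simp
    finally have "\<delta> / (d + 1) * d \<le> \<delta>" .
    moreover have "- (\<integral>z. g z \<partial>\<mu>) \<le> (s + \<delta> / (d + 1)) * d"
      using d_nonneg that by (intro step) auto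
    ultimately show ?thesis
      by (simp add: distrib_right)
  qed
  then have "- (\<integral>z. g z \<partial>\<mu>) - s * d \<le> 0"
    by (rule field_le_epsilon)
  then show ?thesis
    by simp
qed

lemma admissible_const: "(\<And>p. f p \<le> M) \<Longrightarrow> admissible c e f (\<lambda>z. M) (\<lambda>p. 0) 0"
  by (intro admissibleI const_bcontfun test_function_zero) (auto simp: ennreal_neg)

text \<open>Adding the constant triple admissible for \<open>- f\<close> leads back to the zero
  function.\<close>

lemma admissible_lower:
  assumes "admissible c e f g h s" "\<And>p. - M \<le> f p"
  shows "- M \<le> (\<integral>z. g z \<partial>\<mu>) + s * d"
proof -
  have "admissible c e (\<lambda>p. - f p) (\<lambda>z. M) (\<lambda>p. 0) 0"
    using assms(2) by (intro admissible_const) (simp add: minus_le_iff)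
  from admissible_add[OF assms(1) this] have "admissible c e (\<lambda>p. 0) (\<lambda>z. g z + M) h s"
    by simp
  then have "0 \<le> (\<integral>z. g z + M \<partial>\<mu>) + s * d"
    by (rule admissible_zero_nonneg)
  also have "(\<integral>z. g z + M \<partial>\<mu>) = (\<integral>z. g z \<partial>\<mu>) + M"
    using integrable_bcontfun[of g] assms(1) by (simp add: admissible_def mu.prob_space)
  finally show ?thesis
    by simp
qed

abbreviation "\<Psi> \<equiv> dual_bound c e \<mu> d"

lemma dual_bound_le:
  assumes "f \<in> bounded_functions" "admissible c e f g h s"
  shows "\<Psi> f \<le> (\<integral>z. g z \<partial>\<mu>) + s * d"
proof -
  obtain M where M: "\<And>p. \<bar>f p\<bar> \<le> M"
    using assms(1) by (auto simp: bounded_functions_iff)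
  have "- M \<le> f p" for p
    using M[of p] by linarith
  then have "bdd_below {(\<integral>z. g z \<partial>\<mu>) + s * d | g h s. admissible c e f g h s}"
    using admissible_lower[of f _ _ _ M] by (intro bdd_belowI[of _ "- M"]) auto
  then show ?thesis
    unfolding dual_bound_def using assms(2) by (intro cInf_lower) auto
qed

lemma dual_bound_greatest:
  assumes "f \<in> bounded_functions" "\<And>g h s. admissible c e f g h s \<Longrightarrow> x \<le> (\<integral>z. g z \<partial>\<mu>) + s * d"
  shows "x \<le> \<Psi> f"
proof -
  obtain M where M: "\<And>p. \<bar>f p\<bar> \<le> M"
    using assms(1) by (auto simp: bounded_functions_iff)
  have "f p \<le> M" for p
    using M[of p] by linarith
  then have "admissible c e f (\<lambda>z. M) (\<lambda>p. 0) 0"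
    by (rule admissible_const)
  then show ?thesis
    unfolding dual_bound_def using assms(2) by (intro cInf_greatest) auto
qed

lemma sublinear_dual_bound: "sublinear \<Psi>"
  unfolding sublinear_def
proof (intro conjI ballI allI impI)
  fix f f' :: "'e \<times> 's \<Rightarrow> real"
  assume f: "f \<in> bounded_functions" and f': "f' \<in> bounded_functions"
  have le: "\<Psi> (\<lambda>p. f p + f' p) \<le> ((\<integral>z. g z \<partial>\<mu>) + s * d) + ((\<integral>z. g' z \<partial>\<mu>) + s' * d)"
    if ad: "admissible c e f g h s" "admissible c e f' g' h' s'" for g h s g' h' s'
  proof -
    have "\<Psi> (\<lambda>p. f p + f' p) \<le> (\<integral>z. g z + g' z \<partial>\<mu>) + (s + s') * d"
      by (rule dual_bound_le[OF bounded_functions_add[OF f f'] admissible_add[OF ad]])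
    also have "\<dots> = ((\<integral>z. g z \<partial>\<mu>) + s * d) + ((\<integral>z. g' z \<partial>\<mu>) + s' * d)"
      using integrable_bcontfun[of g] integrable_bcontfun[of g'] ad
      by (simp add: admissible_def distrib_right)
    finally show ?thesis .
  qed
  have le': "\<Psi> (\<lambda>p. f p + f' p) - ((\<integral>z. g z \<partial>\<mu>) + s * d) \<le> \<Psi> f'" if "admissible c e f g h s" for g h s
  proof (rule dual_bound_greatest[OF f'])
    fix g' h' s' assume "admissible c e f' g' h' s'"
    from le[OF that this] show "\<Psi> (\<lambda>p. f p + f' p) - ((\<integral>z. g z \<partial>\<mu>) + s * d) \<le> (\<integral>z. g' z \<partial>\<mu>) + s' * d"
      by linarith
  qed
  have "\<Psi> (\<lambda>p. f p + f' p) - \<Psi> f' \<le> \<Psi> f"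
  proof (rule dual_bound_greatest[OF f])
    fix g h s assume "admissible c e f g h s"
    from le'[OF this] show "\<Psi> (\<lambda>p. f p + f' p) - \<Psi> f' \<le> (\<integral>z. g z \<partial>\<mu>) + s * d"
      by linarith
  qed
  then show "\<Psi> (\<lambda>p. f p + f' p) \<le> \<Psi> f + \<Psi> f'"
    by simp
next
  fix f :: "'e \<times> 's \<Rightarrow> real" and a :: real
  assume f: "f \<in> bounded_functions" and a: "0 < a"
  have "\<Psi> (\<lambda>p. a * f p) / a \<le> \<Psi> f"
  proof (rule dual_bound_greatest[OF f])
    fix g h s assume "admissible c e f g h s"
    then have "admissible c e (\<lambda>p. a * f p) (\<lambda>z. a * g z) (\<lambda>p. a * h p) (a * s)"
      using a by (intro admissible_scale) auto
    then have "\<Psi> (\<lambda>p. a * f p) \<le> (\<integral>z. a * g z \<partial>\<mu>) + (a * s) * d"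
      by (rule dual_bound_le[OF bounded_functions_scale[OF f]])
    also have "\<dots> = a * ((\<integral>z. g z \<partial>\<mu>) + s * d)"
      by (simp add: distrib_left mult.assoc)
    finally show "\<Psi> (\<lambda>p. a * f p) / a \<le> (\<integral>z. g z \<partial>\<mu>) + s * d"
      using a by (simp add: field_simps)
  qed
  then show "\<Psi> (\<lambda>p. a * f p) \<le> a * \<Psi> f"
    using a by (simp add: field_simps)
qed

text \<open>Each property of \<open>L\<close> comes from a triple \<open>(g, h, s)\<close>:
  \<open>(0, h, 0)\<close> handles test functions, \<open>(g, 0, 0)\<close> the image under
  \<open>e\<close>, constant \<open>g\<close> normalisation and positivity, and
  \<open>(0, 0, 1)\<close> the bound \<open>d\<close> below the cost.\<close>

theorem optimal_plan_exists:
  "\<exists>\<gamma>\<in>causal_plans_from BE BS \<eta>. distr \<gamma> borel e = \<mu> \<and> (\<integral>\<^sup>+p. c p \<partial>\<gamma>) \<le> ennreal d"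
proof -
  obtain L where L: "linear_functional L" and L_le: "\<And>f. f \<in> bounded_functions \<Longrightarrow> L f \<le> \<Psi> f"
    using sublinear_dominates_linear[OF sublinear_dual_bound] by metis
  have L_admissible: "L f \<le> (\<integral>z. g z \<partial>\<mu>) + s * d"
    if "f \<in> bounded_functions" "admissible c e f g h s" for f g h s
    using L_le dual_bound_le that by (blast intro: order_trans)
  have L_add: "L (\<lambda>p. f p + g p) = L f + L g" and L_scale: "L (\<lambda>p. a * f p) = a * L f"
    if "f \<in> bounded_functions" "g \<in> bounded_functions" for f g a
    using L that by (auto simp: linear_functional_def)
  have L_const_le: "L (\<lambda>p. a) \<le> a" for a
    using L_admissible[OF bounded_functions_const admissible_const[of "\<lambda>p. a" a]] by (simp add: mu.prob_space)
  \<comment> \<open>Domination gives upper bounds only; equality follows by applying them to the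
    negative too. The same is done for test functions and for functions of the target.\<close>
  have L_const: "L (\<lambda>p. a) = a" for a
    using L_const_le[of a] L_const_le[of "- a"] L_scale[of "\<lambda>p. a" "\<lambda>p. a" "-1"] by simp
  have L_test_le: "L h \<le> 0" if h: "h \<in> \<H>" for h
    using L_admissible[OF test_function_bounded[OF h] admissibleI[OF const_bcontfun[of 0] h order_refl]] by simp
  have L_test: "L h = 0" if h: "h \<in> \<H>" for h
    using L_test_le[OF h] L_test_le[OF test_function_scale[OF h, of "-1"]]
      L_scale[OF test_function_bounded[OF h] test_function_bounded[OF h], of "-1"] by simp
  have bounded_e: "(\<lambda>p. g (e p)) \<in> bounded_functions" if "g \<in> bcontfun" for g :: "'z \<Rightarrow> real"
    using that by (simp add: bcontfun_iff bounded_functions_comp)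
  have L_target_le: "L (\<lambda>p. g (e p)) \<le> (\<integral>z. g z \<partial>\<mu>)" if g: "g \<in> bcontfun" for g
    using L_admissible[OF bounded_e[OF g] admissibleI[OF g test_function_zero order_refl]] by simp
  have L_target: "L (\<lambda>p. g (e p)) = (\<integral>z. g z \<partial>\<mu>)" if g: "g \<in> bcontfun" for g
    using L_target_le[OF g] L_target_le[OF bcontfun_scale_real[OF g, of "-1"]]
      L_scale[OF bounded_e[OF g] bounded_e[OF g], of "-1"] by simp
  have L_nonpos: "L f \<le> 0" if "f \<in> bounded_functions" "\<And>p. f p \<le> 0" for f
    using L_admissible[OF that(1) admissible_const[OF that(2)]] by simp
  interpret positive_functional \<eta> L
  proof (rule positive_functional.intro)
    show "prob_space \<eta>"
      by (rule prob_eta)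
    show "L f \<le> L g" if "f \<in> bounded_functions" "g \<in> bounded_functions" "\<And>p. f p \<le> g p" for f g
    proof -
      have "L (\<lambda>p. f p + - 1 * g p) \<le> 0"
        using that by (intro L_nonpos bounded_functions_add bounded_functions_scale) simp_all
      moreover have "L (\<lambda>p. f p + - 1 * g p) = L f + - 1 * L g"
        using that L_add[of f "\<lambda>p. - 1 * g p"] L_scale[of g g "- 1"] by (simp only: bounded_functions_scale)
      ultimately show ?thesis
        by simp
    qed
    show "L (\<lambda>p. indicator A (fst p)) = measure \<eta> A" if A: "A \<in> sets borel" for A
    proof -
      have "L (\<lambda>p. (indicator A (fst p) - measure \<eta> A) + measure \<eta> A) =
          L (\<lambda>p. indicator A (fst p) - measure \<eta> A) + L (\<lambda>p. measure \<eta> A)"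
        by (rule L_add[OF test_function_bounded[OF test_function_indicator[OF A]] bounded_functions_const])
      then show ?thesis
        using L_test[OF test_function_indicator[OF A]] by (simp add: L_const)
    qed
  qed (use L in simp_all)
  show ?thesis
  proof (rule graph_coupling_exists[OF compact])
    fix Y
    assume coupling: "graph_coupling \<eta> Y"
      and lsc: "\<And>c d. lower_semicontinuous c \<Longrightarrow> (\<And>f. f \<in> bounded_functions \<Longrightarrow> (\<And>p. ennreal (f p) \<le> c p) \<Longrightarrow> L f \<le> d) \<Longrightarrow>
        (\<integral>\<^sup>+p. c p \<partial>graph_law \<eta> Y) \<le> ennreal d"
      and cont: "\<And>f. f \<in> borel_measurable borel \<Longrightarrow> f \<in> bounded_functions \<Longrightarrow> (\<And>x. continuous_on UNIV (\<lambda>y. f (x, y))) \<Longrightarrow>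
        (\<integral>p. f p \<partial>graph_law \<eta> Y) = L f"
    interpret graph_coupling \<eta> Y
      by (rule coupling)
    have e_meas [measurable]: "e \<in> measurable borel borel"
      using e by (rule borel_measurable_continuous_onI)
    have "graph_law \<eta> Y \<in> causal_plans_from BE BS \<eta>"
    proof (rule graph_law_test_functions_causal[OF coupling])
      fix t g v
      assume g: "centered \<eta> (BE t) g" and v: "continuous_on UNIV v" "v \<in> borel_measurable (BS t)" "v \<in> bounded_functions"
      have prod_bounded: "(\<lambda>p. g (fst p) * w (snd p)) \<in> bounded_functions" if "w \<in> bounded_functions" for w :: "'s \<Rightarrow> real"
        by (rule bounded_functions_product[OF centered_bounded[OF g] that])
      have [measurable]: "g \<in> borel_measurable borel" "v \<in> borel_measurable borel"
        using centered_measurable[OF g] v(1) by (auto intro: borel_measurable_continuous_onI)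
      have "(\<integral>p. g (fst p) * v (snd p) \<partial>graph_law \<eta> Y) = L (\<lambda>p. g (fst p) * v (snd p))"
      proof (rule cont)
        show "(\<lambda>p. g (fst p) * v (snd p)) \<in> borel_measurable borel"
          unfolding borel_prod[symmetric] by measurable
        show "continuous_on UNIV (\<lambda>y. g (fst (x, y)) * v (snd (x, y)))" for x
          using v(1) by (auto intro!: continuous_intros)
      qed (rule prod_bounded[OF v(3)])
      \<comment> \<open>For \<open>A\<close> in \<open>BS t\<close>, the product of \<open>g\<close>
        with the indicator of \<open>A\<close> is a test function, so \<open>L\<close> vanishes on
        it, and \<open>v\<close> is a uniform limit of combinations of such indicators. The
        comparison with \<open>\<gamma>\<close> was made for the continuous \<open>v\<close>, not
        for the indicators.\<close>
      also have "L (\<lambda>p. g (fst p) * v (snd p)) = 0"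
      proof -
        obtain M where M: "\<And>x. \<bar>g x\<bar> \<le> M"
          using centered_bounded[OF g] unfolding bounded_functions_iff by auto
        show ?thesis
        proof (rule bounded_measurable_functional_zero[where M = "BS t" and K = M
              and \<Phi> = "\<lambda>w. L (\<lambda>p. g (fst p) * w (snd p))"])
          show "space (BS t) = UNIV"
            using BS by (simp add: borel_filtration_def subalgebra_def)
          fix w w' :: "'s \<Rightarrow> real" and a
          assume w: "w \<in> borel_measurable (BS t) \<inter> bounded_functions"
          have "L (\<lambda>p. a * (g (fst p) * w (snd p))) = a * L (\<lambda>p. g (fst p) * w (snd p))"
            using w by (intro L_scale prod_bounded) auto
          then show "L (\<lambda>p. g (fst p) * (a * w (snd p))) = a * L (\<lambda>p. g (fst p) * w (snd p))"
            by (simp add: mult.left_commute)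
          assume w': "w' \<in> borel_measurable (BS t) \<inter> bounded_functions"
          have "L (\<lambda>p. g (fst p) * w (snd p) + g (fst p) * w' (snd p)) =
              L (\<lambda>p. g (fst p) * w (snd p)) + L (\<lambda>p. g (fst p) * w' (snd p))"
            using w w' by (intro L_add prod_bounded) auto
          then show "L (\<lambda>p. g (fst p) * (w (snd p) + w' (snd p))) =
              L (\<lambda>p. g (fst p) * w (snd p)) + L (\<lambda>p. g (fst p) * w' (snd p))"
            by (simp add: distrib_left)
        next
          fix w :: "'s \<Rightarrow> real" and \<epsilon>
          assume w: "w \<in> borel_measurable (BS t) \<inter> bounded_functions" "\<And>y. \<bar>w y\<bar> \<le> \<epsilon>"
          show "\<bar>L (\<lambda>p. g (fst p) * w (snd p))\<bar> \<le> M * \<epsilon>"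
          proof (rule L_bound)
            show "(\<lambda>p. g (fst p) * w (snd p)) \<in> bounded_functions"
              using w by (intro prod_bounded) simp
            show "\<bar>g (fst p) * w (snd p)\<bar> \<le> M * \<epsilon>" for p
              unfolding abs_mult using M[of "fst p"] w(2)[of "snd p"] abs_ge_zero[of "g (fst p)"]
              by (intro mult_mono) linarith+
          qed
        next
          fix A assume "A \<in> sets (BS t)"
          then show "L (\<lambda>p. g (fst p) * indicator A (snd p)) = 0"
            using g by (intro L_test test_function_single[where t = "Some t"]) (auto simp: adjoin_trivial_def)
        qed (use v in simp)
      qed
      finally show "(\<integral>p. g (fst p) * v (snd p) \<partial>graph_law \<eta> Y) = 0" .
    qed
    moreover have "distr (graph_law \<eta> Y) borel e = \<mu>"
    proof (rule measure_eqI_bcontfun[OF prob_space.prob_space_distr[OF prob_space_graph_law] prob_mu])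
      fix g :: "'z \<Rightarrow> real" assume g: "g \<in> bcontfun"
      then have [measurable]: "g \<in> borel_measurable borel"
        by (intro borel_measurable_continuous_onI) (simp add: bcontfun_iff)
      have "(\<integral>z. g z \<partial>distr (graph_law \<eta> Y) borel e) = (\<integral>p. g (e p) \<partial>graph_law \<eta> Y)"
        by (rule integral_distr) measurable
      also have "\<dots> = L (\<lambda>p. g (e p))"
      proof (rule cont[OF _ bounded_e[OF g]])
        fix x
        have "continuous_on UNIV (\<lambda>y. e (x, y))"
          by (rule continuous_on_compose2[OF e]) (auto intro!: continuous_intros)
        then show "continuous_on UNIV (\<lambda>y. g (e (x, y)))"
          using g by (intro continuous_on_compose2[of UNIV g UNIV "\<lambda>y. e (x, y)"]) (auto simp: bcontfun_iff)
      qed measurable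
      finally show "(\<integral>z. g z \<partial>distr (graph_law \<eta> Y) borel e) = (\<integral>z. g z \<partial>\<mu>)"
        by (simp add: L_target[OF g])
    qed simp_all
    moreover have "(\<integral>\<^sup>+p. c p \<partial>graph_law \<eta> Y) \<le> ennreal d"
    proof (rule lsc[OF c])
      fix f assume f: "f \<in> bounded_functions" "\<And>p. ennreal (f p) \<le> c p"
      have "admissible c e f (\<lambda>z. 0) (\<lambda>p. 0) 1"
        using f(2) by (intro admissibleI const_bcontfun test_function_zero) simp_all
      from L_admissible[OF f(1) this] show "L f \<le> d"
        by simp
    qed
    ultimately show ?thesis
      by blast
  qed
qed

end

section \<open>From the dual value to attainment and the problem without target\<close>

context causal_setting
begin

lemma dual_value_target_nonneg: "0 \<le> dual_value_target BE BS c e \<eta> \<mu>"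
proof -
  have "ereal (\<integral>z. 0 \<partial>\<mu>) \<le> dual_value_target BE BS c e \<eta> \<mu>"
    unfolding dual_value_target_def using const_bcontfun[of 0] test_function_zero
    by (intro Sup_upper) (force simp: zero_ereal_def[symmetric])
  then show ?thesis
    by (simp add: zero_ereal_def)
qed

text \<open>A finite dual value alone already produces a causal plan with image
  \<open>\<mu>\<close>, of cost at most that value; weak duality excludes a smaller cost.\<close>

lemma strong_duality:
  fixes c :: "'e \<times> 's \<Rightarrow> ennreal" and e :: "'e \<times> 's \<Rightarrow> 'z::polish_space"
  assumes c: "lower_semicontinuous c" and e: "continuous_on UNIV e" and \<mu>: "\<mu> \<in> space (prob_algebra borel)"
    and compact: "compact (UNIV :: 's set)"
    and finite: "dual_value_target BE BS c e \<eta> \<mu> < \<infinity>"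
  shows "\<exists>\<gamma>\<in>causal_plans_from BE BS \<eta>. distr \<gamma> borel e = \<mu> \<and>
    enn2ereal (\<integral>\<^sup>+p. c p \<partial>\<gamma>) = dual_value_target BE BS c e \<eta> \<mu>"
proof -
  let ?D = "dual_value_target BE BS c e \<eta> \<mu>"
  obtain d where d: "?D = ereal d"
    using finite dual_value_target_nonneg[of c e \<mu>] by (cases ?D) auto
  then have "0 \<le> d"
    using dual_value_target_nonneg[of c e \<mu>] by simp
  interpret finite_dual BE BS \<eta> c e \<mu> d
  proof
    fix g :: "'z \<Rightarrow> real" and h
    assume "g \<in> bcontfun" "h \<in> \<H>" "\<And>p. ennreal (h p + g (e p)) \<le> c p"
    then have "ereal (\<integral>z. g z \<partial>\<mu>) \<le> ?D"
      unfolding dual_value_target_def ereal_le_enn2ereal_iff by (intro Sup_upper) blast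
    then show "(\<integral>z. g z \<partial>\<mu>) \<le> d"
      by (simp add: d)
  qed fact+
  obtain \<gamma> where \<gamma>: "\<gamma> \<in> causal_plans_from BE BS \<eta>" "distr \<gamma> borel e = \<mu>" "(\<integral>\<^sup>+p. c p \<partial>\<gamma>) \<le> ennreal d"
    using optimal_plan_exists by blast
  have "enn2ereal (\<integral>\<^sup>+p. c p \<partial>\<gamma>) \<le> enn2ereal (ennreal d)"
    using \<gamma>(3) by (simp add: less_eq_ennreal.rep_eq)
  then have "enn2ereal (\<integral>\<^sup>+p. c p \<partial>\<gamma>) \<le> ?D"
    using \<open>0 \<le> d\<close> by (simp add: d)
  then have "enn2ereal (\<integral>\<^sup>+p. c p \<partial>\<gamma>) = ?D"
    using weak_duality[OF \<gamma>(1) e \<gamma>(2), of c] by simp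
  then show ?thesis
    using \<gamma> by blast
qed

text \<open>For a constant \<open>e\<close> only the value of \<open>g\<close> at \<open>0\<close>
  is seen, both in the constraint and by the point mass, and this value is the real number
  \<open>a\<close>.\<close>

lemma dual_value_eq_target:
  "dual_value BE BS c \<eta> = dual_value_target BE BS c (\<lambda>_. 0 :: real) \<eta> (return borel 0)"
proof -
  have "{ereal a | a h. h \<in> \<H> \<and> (\<forall>x y. ereal (a + h (x, y)) \<le> enn2ereal (c (x, y)))} =
    {ereal (LINT z|return borel 0. g z) | g h. g \<in> bcontfun \<and> h \<in> \<H> \<and>
       (\<forall>x y. ereal (h (x, y) + g (0::real)) \<le> enn2ereal (c (x, y)))}" (is "?A = ?B")
  proof (intro equalityI subsetI)
    fix r assume "r \<in> ?A"
    then obtain a h where r: "r = ereal a" and h: "h \<in> \<H>"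
      and le: "\<forall>x y. ereal (a + h (x, y)) \<le> enn2ereal (c (x, y))"
      by blast
    have "(LINT z|return borel (0::real). a) = a"
      by (rule integral_return) simp_all
    then have "r = ereal (LINT z|return borel (0::real). a)"
      by (simp only: r)
    moreover have "\<forall>x y. ereal (h (x, y) + a) \<le> enn2ereal (c (x, y))"
      using le by (simp add: add.commute)
    ultimately show "r \<in> ?B"
      using const_bcontfun[of a] h by blast
  next
    fix r assume "r \<in> ?B"
    then obtain g h where r: "r = ereal (LINT z|return borel 0. g z)" and g: "g \<in> bcontfun" "h \<in> \<H>"
      "\<forall>x y. ereal (h (x, y) + g (0::real)) \<le> enn2ereal (c (x, y))"
      by blast
    have "(LINT z|return borel 0. g z) = g 0"
      using g(1) by (intro integral_return) (auto simp: bcontfun_iff intro: borel_measurable_continuous_onI)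
    then have "r = ereal (g 0)"
      by (simp only: r)
    moreover have "\<forall>x y. ereal (g 0 + h (x, y)) \<le> enn2ereal (c (x, y))"
      using g(3) by (simp add: add.commute)
    ultimately show "r \<in> ?A"
      using g(2) by blast
  qed
  then show ?thesis
    by (simp add: dual_value_def dual_value_target_def)
qed

end

theorem corollary3:
  fixes BE :: "'i::linorder \<Rightarrow> 'e::polish_space measure"
    and BS :: "'i \<Rightarrow> 's::polish_space measure"
    and c :: "'e \<times> 's \<Rightarrow> ennreal"
    and e :: "'e \<times> 's \<Rightarrow> 'z::polish_space"
    and \<eta> :: "'e measure" and \<mu> :: "'z measure"
  assumes "borel_filtration BE" and "borel_filtration BS"
    and "lower_semicontinuous c"
    and "continuous_on UNIV e"
    and "\<eta> \<in> space (prob_algebra borel)" and "\<mu> \<in> space (prob_algebra borel)"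
    and "compact (UNIV :: 's set)"
    and "regular_filtration BS"
  shows "(\<exists>\<gamma>\<in>causal_plans_from BE BS \<eta>. (\<integral>\<^sup>+ p. c p \<partial>\<gamma>) = primal_value BE BS c \<eta>)
       \<and> dual_value BE BS c \<eta> = enn2ereal (primal_value BE BS c \<eta>)
       \<and> (primal_value_target BE BS c e \<eta> \<mu> < \<infinity> \<longrightarrow>
            (\<exists>\<gamma>\<in>causal_plans_from BE BS \<eta>. distr \<gamma> borel e = \<mu> \<and>
               (\<integral>\<^sup>+ p. c p \<partial>\<gamma>) = primal_value_target BE BS c e \<eta> \<mu>)
            \<and> dual_value_target BE BS c e \<eta> \<mu> = enn2ereal (primal_value_target BE BS c e \<eta> \<mu>))"
proof -
  interpret causal_setting BE BS \<eta>
    using assms by unfold_locales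
  let ?plans = "causal_plans_from BE BS \<eta>"
  \<comment> \<open>The predicate \<open>Q\<close> is the target condition, or \<open>True\<close>
    in the problem without target; a plan whose cost meets the lower bound \<open>D\<close> is a
    minimiser.\<close>
  have attained: "(\<exists>\<gamma>\<in>?plans. Q \<gamma> \<and> (\<integral>\<^sup>+p. c p \<partial>\<gamma>) = P) \<and> D = enn2ereal P"
    if P: "P = Inf {\<integral>\<^sup>+p. c p \<partial>\<gamma> | \<gamma>. \<gamma> \<in> ?plans \<and> Q \<gamma>}"
      and lower: "\<And>\<gamma>. \<gamma> \<in> ?plans \<Longrightarrow> Q \<gamma> \<Longrightarrow> D \<le> enn2ereal (\<integral>\<^sup>+p. c p \<partial>\<gamma>)"
      and optimal: "\<exists>\<gamma>\<in>?plans. Q \<gamma> \<and> enn2ereal (\<integral>\<^sup>+p. c p \<partial>\<gamma>) = D" for Q P D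
  proof -
    obtain \<gamma> where \<gamma>: "\<gamma> \<in> ?plans" "Q \<gamma>" "enn2ereal (\<integral>\<^sup>+p. c p \<partial>\<gamma>) = D"
      using optimal by blast
    have "P = (\<integral>\<^sup>+p. c p \<partial>\<gamma>)"
      unfolding P
    proof (rule cInf_eq_minimum)
      show "(\<integral>\<^sup>+p. c p \<partial>\<gamma>) \<in> {\<integral>\<^sup>+p. c p \<partial>\<gamma> | \<gamma>. \<gamma> \<in> ?plans \<and> Q \<gamma>}"
        using \<gamma>(1,2) by blast
      fix r assume "r \<in> {\<integral>\<^sup>+p. c p \<partial>\<gamma> | \<gamma>. \<gamma> \<in> ?plans \<and> Q \<gamma>}"
      then show "(\<integral>\<^sup>+p. c p \<partial>\<gamma>) \<le> r"
        using lower \<gamma>(3) by (auto simp: less_eq_ennreal.rep_eq)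
    qed
    with \<gamma> show ?thesis
      by auto
  qed
  have const: "distr \<gamma> borel (\<lambda>_. 0 :: real) = return borel 0" if "\<gamma> \<in> ?plans" for \<gamma>
  proof -
    interpret prob_space \<gamma>
      using that by (auto simp: causal_plans_from_def causal_plans_def transference_plans_def space_prob_algebra)
    show ?thesis
      by (rule distr_const) simp
  qed
  have return: "return borel (0 :: real) \<in> space (prob_algebra borel)"
    by (simp add: space_prob_algebra prob_space_return)
  have weak: "dual_value BE BS c \<eta> \<le> enn2ereal (\<integral>\<^sup>+p. c p \<partial>\<gamma>)" if "\<gamma> \<in> ?plans" for \<gamma>
    unfolding dual_value_eq_target using weak_duality[OF that continuous_on_const const[OF that]] .
  have "\<exists>\<gamma>\<in>?plans. enn2ereal (\<integral>\<^sup>+p. c p \<partial>\<gamma>) = dual_value BE BS c \<eta>"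
  proof (cases "dual_value BE BS c \<eta> < \<infinity>")
    case True
    then show ?thesis
      using strong_duality[OF assms(3) continuous_on_const return assms(7)] unfolding dual_value_eq_target by blast
  next
    case False
    \<comment> \<open>When the dual value is infinite, weak duality gives every plan infinite cost,
      so any plan is optimal; it only remains to have one.\<close>
    obtain \<gamma> where "\<gamma> \<in> ?plans"
      using causal_plan_exists by blast
    then show ?thesis
      using weak[of \<gamma>] False by (intro bexI[of _ \<gamma>]) auto
  qed
  then have first: "(\<exists>\<gamma>\<in>?plans. True \<and> (\<integral>\<^sup>+p. c p \<partial>\<gamma>) = primal_value BE BS c \<eta>) \<and>
      dual_value BE BS c \<eta> = enn2ereal (primal_value BE BS c \<eta>)"
    using weak by (intro attained) (simp_all add: primal_value_def)
  have second: "(\<exists>\<gamma>\<in>?plans. distr \<gamma> borel e = \<mu> \<and> (\<integral>\<^sup>+p. c p \<partial>\<gamma>) = primal_value_target BE BS c e \<eta> \<mu>) \<and>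
      dual_value_target BE BS c e \<eta> \<mu> = enn2ereal (primal_value_target BE BS c e \<eta> \<mu>)"
    if finite: "primal_value_target BE BS c e \<eta> \<mu> < \<infinity>"
  proof (rule attained)
    show weak: "dual_value_target BE BS c e \<eta> \<mu> \<le> enn2ereal (\<integral>\<^sup>+p. c p \<partial>\<gamma>)"
      if "\<gamma> \<in> ?plans" "distr \<gamma> borel e = \<mu>" for \<gamma>
      by (rule weak_duality[OF that(1) assms(4) that(2)])
    \<comment> \<open>Finiteness of the infimum provides a plan with image \<open>\<mu>\<close> and
      finite cost, and this cost bounds the dual value as \<open>strong_duality\<close>
      requires.\<close>
    obtain \<gamma> where \<gamma>: "\<gamma> \<in> ?plans" "distr \<gamma> borel e = \<mu>" "(\<integral>\<^sup>+p. c p \<partial>\<gamma>) < \<infinity>"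
      using finite unfolding primal_value_target_def Inf_less_iff by blast
    then have "enn2ereal (\<integral>\<^sup>+p. c p \<partial>\<gamma>) < \<infinity>"
      by (simp add: less_ennreal.rep_eq)
    then have "dual_value_target BE BS c e \<eta> \<mu> < \<infinity>"
      using weak[OF \<gamma>(1,2)] by (rule le_less_trans[rotated])
    then show "\<exists>\<gamma>\<in>?plans. distr \<gamma> borel e = \<mu> \<and> enn2ereal (\<integral>\<^sup>+p. c p \<partial>\<gamma>) = dual_value_target BE BS c e \<eta> \<mu>"
      by (rule strong_duality[OF assms(3,4,6,7)])
  qed (simp add: primal_value_target_def)
  show ?thesis
    using first second by auto
qed

end
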